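(* Let $k>2$ be an even integer and fix constants $c_1,c_2,c_3,c_4>0$. For $G\in C_c^\infty([\frac14,\frac54])$, $X\geq2$ and $\kappa,\alpha>0$ let \[S_G(X,\kappa,\alpha)=\sum_{n\in\mathbb{Z}}G\bigl(\tfrac nX\bigr)\sqrt n\sum_{\substack{l,f\geq1\\ c_1X^{\frac14-\kappa}\leq lf^2\leq c_2X^{\frac12+\kappa}}}\tfrac{1}{l^2f^3}\sum_{\substack{\xi\in\mathbb{Z}\setminus\{0\}\\ lf^2|\xi|\leq c_3X^{\frac12+\kappa}\\ |\xi|\leq c_4X^{\frac16+\kappa+\alpha}}}Kl_{l,f}(\xi,n)\,I_{l,f}(\xi,n).\] Then for every such $G$, every integer $M\geq2$ and every $\kappa,\alpha>0$ with $2\kappa+\alpha<\frac1{12}$, \[S_G(X,\kappa,\alpha)=O\Bigl(\|G\|_{M,1}\,X^{\frac{17}{12}+2\kappa+\alpha-M(\frac13-\kappa-\alpha)}\log X\Bigr),\] where $\|G\|_{M,1}=\sum_{j=0}^{M}\|G^{(j)}\|_{L^1}$ and the implied constant depends only on $k,\kappa,\alpha,M$ (and $c_1,\dots,c_4$).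
   Context: Write $e(x)=e^{2\pi i x}$. $\theta_\infty:\mathbb{R}\to\mathbb{R}$ is $\theta_\infty(x)=\tfrac{i}{2\pi}\{(x+\sqrt{x^2-1})^{k-1}-(x-\sqrt{x^2-1})^{k-1}\}$ for $|x|<1$, with $\sqrt{x^2-1}=i\sqrt{1-x^2}$, and $\theta_\infty(x)=0$ for $|x|\geq1$. $F(x)=\tfrac{1}{2K_0(2)}\int_x^\infty e^{-y-1/y}\tfrac{dy}{y}$ for $x>0$ ($K_0$ the modified Bessel function), $\tilde F$ its Mellin transform (meromorphically continued, only pole simple at $0$ with residue $1$), and for $y>0$, $H(y)=\tfrac{\sqrt\pi}{2\pi i}\int_{\Re(u)=1}\tfrac{\Gamma(\frac{1+u}{2})}{\Gamma(\frac{2-u}{2})}(\pi y)^{-u}\tilde F(u)\,du$. For positive integers $l,f,n$ and $\xi\in\mathbb{Z}$, with $t=\tfrac{lf^2(4n)^{-1/2}}{\sqrt{1-x^2}}$, \[I_{l,f}(\xi,n)=\int_{-1}^{1}\theta_\infty(x)\bigl\{F(t)+t\,H(t)\bigr\}e\Bigl(\tfrac{-x\xi\sqrt n}{2lf^2}\Bigr)dx,\quad Kl_{l,f}(\xi,n)=\sum_{\substack{a\bmod 4lf^2\\ a^2\equiv 4n\bmod f^2\\ (a^2-4n)/f^2\equiv 0,1\bmod 4}}\Bigl(\tfrac{(a^2-4n)/f^2}{l}\Bigr)e\Bigl(\tfrac{a\xi}{4lf^2}\Bigr),\] with $(\tfrac{\cdot}{l})$ the Kronecker symbol. Only $n$ with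 $G(n/X)\neq0$ (hence $n>0$) contribute. *)

theory Defs
  imports "HOL-Analysis.Analysis" "HOL-Number_Theory.Number_Theory"
begin

definition e :: "real \<Rightarrow> complex" where
  "e x = exp (2 * complex_of_real pi * \<i> * complex_of_real x)"

text \<open>For \<open>\<bar>x\<bar> < 1\<close> the two powers below are complex conjugates, so that the expression is
  real and taking the real part loses nothing; see \<open>of_real_theta_infty\<close>.\<close>

definition theta_infty :: "nat \<Rightarrow> real \<Rightarrow> real" where
  "theta_infty k x =
     (if \<bar>x\<bar> < 1
      then Re (\<i> / (2 * complex_of_real pi) *
             ((complex_of_real x + \<i> * complex_of_real (sqrt (1 - x\<^sup>2))) ^ (k - 1)
              - (complex_of_real x - \<i> * complex_of_real (sqrt (1 - x\<^sup>2))) ^ (k - 1)))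
      else 0)"

lemma of_real_theta_infty:
  assumes "\<bar>x\<bar> < 1"
  shows "complex_of_real (theta_infty k x) =
     \<i> / (2 * complex_of_real pi) *
       ((complex_of_real x + \<i> * complex_of_real (sqrt (1 - x\<^sup>2))) ^ (k - 1)
        - (complex_of_real x - \<i> * complex_of_real (sqrt (1 - x\<^sup>2))) ^ (k - 1))"
proof -
  define z where "z = (complex_of_real x + \<i> * complex_of_real (sqrt (1 - x\<^sup>2))) ^ (k - 1)"
  have cnj: "(complex_of_real x - \<i> * complex_of_real (sqrt (1 - x\<^sup>2))) ^ (k - 1) = cnj z"
    by (simp add: z_def)
  have "\<i> / (2 * complex_of_real pi) * (z - cnj z) = complex_of_real (- Im z / pi)"
    by (simp add: complex_eq_iff)
  then show ?thesis
    using assms unfolding theta_infty_def z_def [symmetric] cnj by simp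
qed

definition bessel_K :: "real \<Rightarrow> real \<Rightarrow> real" where
  "bessel_K \<nu> z = (LINT t:{0..}|lborel. exp (- z * cosh t) * cosh (\<nu> * t))"

definition F :: "real \<Rightarrow> real" where
  "F x = 1 / (2 * bessel_K 0 2) * (LINT y:{x<..}|lborel. exp (- y - 1 / y) / y)"

text \<open>The integral for the Mellin transform of \<open>F\<close> converges absolutely for \<open>Re u > 0\<close>. The
  meromorphic continuation beyond that half-plane is not needed: \<open>H\<close> only involves \<open>Re u = 1\<close>.\<close>

definition mellin :: "(real \<Rightarrow> real) \<Rightarrow> complex \<Rightarrow> complex" where
  "mellin g u =
     (LINT x:{0<..}|lborel. complex_of_real (g x) * complex_of_real x powr (u - 1))"

text \<open>Upward oriented integral over the line \<open>Re u = \<sigma>\<close>, parametrised by \<open>u = \<sigma> + \<i> t\<close>.\<close>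

definition vertical_integral :: "real \<Rightarrow> (complex \<Rightarrow> complex) \<Rightarrow> complex" where
  "vertical_integral \<sigma> g = (LINT t|lborel. g (Complex \<sigma> t) * \<i>)"

definition H :: "real \<Rightarrow> complex" where
  "H y = complex_of_real (sqrt pi) / (2 * complex_of_real pi * \<i>) *
     vertical_integral 1 (\<lambda>u. Gamma ((1 + u) / 2) / Gamma ((2 - u) / 2)
                              * complex_of_real (pi * y) powr (- u) * mellin F u)"

definition I_int :: "nat \<Rightarrow> nat \<Rightarrow> nat \<Rightarrow> int \<Rightarrow> int \<Rightarrow> complex" where
  "I_int k l f \<xi> n =
     (LINT x:{-1..1}|lborel.
        (let t = real l * (real f)\<^sup>2 * (4 * real_of_int n) powr (- 1 / 2) / sqrt (1 - x\<^sup>2)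
         in complex_of_real (theta_infty k x)
            * (complex_of_real (F t) + complex_of_real t * H t)
            * e (- x * real_of_int \<xi> * sqrt (real_of_int n) / (2 * real l * (real f)\<^sup>2))))"

text \<open>Kronecker symbol with positive lower argument.\<close>

definition kronecker_prime :: "int \<Rightarrow> nat \<Rightarrow> int" where
  "kronecker_prime D p =
     (if p = 2
      then (if even D then 0 else if D mod 8 = 1 \<or> D mod 8 = 7 then 1 else -1)
      else Legendre D (int p))"

definition kronecker :: "int \<Rightarrow> nat \<Rightarrow> int" where
  "kronecker D l = (\<Prod>p\<in>prime_factors l. kronecker_prime D p ^ multiplicity p l)"

definition Kl :: "nat \<Rightarrow> nat \<Rightarrow> int \<Rightarrow> int \<Rightarrow> complex" where
  "Kl l f \<xi> n =
     (\<Sum>a | 0 \<le> a \<and> a < 4 * int l * (int f)\<^sup>2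
           \<and> [a\<^sup>2 = 4 * n] (mod (int f)\<^sup>2)
           \<and> ([(a\<^sup>2 - 4 * n) div (int f)\<^sup>2 = 0] (mod 4)
              \<or> [(a\<^sup>2 - 4 * n) div (int f)\<^sup>2 = 1] (mod 4)).
        of_int (kronecker ((a\<^sup>2 - 4 * n) div (int f)\<^sup>2) l)
        * e (real_of_int (a * \<xi>) / (4 * real l * (real f)\<^sup>2)))"

definition nth_deriv :: "nat \<Rightarrow> (real \<Rightarrow> complex) \<Rightarrow> real \<Rightarrow> complex" where
  "nth_deriv j = (\<lambda>g x. vector_derivative g (at x)) ^^ j"

text \<open>Smooth functions on the real line with topological support in the compact set \<open>K\<close>.\<close>

definition Cc_infty :: "real set \<Rightarrow> (real \<Rightarrow> complex) set" where
  "Cc_infty K = {G. (\<forall>j x. nth_deriv j G differentiable (at x)) \<and> closure {x. G x \<noteq> 0} \<subseteq> K}"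

definition sobolev_norm :: "nat \<Rightarrow> (real \<Rightarrow> complex) \<Rightarrow> real" where
  "sobolev_norm M G = (\<Sum>j=0..M. LINT x|lborel. norm (nth_deriv j G x))"

text \<open>The sum over \<open>n\<close> runs over the integers with \<open>G (n / X) \<noteq> 0\<close>; for compactly supported \<open>G\<close>
  this is a finite set.\<close>

definition S ::
  "nat \<Rightarrow> real \<Rightarrow> real \<Rightarrow> real \<Rightarrow> real \<Rightarrow> (real \<Rightarrow> complex) \<Rightarrow> real \<Rightarrow> real \<Rightarrow> real \<Rightarrow> complex" where
  "S k c1 c2 c3 c4 G X \<kappa> \<alpha> =
     (\<Sum>n::int | G (real_of_int n / X) \<noteq> 0.
        G (real_of_int n / X) * complex_of_real (sqrt (real_of_int n)) *
        (\<Sum>(l, f) \<in> {(l::nat, f::nat). l \<ge> 1 \<and> f \<ge> 1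
             \<and> c1 * X powr (1/4 - \<kappa>) \<le> real l * (real f)\<^sup>2
             \<and> real l * (real f)\<^sup>2 \<le> c2 * X powr (1/2 + \<kappa>)}.
           1 / ((of_nat l)\<^sup>2 * (of_nat f) ^ 3) *
           (\<Sum>\<xi>::int | \<xi> \<noteq> 0
                \<and> real l * (real f)\<^sup>2 * \<bar>real_of_int \<xi>\<bar> \<le> c3 * X powr (1/2 + \<kappa>)
                \<and> \<bar>real_of_int \<xi>\<bar> \<le> c4 * X powr (1/6 + \<kappa> + \<alpha>).
              Kl l f \<xi> n * I_int k l f \<xi> n)))"

end

theory Submission
  imports
    "HOL-Probability.Sinc_Integral"
    "HOL-Probability.Characteristic_Functions"
    Defs
begin

text \<open>
  Put \<open>q = l f\<^sup>2\<close>. As a function of \<open>n\<close>, \<open>Kl l f \<xi> n\<close> has period \<open>q\<close>, and its sum over a period vanishes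
  unless \<open>2 q\<close> divides \<open>\<xi>\<close>. The latter is excluded for large \<open>X\<close>, because \<open>2 \<kappa> + \<alpha> < 1/12\<close> forces
  \<open>\<bar>\<xi>\<bar> < q\<close>. Hence the sum over \<open>n\<close> can be summed by parts \<open>M\<close> times against periodic antiderivatives
  of mean zero (this takes the place of Poisson summation), and each step gains a factor
  \<open>q / X + \<bar>\<xi>\<bar> / sqrt X\<close>. The derivatives are controlled because \<open>v \<mapsto> F (e\<^sup>v) + e\<^sup>v H (e\<^sup>v)\<close> is smooth
  with all derivatives bounded: the Mellin transform of \<open>F\<close> decays rapidly on \<open>Re u = 1\<close>, while the
  quotient of Gamma values grows only polynomially there. Before summing over \<open>n\<close>, one integration by
  parts in \<open>x\<close> saves the factor \<open>q / (\<bar>\<xi>\<bar> sqrt n)\<close>; with the trivial bound \<open>4 q\<close> for the Kloosterman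
  sum this suffices. Bounded \<open>X\<close> involve only finitely many \<open>(n, l, f, \<xi>)\<close>.
\<close>

section \<open>Kloosterman sums over a period\<close>

text \<open>The integrand depends on \<open>n\<close> through
  \<open>t = q / (2 sqrt n sqrt (1 - x^2))\<close>, which blows up at both ends of the range of
  \<open>x\<close>. In the variable \<open>ln t\<close> the point \<open>x\<close> acts only as a
  translation, so bounds valid on the whole real line make every estimate uniform in
  \<open>x\<close>. The phase \<open>e (- x \<xi> sqrt n / (2 q))\<close> is the other obstacle: as
  a function of \<open>n / X\<close>, each derivative costs about
  \<open>1 + \<bar>\<xi>\<bar> sqrt X / q\<close>, and a summation by parts contributes
  \<open>q / X\<close>; their product is the gain. The factor \<open>sqrt n\<close> of the sum is
  absorbed exactly, since integration by parts in \<open>x\<close> divides by a multiple of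
  \<open>\<xi> sqrt n / q\<close>. For one triple there remains
  \<open>X * f / \<bar>\<xi>\<bar>\<close> times the \<open>M\<close>-th power of the gain:
  \<open>q\<close> from the Kloosterman sum and \<open>q / \<bar>\<xi>\<bar>\<close> from the
  integration stand against \<open>l^2 f^3\<close>. Only \<open>L^1\<close> norms of derivatives of
  \<open>G\<close> appear because one of the \<open>M\<close> differences is bounded by an integral
  instead of a supremum.\<close>

lemma e_add: "e (x + y) = e x * e y"
  by (simp add: e_def distrib_left exp_add)

lemma norm_e [simp]: "norm (e x) = 1"
  unfolding e_def by (simp add: norm_exp_eq_Re)

lemma e_of_int [simp]: "e (of_int n) = 1"
  unfolding e_def using exp_2pi_1_int[of n] by (simp add: algebra_simps)

lemma e_eq_1_imp_Ints:
  assumes "e x = 1"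
  shows "x \<in> \<int>"
proof -
  obtain n :: int where "Im (2 * complex_of_real pi * \<i> * complex_of_real x) = of_int (2 * n) * pi"
    using assms unfolding e_def exp_eq_1 by blast
  then have "x = of_int n" by simp
  then show ?thesis by simp
qed

text \<open>The factor 4 in the modulus is for \<open>p = 2\<close>: an even \<open>l\<close> makes
  it divisible by 8, and the value at 2 depends on \<open>D\<close> modulo 8. Odd primes only use
  that \<open>p\<close> divides \<open>l\<close>.\<close>

lemma kronecker_prime_cong:
  assumes "prime p" "p dvd l" "[D = D'] (mod (4 * int l))"
  shows "kronecker_prime D p = kronecker_prime D' p"
proof (cases "p = 2")
  case True
  obtain c where "l = 2 * c" using assms True by auto
  then have "8 dvd 4 * int l" by simp
  then have m8: "D mod 8 = D' mod 8" using assms(3) unfolding cong_def by (metis mod_mod_cancel)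
  then have "even D = even D'" by presburger
  then show ?thesis using True m8 by (simp add: kronecker_prime_def)
next
  case False
  have "int p dvd 4 * int l" using assms(2) by auto
  then have "[D = D'] (mod int p)" using assms(3) cong_dvd_modulus by blast
  then have "Legendre D (int p) = Legendre D' (int p)"
    unfolding Legendre_def QuadRes_def cong_def by simp
  then show ?thesis using False by (simp add: kronecker_prime_def)
qed

lemma kronecker_cong:
  assumes "[D = D'] (mod (4 * int l))"
  shows "kronecker D l = kronecker D' l"
  unfolding kronecker_def
  by (intro prod.cong refl arg_cong2[where f = power] kronecker_prime_cong[OF _ _ assms])
     (auto simp: in_prime_factors_iff)

lemma abs_kronecker_le: "\<bar>kronecker D l\<bar> \<le> 1"
proof -
  have "\<bar>kronecker_prime D p\<bar> \<le> 1" for p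
    by (auto simp: kronecker_prime_def Legendre_def)
  then show ?thesis unfolding kronecker_def abs_prod
    by (intro prod_le_1) (auto simp: power_abs power_le_one)
qed

text \<open>The side conditions become the value 0, so that sums over \<open>a\<close> run over a
  full residue system independent of \<open>n\<close> and can be exchanged with sums over
  \<open>n\<close>.\<close>

definition Kl_coeff :: "nat \<Rightarrow> nat \<Rightarrow> int \<Rightarrow> int \<Rightarrow> complex" where
  "Kl_coeff l f a n =
     (if [a\<^sup>2 = 4 * n] (mod (int f)\<^sup>2)
         \<and> ([(a\<^sup>2 - 4 * n) div (int f)\<^sup>2 = 0] (mod 4)
            \<or> [(a\<^sup>2 - 4 * n) div (int f)\<^sup>2 = 1] (mod 4))
      then of_int (kronecker ((a\<^sup>2 - 4 * n) div (int f)\<^sup>2) l) else 0)"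

lemma Kl_eq: "Kl l f \<xi> n = (\<Sum>a\<in>{0..<4 * int l * (int f)\<^sup>2}.
    Kl_coeff l f a n * e (real_of_int (a * \<xi>) / (4 * real l * (real f)\<^sup>2)))"
proof -
  have "Kl l f \<xi> n = (\<Sum>a\<in>{a \<in> {0..<4 * int l * (int f)\<^sup>2}. [a\<^sup>2 = 4 * n] (mod (int f)\<^sup>2)
         \<and> ([(a\<^sup>2 - 4 * n) div (int f)\<^sup>2 = 0] (mod 4)
            \<or> [(a\<^sup>2 - 4 * n) div (int f)\<^sup>2 = 1] (mod 4))}.
     of_int (kronecker ((a\<^sup>2 - 4 * n) div (int f)\<^sup>2) l) * e (real_of_int (a * \<xi>) / (4 * real l * (real f)\<^sup>2)))"
    unfolding Kl_def by (rule sum.cong) auto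
  then show ?thesis
    by (simp only: sum.inter_filter[OF finite_atLeastLessThan_int]) (auto simp: Kl_coeff_def intro!: sum.cong)
qed

text \<open>Adding \<open>l f^2\<close> to \<open>n\<close> lowers \<open>(a^2 - 4 n) / f^2\<close>
  by exactly \<open>4 l\<close>. This changes neither its class modulo 4 nor, by
  \<open>kronecker_cong\<close>, the symbol; hence the period is \<open>l f^2\<close> although
  \<open>a\<close> runs modulo \<open>4 l f^2\<close>.\<close>

lemma Kl_coeff_shift:
  assumes "f > 0"
  shows "Kl_coeff l f a (n + int l * (int f)\<^sup>2) = Kl_coeff l f a n"
proof -
  let ?D = "(a\<^sup>2 - 4 * n) div (int f)\<^sup>2"
  have eq: "a\<^sup>2 - 4 * (n + int l * (int f)\<^sup>2) = (a\<^sup>2 - 4 * n) + (- 4 * int l) * (int f)\<^sup>2"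
    by (simp add: algebra_simps)
  have D: "(a\<^sup>2 - 4 * (n + int l * (int f)\<^sup>2)) div (int f)\<^sup>2 = ?D - 4 * int l"
    unfolding eq using assms by (subst div_mult_self1) auto
  have c1: "[a\<^sup>2 = 4 * (n + int l * (int f)\<^sup>2)] (mod (int f)\<^sup>2) \<longleftrightarrow> [a\<^sup>2 = 4 * n] (mod (int f)\<^sup>2)"
  proof -
    have "4 * (n + int l * (int f)\<^sup>2) = 4 * n + (4 * int l) * (int f)\<^sup>2" by (simp add: algebra_simps)
    then show ?thesis unfolding cong_def by (simp only: mod_mult_self1)
  qed
  have c2: "[d - 4 * int l = b] (mod 4) \<longleftrightarrow> [d = b] (mod 4)" for b d
  proof -
    have "(d - 4 * int l) mod 4 = d mod 4" by presburger
    then show ?thesis by (simp add: cong_def)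
  qed
  have "kronecker (?D - 4 * int l) l = kronecker ?D l"
    by (rule kronecker_cong) (simp add: cong_def mod_diff_right_eq[symmetric])
  then show ?thesis unfolding Kl_coeff_def D c1 c2 by (simp only:)
qed

lemma Kl_periodic:
  assumes "f > 0"
  shows "Kl l f \<xi> (n + int l * (int f)\<^sup>2) = Kl l f \<xi> n"
  unfolding Kl_eq by (simp add: Kl_coeff_shift[OF assms])

lemma norm_Kl_le: "norm (Kl l f \<xi> n) \<le> 4 * real l * (real f)\<^sup>2"
proof -
  have "norm (Kl_coeff l f a n) \<le> 1" for a
  proof -
    have "\<bar>real_of_int (kronecker D l)\<bar> \<le> 1" for D using abs_kronecker_le[of D l] by linarith
    then show ?thesis by (simp add: Kl_coeff_def)
  qed
  then have "norm (Kl l f \<xi> n) \<le> (\<Sum>a\<in>{0..<4 * int l * (int f)\<^sup>2}. 1)"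
    unfolding Kl_eq by (intro order_trans[OF norm_sum] sum_mono) (auto simp: norm_mult)
  also have "\<dots> = 4 * real l * (real f)\<^sup>2"
  proof -
    have "real (nat (4 * int l * (int f)\<^sup>2)) = real_of_int (4 * int l * (int f)\<^sup>2)" by (subst of_nat_nat) auto
    then show ?thesis by simp
  qed
  finally show ?thesis .
qed

lemma sum_int_periodic_shift:
  fixes g :: "int \<Rightarrow> 'a::ab_group_add"
  assumes per: "\<And>n. g (n + q) = g n" and q: "q \<ge> 0"
  shows "(\<Sum>n\<in>{0..<q}. g (n + c)) = (\<Sum>n\<in>{0..<q}. g n)"
proof -
  have 1: "(\<Sum>n\<in>{0..<q}. g (n + (d + 1))) = (\<Sum>n\<in>{0..<q}. g (n + d))" for d
  proof -
    have "(\<Sum>n\<in>{0..<q}. g (n + (d + 1))) = (\<Sum>n\<in>{1..<q+1}. g (n + d))"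
      by (rule sum.reindex_bij_witness[of _ "\<lambda>n. n - 1" "\<lambda>n. n + 1"]) (auto simp: add_ac)
    also have "\<dots> = (\<Sum>n\<in>{0..<q}. g (n + d))"
    proof (cases "q = 0")
      case False
      have "{1..<q+1} = insert q {1..<q}" "{0..<q} = insert 0 {1..<q}" using q False by auto
      then show ?thesis using per[of d] by (simp add: add.commute)
    qed auto
    finally show ?thesis .
  qed
  show ?thesis
  proof (induction c rule: int_induct[of _ 0])
    case (step1 i) then show ?case using 1[of i] by simp
  next
    case (step2 i) then show ?case using 1[of "i - 1"] by simp
  qed auto
qed

text \<open>The map \<open>(a, n) \<mapsto> (a + 2, n + a + 1)\<close> preserves the discriminant \<open>a\<^sup>2 - 4 n\<close>, so the sum over
  \<open>n\<close> of the coefficient depends only on the parity of \<open>a\<close>.\<close>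

lemma Kl_sum_period_eq_0:
  assumes "l > 0" "f > 0" "\<xi> \<noteq> 0" "\<bar>\<xi>\<bar> < int l * (int f)\<^sup>2"
  shows "(\<Sum>n\<in>{0..<int l * (int f)\<^sup>2}. Kl l f \<xi> n) = 0"
proof -
  define q where "q = int l * (int f)\<^sup>2"
  have q: "q > 0" using assms by (simp add: q_def)
  define c where "c a = (\<Sum>n\<in>{0..<q}. Kl_coeff l f a n)" for a
  define E where "E a = e (real_of_int (a * \<xi>) / (4 * real_of_int q))" for a
  have qr: "4 * real l * (real f)\<^sup>2 = 4 * real_of_int q" by (simp add: q_def)
  have c2: "c (a + 2) = c a" for a
  proof -
    have "c (a + 2) = (\<Sum>n\<in>{0..<q}. Kl_coeff l f (a + 2) (n + (a + 1)))"
      unfolding c_def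
      by (rule sum_int_periodic_shift[symmetric]) (use Kl_coeff_shift[OF assms(2)] q in \<open>auto simp: q_def\<close>)
    also have "\<dots> = c a"
    proof -
      have k: "Kl_coeff l f (a + 2) (n + (a + 1)) = Kl_coeff l f a n" for n
      proof -
        have d: "(a + 2)\<^sup>2 - 4 * (n + (a + 1)) = a\<^sup>2 - 4 * n" by (simp add: power2_eq_square algebra_simps)
        have "[(a + 2)\<^sup>2 = 4 * (n + (a + 1))] (mod (int f)\<^sup>2) \<longleftrightarrow> [a\<^sup>2 = 4 * n] (mod (int f)\<^sup>2)"
          unfolding cong_iff_dvd_diff d ..
        then show ?thesis unfolding Kl_coeff_def d by simp
      qed
      then show ?thesis by (simp add: c_def)
    qed
    finally show ?thesis .
  qed
  have c_even: "c (a + 2 * b) = c a" for a b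
  proof (induction b rule: int_induct[of _ 0])
    case (step1 i) then show ?case using c2[of "a + 2 * i"] by (simp add: algebra_simps)
  next
    case (step2 i) then show ?case using c2[of "a + 2 * (i - 1)"] by (simp add: algebra_simps)
  qed auto
  define T where "T = (\<Sum>a\<in>{0..<4*q}. c a * E a)"
  have E2: "E (a + b) = E a * E b" for a b
    unfolding E_def e_add[symmetric] by (simp add: add_divide_distrib distrib_right)
  have E4q: "E (4 * q) = 1"
  proof -
    have "real_of_int (4 * q * \<xi>) / (4 * real_of_int q) = real_of_int \<xi>" using q by simp
    then show ?thesis unfolding E_def by (metis e_of_int)
  qed
  \<comment> \<open>Translating \<open>a\<close> by 2 leaves \<open>c\<close> fixed and multiplies
    the character by \<open>E 2\<close>, that is \<open>e (\<xi> / (2 q))\<close>. So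
    \<open>T\<close> vanishes as soon as this root of unity differs from 1.\<close>
  have "T = (\<Sum>a\<in>{0..<4*q}. c (a + 2) * E (a + 2))"
    unfolding T_def
    by (rule sum_int_periodic_shift[symmetric]) (use q c_even[of _ "2 * q"] E4q E2 in auto)
  also have "\<dots> = T * E 2"
    unfolding T_def by (simp add: c2 E2 sum_distrib_right mult.assoc)
  finally have TE: "T * (1 - E 2) = 0" by (simp add: algebra_simps)
  have "E 2 \<noteq> 1"
  proof
    assume "E 2 = 1"
    then have "real_of_int (2 * \<xi>) / (4 * real_of_int q) \<in> \<int>" unfolding E_def by (rule e_eq_1_imp_Ints)
    then obtain j where j: "real_of_int (2 * \<xi>) / (4 * real_of_int q) = of_int j" by (elim Ints_cases)
    then have "real_of_int (2 * \<xi>) = of_int (4 * q * j)" using q by (simp add: field_simps)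
    then have "\<xi> = 2 * q * j" by linarith
    moreover from this assms(3) have "\<bar>j\<bar> \<ge> 1" by auto
    ultimately have "\<bar>\<xi>\<bar> \<ge> 2 * q" using q by (simp add: abs_mult)
    then show False using assms(4) q unfolding q_def[symmetric] by linarith
  qed
  then have "T = 0" using TE by simp
  moreover have "(\<Sum>n\<in>{0..<q}. Kl l f \<xi> n) = T"
  proof -
    have q4: "4 * int l * (int f)\<^sup>2 = 4 * q" by (simp add: q_def)
    have "(\<Sum>n\<in>{0..<q}. Kl l f \<xi> n) = (\<Sum>n\<in>{0..<q}. \<Sum>a\<in>{0..<4*q}. Kl_coeff l f a n * E a)"
      unfolding Kl_eq qr q4 E_def ..
    also have "\<dots> = T" unfolding T_def c_def by (subst sum.swap) (simp add: sum_distrib_right)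
    finally show ?thesis .
  qed
  ultimately show ?thesis by (simp add: q_def)
qed

section \<open>Functions with bounded derivatives and summation by parts\<close>

text \<open>\<open>deriv_bounded A m K L g\<close> says that \<open>\<bar>g\<^sup>(\<^sup>j\<^sup>)\<bar> \<le> K L\<^sup>j\<close> on \<open>A\<close> for all \<open>j \<le> m\<close>.\<close>

primrec deriv_bounded ::
  "real set \<Rightarrow> nat \<Rightarrow> (real \<Rightarrow> real) \<Rightarrow> real \<Rightarrow> (real \<Rightarrow> complex) \<Rightarrow> bool" where
  "deriv_bounded A 0 K L g = (\<forall>z\<in>A. norm (g z) \<le> K z)"
| "deriv_bounded A (Suc m) K L g =
     ((\<forall>z\<in>A. norm (g z) \<le> K z) \<and>
      (\<exists>g'. (\<forall>z\<in>A. (g has_vector_derivative g' z) (at z)) \<and>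
            deriv_bounded A m (\<lambda>z. K z * L) L g'))"

lemma deriv_bounded_norm: "deriv_bounded A m K L g \<Longrightarrow> z \<in> A \<Longrightarrow> norm (g z) \<le> K z"
  by (cases m) auto

lemma deriv_bounded_SucE:
  assumes "deriv_bounded A (Suc m) K L g"
  obtains g' where "\<And>z. z \<in> A \<Longrightarrow> (g has_vector_derivative g' z) (at z)"
    "deriv_bounded A m (\<lambda>z. K z * L) L g'"
  using assms unfolding deriv_bounded.simps by blast

lemma deriv_bounded_mono:
  assumes "deriv_bounded A m K L g" "\<And>z. z \<in> A \<Longrightarrow> K z \<le> K' z" "\<And>z. z \<in> A \<Longrightarrow> 0 \<le> K z"
    "0 \<le> L" "L \<le> L'"
  shows "deriv_bounded A m K' L' g"
  using assms
proof (induction m arbitrary: K K' g)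
  case 0
  then show ?case by force
next
  case (Suc m)
  from Suc.prems(1) obtain g' where g': "\<And>z. z \<in> A \<Longrightarrow> (g has_vector_derivative g' z) (at z)"
    "deriv_bounded A m (\<lambda>z. K z * L) L g'" by (rule deriv_bounded_SucE) blast
  have "deriv_bounded A m (\<lambda>z. K' z * L') L' g'"
    by (rule Suc.IH[OF g'(2)]) (use Suc.prems in \<open>auto intro!: mult_mono intro: order_trans\<close>)
  then show ?case using g'(1) Suc.prems(1,2) by force
qed

lemma deriv_bounded_Suc_D:
  "deriv_bounded A (Suc m) K L g \<Longrightarrow> deriv_bounded A m K L g"
proof (induction m arbitrary: K g)
  case (Suc m)
  then show ?case unfolding deriv_bounded.simps(2)[of A "Suc m"] by (subst deriv_bounded.simps) blast
qed auto

lemma deriv_bounded_subset: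
  assumes "deriv_bounded A m K L g" "B \<subseteq> A"
  shows "deriv_bounded B m K L g"
  using assms(1)
proof (induction m arbitrary: K g)
  case 0
  then show ?case using assms(2) by auto
next
  case (Suc m)
  from Suc.prems obtain g' where g': "\<And>z. z \<in> A \<Longrightarrow> (g has_vector_derivative g' z) (at z)"
    "deriv_bounded A m (\<lambda>z. K z * L) L g'" by (rule deriv_bounded_SucE) blast
  then show ?case
    using Suc.IH[OF g'(2)] deriv_bounded_norm[OF Suc.prems] assms(2)
    unfolding deriv_bounded.simps by blast
qed

lemma deriv_bounded_add:
  assumes "deriv_bounded A m K L g" "deriv_bounded A m K' L h"
  shows "deriv_bounded A m (\<lambda>z. K z + K' z) L (\<lambda>z. g z + h z)"
  using assms
proof (induction m arbitrary: K K' g h)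
  case 0
  then show ?case by (auto intro!: norm_triangle_mono)
next
  case (Suc m)
  from Suc.prems(1) obtain g' where g': "\<And>z. z \<in> A \<Longrightarrow> (g has_vector_derivative g' z) (at z)"
    "deriv_bounded A m (\<lambda>z. K z * L) L g'" by (rule deriv_bounded_SucE) blast
  from Suc.prems(2) obtain h' where h': "\<And>z. z \<in> A \<Longrightarrow> (h has_vector_derivative h' z) (at z)"
    "deriv_bounded A m (\<lambda>z. K' z * L) L h'" by (rule deriv_bounded_SucE) blast
  have "deriv_bounded A m (\<lambda>z. (K z + K' z) * L) L (\<lambda>z. g' z + h' z)"
    using Suc.IH[OF g'(2) h'(2)] by (simp add: distrib_right)
  moreover have "\<forall>z\<in>A. norm (g z + h z) \<le> K z + K' z"
    using Suc.prems by (auto intro!: norm_triangle_mono)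
  ultimately show ?case using g'(1) h'(1)
    by (auto intro!: exI[of _ "\<lambda>z. g' z + h' z"] has_vector_derivative_add)
qed

text \<open>The Leibniz rule and the binomial theorem combine the bounds to
  \<open>(L + L') ^ j\<close>: rates add while the leading bounds multiply.\<close>

lemma deriv_bounded_mult:
  assumes "deriv_bounded A m K L g" "deriv_bounded A m K' L' h"
  shows "deriv_bounded A m (\<lambda>z. K z * K' z) (L + L') (\<lambda>z. g z * h z)"
  using assms
proof (induction m arbitrary: K K' g h)
  case 0
  then show ?case by (auto simp: norm_mult intro!: mult_mono intro: order_trans[OF norm_ge_zero])
next
  case (Suc m)
  from Suc.prems(1) obtain g' where g': "\<And>z. z \<in> A \<Longrightarrow> (g has_vector_derivative g' z) (at z)"
    "deriv_bounded A m (\<lambda>z. K z * L) L g'" by (rule deriv_bounded_SucE) blast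
  from Suc.prems(2) obtain h' where h': "\<And>z. z \<in> A \<Longrightarrow> (h has_vector_derivative h' z) (at z)"
    "deriv_bounded A m (\<lambda>z. K' z * L') L' h'" by (rule deriv_bounded_SucE) blast
  have *: "deriv_bounded A m K L g" "deriv_bounded A m K' L' h"
    using Suc.prems by (auto dest: deriv_bounded_Suc_D simp del: deriv_bounded.simps)
  have "deriv_bounded A m (\<lambda>z. K z * K' z * (L + L')) (L + L') (\<lambda>z. g z * h' z + g' z * h z)"
    using deriv_bounded_add[OF Suc.IH[OF *(1) h'(2)] Suc.IH[OF g'(2) *(2)]]
    by (simp add: algebra_simps)
  moreover have "\<forall>z\<in>A. norm (g z * h z) \<le> K z * K' z"
    using Suc.prems by (auto simp: norm_mult intro!: mult_mono intro: order_trans[OF norm_ge_zero])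
  ultimately show ?case using g'(1) h'(1)
    by (auto intro!: exI[of _ "\<lambda>z. g z * h' z + g' z * h z"] has_vector_derivative_mult)
qed

lemma deriv_bounded_const: "deriv_bounded A m (\<lambda>_. norm c) 0 (\<lambda>_. c)"
proof -
  have z: "deriv_bounded A m (\<lambda>_. 0) 0 (\<lambda>_. 0)" for m
    by (induction m) (auto intro!: exI[of _ "\<lambda>_. 0"])
  show ?thesis
    by (cases m) (auto intro!: exI[of _ "\<lambda>_. 0"] z)
qed

lemma deriv_bounded_cmult:
  "deriv_bounded A m K L g \<Longrightarrow> deriv_bounded A m (\<lambda>z. norm c * K z) L (\<lambda>z. c * g z)"
  using deriv_bounded_mult[OF deriv_bounded_const[of A m c], of K L g] by simp

text \<open>In a derivative of \<open>g (u z)\<close> the next differentiation hits either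
  \<open>g\<close>, at cost \<open>L * K'\<close>, or one of at most \<open>m\<close> factors coming
  from \<open>u'\<close>, at cost \<open>L'\<close> each. The rate is linear in \<open>L\<close>,
  which later keeps the dependence on the frequency linear.\<close>

lemma deriv_bounded_compose:
  fixes u :: "real \<Rightarrow> real" and K K' L L' :: real
  assumes "deriv_bounded UNIV m (\<lambda>_. K) L g" "deriv_bounded A m (\<lambda>_. K') L' (\<lambda>z. complex_of_real (u' z))"
    "\<And>z. z \<in> A \<Longrightarrow> (u has_real_derivative u' z) (at z)" "K \<ge> 0" "K' \<ge> 0" "L \<ge> 0" "L' \<ge> 0"
  shows "deriv_bounded A m (\<lambda>_. K) (L * K' + m * L') (\<lambda>z. g (u z))"
  using assms
proof (induction m arbitrary: K g)
  case 0
  then show ?case by auto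
next
  case (Suc m)
  obtain g' where g': "\<And>z. (g has_vector_derivative g' z) (at z)"
    "deriv_bounded UNIV m (\<lambda>z. K * L) L g'" using Suc.prems(1) by auto
  have u: "deriv_bounded A m (\<lambda>_. K') L' (\<lambda>z. complex_of_real (u' z))"
    using Suc.prems(2) by (rule deriv_bounded_Suc_D)
  have "deriv_bounded A m (\<lambda>_. K * L) (L * K' + m * L') (\<lambda>z. g' (u z))"
    using Suc.IH[OF g'(2) u Suc.prems(3)] Suc.prems by auto
  from deriv_bounded_mult[OF u this]
  have "deriv_bounded A m (\<lambda>_. K' * (K * L)) (L' + (L * K' + m * L')) (\<lambda>z. u' z * g' (u z))" .
  then have d: "deriv_bounded A m (\<lambda>_. K * (L * K' + Suc m * L')) (L * K' + Suc m * L') (\<lambda>z. u' z * g' (u z))"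
    by (rule deriv_bounded_mono) (use Suc.prems in \<open>auto simp: algebra_simps\<close>)
  have "((\<lambda>z. g (u z)) has_vector_derivative (u' z * g' (u z))) (at z)" if "z \<in> A" for z
    using vector_diff_chain_at[of u "u' z" z g "g' (u z)"] g'(1) Suc.prems(3)[OF that]
    by (simp add: o_def scaleR_conv_of_real has_real_derivative_iff_has_vector_derivative)
  then show ?case using d Suc.prems(1)
    by (auto intro!: exI[of _ "\<lambda>z. u' z * g' (u z)"])
qed

lemma deriv_bounded_transform:
  assumes "deriv_bounded A m K L g" "open A" "\<And>z. z \<in> A \<Longrightarrow> g z = h z"
  shows "deriv_bounded A m K L h"
proof (cases m)
  case 0
  then show ?thesis using assms by auto
next
  case (Suc n)
  then obtain g' where g': "\<And>z. z \<in> A \<Longrightarrow> (g has_vector_derivative g' z) (at z)"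
    "deriv_bounded A n (\<lambda>z. K z * L) L g'" using assms by auto
  have "(h has_vector_derivative g' z) (at z)" if "z \<in> A" for z
    using has_vector_derivative_transform_within_open[OF g'(1)[OF that] assms(2) that] assms(3) by auto
  then show ?thesis using Suc assms g'(2) by auto
qed

text \<open>The weights contain \<open>ln z\<close> and \<open>sqrt z\<close>, which are smooth only
  for positive \<open>z\<close>. Off \<open>T\<close> the derivative is 0, so the derivative on
  \<open>A\<close>, cut down to \<open>T\<close>, is one on the whole line.\<close>

lemma deriv_bounded_extend:
  assumes "deriv_bounded A m K L g" "open A" "closed T" "T \<subseteq> A"
    "\<And>z. z \<notin> T \<Longrightarrow> g z = 0" "\<And>z. K z \<ge> 0" "L \<ge> 0"
  shows "deriv_bounded UNIV m K L g"
  using assms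
proof (induction m arbitrary: K g)
  case 0
  then show ?case by (auto, metis norm_zero subsetD)
next
  case (Suc m)
  from Suc.prems(1) obtain g' where g': "\<And>z. z \<in> A \<Longrightarrow> (g has_vector_derivative g' z) (at z)"
    "deriv_bounded A m (\<lambda>z. K z * L) L g'" by (rule deriv_bounded_SucE) blast
  define g2 where "g2 z = (if z \<in> T then g' z else 0)" for z
  have d0: "(g has_vector_derivative 0) (at z)" if "z \<notin> T" for z
  proof -
    have "open (- T)" using Suc.prems by auto
    show ?thesis
      by (rule has_vector_derivative_transform_within_open[of "\<lambda>_. 0" 0 _ "- T"])
        (use that Suc.prems \<open>open (- T)\<close> in auto)
  qed
  have eq: "g' z = g2 z" if "z \<in> A" for z
    using d0[of z] g'(1)[OF that] vector_derivative_unique_at by (auto simp: g2_def)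
  have "deriv_bounded A m (\<lambda>z. K z * L) L g2"
    using deriv_bounded_transform[OF g'(2) Suc.prems(2) eq] .
  then have "deriv_bounded UNIV m (\<lambda>z. K z * L) L g2"
    by (rule Suc.IH) (use Suc.prems in \<open>auto simp: g2_def\<close>)
  moreover have "(g has_vector_derivative g2 z) (at z)" for z
    using d0[of z] g'(1)[of z] Suc.prems(4) by (auto simp: g2_def)
  moreover have "norm (g z) \<le> K z" for z
    using Suc.prems by (cases "z \<in> T") auto
  ultimately show ?case by auto
qed

text \<open>Differentiation only changes \<open>p\<close> and the scalar \<open>c\<close>, so the
  induction runs over all of them. Away from 0 the powers are bounded, and \<open>K\<close> absorbs
  all constants, which allows the rate 1.\<close>

lemma deriv_bounded_powr:
  assumes "A \<subseteq> {a..b}" "a > 0"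
  shows "\<exists>K\<ge>0. deriv_bounded A m (\<lambda>_. K) 1 (\<lambda>z. complex_of_real (c * z powr p))"
proof (induction m arbitrary: p c)
  have bnd: "norm (complex_of_real (c * z powr p)) \<le> \<bar>c\<bar> * (a powr p + b powr p)"
    if "z \<in> A" for z c p
  proof -
    have "z powr p \<le> a powr p + b powr p"
    proof (cases "p \<ge> 0")
      case True
      then have "z powr p \<le> b powr p" using that assms by (intro powr_mono2) auto
      then show ?thesis using powr_ge_zero[of a p] by linarith
    next
      case False
      then have "z powr p \<le> a powr p" using that assms by (intro powr_mono2') auto
      then show ?thesis using powr_ge_zero[of b p] by linarith
    qed
    then show ?thesis by (auto simp: norm_mult intro!: mult_left_mono)
  qed
  case 0
  show ?case by (rule exI[of _ "\<bar>c\<bar> * (a powr p + b powr p)"]) (use bnd in auto)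
  case (Suc m)
  obtain K where K: "K \<ge> 0" "deriv_bounded A m (\<lambda>_. K) 1 (\<lambda>z. complex_of_real (c * p * z powr (p - 1)))"
    using Suc.IH[of "c * p" "p - 1"] by (auto simp: mult.assoc)
  define K' where "K' = K + \<bar>c\<bar> * (a powr p + b powr p)"
  have K': "K' \<ge> 0" "K \<le> K'" "\<bar>c\<bar> * (a powr p + b powr p) \<le> K'" using K unfolding K'_def by auto
  have "((\<lambda>z. complex_of_real (c * z powr p)) has_vector_derivative complex_of_real (c * p * z powr (p - 1))) (at z)"
    if "z \<in> A" for z
  proof -
    have "z > 0" using that assms by auto
    then have "((\<lambda>z. c * z powr p) has_real_derivative (c * p * z powr (p - 1))) (at z)"
      by (auto intro!: derivative_eq_intros)
    then show ?thesis
      by (intro has_vector_derivative_of_real) (simp add: has_real_derivative_iff_has_vector_derivative)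
  qed
  moreover have "deriv_bounded A m (\<lambda>_. K' * 1) 1 (\<lambda>z. complex_of_real (c * p * z powr (p - 1)))"
    by (rule deriv_bounded_mono[OF K(2)]) (use K K' in auto)
  ultimately show ?case using K' bnd[of _ c p]
    by (intro exI[of _ K']) (force intro!: exI[of _ "\<lambda>z. complex_of_real (c * p * z powr (p - 1))"] intro: order_trans)
qed

section \<open>Iterated finite differences\<close>

definition fdiff :: "real \<Rightarrow> (real \<Rightarrow> complex) \<Rightarrow> real \<Rightarrow> complex" where
  "fdiff h g y = g (y + h) - g y"

lemma fdiff_pow_vector_derivative:
  assumes "\<And>z. (g has_vector_derivative g' z) (at z)"
  shows "((fdiff h ^^ m) g has_vector_derivative (fdiff h ^^ m) g' z) (at z)"
  using assms
proof (induction m arbitrary: g g' z)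
  case (Suc m)
  have sh: "((\<lambda>y. g (y + h)) has_vector_derivative g' (z + h)) (at z)" for z
  proof -
    have "((\<lambda>y. y + h) has_vector_derivative 1) (at z)"
      unfolding has_real_derivative_iff_has_vector_derivative[symmetric] by (auto intro!: derivative_eq_intros)
    from vector_diff_chain_at[OF this Suc.prems] show ?thesis by (simp add: o_def)
  qed
  have "(fdiff h g has_vector_derivative fdiff h g' z) (at z)" for z
    unfolding fdiff_def [abs_def] by (rule has_vector_derivative_diff[OF sh Suc.prems])
  from Suc.IH[OF this] show ?case by (simp add: funpow_Suc_right del: funpow.simps)
qed auto

text \<open>The \<open>m\<close>-th difference of \<open>g\<close> has the \<open>m\<close>-th
  difference of \<open>g'\<close> as its derivative, so the mean value inequality peels off one more
  difference.\<close>

lemma fdiff_pow_Suc_bound: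
  fixes h y B :: real
  assumes g: "\<And>z. (g has_vector_derivative g' z) (at z)" and h: "h \<ge> 0"
    and B: "\<And>z. y \<le> z \<Longrightarrow> z \<le> y + h \<Longrightarrow> norm ((fdiff h ^^ m) g' z) \<le> B"
  shows "norm ((fdiff h ^^ Suc m) g y) \<le> h * B"
proof -
  let ?v = "(fdiff h ^^ m) g"
  have "norm (?v (y + h) - ?v y) \<le> B * norm (y + h - y)"
  proof (rule differentiable_bound[where S = "{y..y+h}" and f' = "\<lambda>z t. t *\<^sub>R (fdiff h ^^ m) g' z"])
    show "(?v has_derivative (\<lambda>t. t *\<^sub>R (fdiff h ^^ m) g' z)) (at z within {y..y+h})" for z
      using fdiff_pow_vector_derivative[OF g, where h = h and m = m and z = z]
      by (simp add: has_vector_derivative_def has_derivative_at_withinI)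
    fix z assume "z \<in> {y..y+h}"
    then show "onorm (\<lambda>t. t *\<^sub>R (fdiff h ^^ m) g' z) \<le> B"
      using B[of z] order_trans[OF norm_ge_zero B[of z]]
      by (intro onorm_bound) (auto simp: mult.commute[of B] intro!: mult_left_mono)
  qed (use h in auto)
  then show ?thesis using h by (simp add: fdiff_def mult.commute)
qed

text \<open>The differences look only to the right of \<open>y\<close>, so for decreasing
  \<open>K\<close> its value at \<open>y\<close> dominates throughout. This version serves the decay
  of the Mellin transform.\<close>

lemma fdiff_pow_bound_antimono:
  fixes h y :: real
  assumes "deriv_bounded UNIV m K L g" "antimono K" "h \<ge> 0" "L \<ge> 0"
  shows "norm ((fdiff h ^^ m) g y) \<le> (h * L) ^ m * K y"
  using assms
proof (induction m arbitrary: K g y)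
  case 0
  then show ?case by auto
next
  case (Suc m)
  then obtain g' where g': "\<And>z. (g has_vector_derivative g' z) (at z)"
    "deriv_bounded UNIV m (\<lambda>z. K z * L) L g'" by auto
  have anti: "antimono (\<lambda>z. K z * L)" using Suc.prems by (auto simp: antimono_def intro!: mult_right_mono)
  have "norm ((fdiff h ^^ Suc m) g y) \<le> h * ((h * L) ^ m * (K y * L))"
  proof (rule fdiff_pow_Suc_bound[OF g'(1) Suc.prems(3)])
    fix z assume "y \<le> z"
    then have "K z * L \<le> K y * L" using anti by (auto simp: antimono_def)
    then have "(h * L) ^ m * (K z * L) \<le> (h * L) ^ m * (K y * L)"
      using Suc.prems by (intro mult_left_mono) auto
    with Suc.IH[OF g'(2) anti, of z] show "norm ((fdiff h ^^ m) g' z) \<le> (h * L) ^ m * (K y * L)"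
      using Suc.prems by auto
  qed
  then show ?case by (simp add: algebra_simps)
qed

text \<open>One difference is estimated by an increment of the antiderivative \<open>D\<close> and
  not by the mean value inequality, hence only \<open>h ^ m\<close> appears. Summed over
  \<open>n\<close> these increments telescope, which is how an \<open>L^1\<close> norm replaces a
  supremum.\<close>

lemma fdiff_pow_bound_integral:
  fixes h y :: real
  assumes "deriv_bounded UNIV (Suc m) K L g" "\<And>z. (D has_real_derivative K z) (at z)"
    "\<And>z. K z \<ge> 0" "h \<ge> 0" "L \<ge> 0"
  shows "norm ((fdiff h ^^ Suc m) g y) \<le> h ^ m * L ^ Suc m * (D (y + Suc m * h) - D y)"
  using assms
proof (induction m arbitrary: K g y D)
  case 0
  then obtain g' where g': "\<And>z. (g has_vector_derivative g' z) (at z)"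
    "\<And>z. norm (g' z) \<le> K z * L" by auto
  have "norm (g (y + h) - g y) \<le> L * D (y + h) - L * D y"
  proof (cases "h = 0")
    case False
    show ?thesis
    proof (rule differentiable_bound_general[where f' = g' and \<phi>' = "\<lambda>z. K z * L"])
      show "continuous_on {y..y+h} g"
        by (intro continuous_at_imp_continuous_on ballI) (meson g'(1) has_vector_derivative_continuous)
      show "continuous_on {y..y+h} (\<lambda>z. L * D z)"
        by (intro continuous_intros continuous_at_imp_continuous_on ballI) (meson "0"(2) DERIV_isCont)
      show "((\<lambda>z. L * D z) has_vector_derivative K z * L) (at z)" for z
        using DERIV_cmult[OF 0(2)[of z], of L] by (simp add: has_real_derivative_iff_has_vector_derivative mult.commute)
    qed (use False 0 g' in auto)
  qed auto
  then show ?case by (simp add: fdiff_def algebra_simps)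
next
  case (Suc m)
  then obtain g' where g': "\<And>z. (g has_vector_derivative g' z) (at z)"
    "deriv_bounded UNIV (Suc m) (\<lambda>z. K z * L) L g'" by (auto simp del: deriv_bounded.simps simp add: deriv_bounded.simps(2)[of _ "Suc m"])
  have mono: "D a \<le> D b" if "a \<le> b" for a b
    using that Suc.prems(2,3) by (meson DERIV_nonneg_imp_nondecreasing)
  have "norm ((fdiff h ^^ Suc (Suc m)) g y) \<le> h * (h ^ m * L ^ Suc m * (D (y + Suc (Suc m) * h) * L - D y * L))"
  proof (rule fdiff_pow_Suc_bound[OF g'(1) Suc.prems(4)])
    fix z assume z: "y \<le> z" "z \<le> y + h"
    have "norm ((fdiff h ^^ Suc m) g' z) \<le> h ^ m * L ^ Suc m * (D (z + Suc m * h) * L - D z * L)"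
      by (rule Suc.IH[OF g'(2)]) (use Suc.prems in \<open>auto intro!: derivative_eq_intros\<close>)
    also have "\<dots> \<le> h ^ m * L ^ Suc m * (D (y + Suc (Suc m) * h) * L - D y * L)"
      using Suc.prems z by (intro mult_left_mono diff_mono mult_right_mono mono) (auto simp: algebra_simps)
    finally show "norm ((fdiff h ^^ Suc m) g' z) \<le> h ^ m * L ^ Suc m * (D (y + Suc (Suc m) * h) * L - D y * L)" .
  qed
  then show ?case by (simp add: algebra_simps)
qed

section \<open>Summation by parts against periodic sequences of mean zero\<close>

lemma sum_periodic_shift:
  fixes a :: "nat \<Rightarrow> 'a::ab_group_add"
  assumes "\<And>n. a (n + q) = a n"
  shows "(\<Sum>i<q. a (n + i)) = (\<Sum>i<q. a i)"
proof (induction n)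
  case (Suc n)
  have "(\<Sum>i<q. a (Suc n + i)) + a n = (\<Sum>i<Suc q. a (n + i))"
    unfolding sum.lessThan_Suc_shift by (simp add: add.commute)
  also have "\<dots> = (\<Sum>i<q. a (n + i)) + a n" using assms by simp
  finally show ?case using Suc by simp
qed simp

text \<open>The partial sums of a periodic sequence of mean zero are again periodic; subtracting
  their average restores mean zero, so the step can be repeated. Each step costs \<open>2 q\<close>,
  namely \<open>q\<close> for the partial sums and \<open>q\<close> for the average, and turns
  \<open>w\<close> into its difference. A difference reaches one place further to the left, which is
  why \<open>w\<close> has to vanish at the first \<open>m\<close> places.\<close>

lemma periodic_abel_summation:
  fixes a w :: "nat \<Rightarrow> complex" and B :: real
  assumes "q > 0" "\<And>n. a (n + q) = a n" "(\<Sum>i<q. a i) = 0" "\<And>n. norm (a n) \<le> B"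
    "\<And>n. n < m \<Longrightarrow> w n = 0" "\<And>n. n \<ge> N \<Longrightarrow> w n = 0"
  shows "norm (\<Sum>n<N. a n * w n) \<le> (2 * real q) ^ m * B * (\<Sum>n<N. norm (((\<lambda>u n. u (Suc n) - u n) ^^ m) w n))"
  using assms(2-)
proof (induction m arbitrary: a w B)
  case 0
  then show ?case
    by (auto simp: norm_mult sum_distrib_left intro!: order_trans[OF norm_sum] sum_mono mult_right_mono)
next
  case (Suc m)
  define P where "P n = (\<Sum>i<n. a i)" for n
  define c where "c = (\<Sum>i<q. P i) / q"
  define b where "b n = P (Suc n) - c" for n
  have "B \<ge> 0" using Suc.prems(3)[of 0] norm_ge_zero order_trans by blast
  have Pper: "P (n + q) = P n" for n
  proof -
    have "P (n + q) = P n + (\<Sum>i<q. a (n + i))"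
      unfolding P_def by (induction q) (auto simp: algebra_simps)
    then show ?thesis using sum_periodic_shift[of a q n] Suc.prems by auto
  qed
  have bper: "b (n + q) = b n" for n using Pper[of "Suc n"] by (simp add: b_def)
  have "(\<Sum>i<q. P (Suc i)) = (\<Sum>i<q. P i)"
    using sum_periodic_shift[of P q 1] Pper by simp
  then have bsum: "(\<Sum>i<q. b i) = 0" using \<open>q > 0\<close> by (simp add: b_def sum_subtractf c_def)
  have Pmod: "P n = P (n mod q)" for n
  proof (induction n rule: less_induct)
    case (less n)
    show ?case
    proof (cases "n < q")
      case False
      then have "P n = P (n - q)" using Pper[of "n - q"] by simp
      also have "\<dots> = P ((n - q) mod q)" using less[of "n - q"] False \<open>q > 0\<close> by simp
      finally show ?thesis using False by (simp add: le_mod_geq)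
    qed simp
  qed
  have Pb: "norm (P n) \<le> q * B" for n
  proof -
    have "norm (P (n mod q)) \<le> (\<Sum>i<n mod q. B)"
      unfolding P_def by (intro order_trans[OF norm_sum] sum_mono Suc.prems)
    also have "\<dots> \<le> q * B" using \<open>q > 0\<close> \<open>B \<ge> 0\<close> by (auto intro!: mult_right_mono simp: less_imp_le)
    finally show ?thesis using Pmod[of n] by simp
  qed
  have "norm c \<le> (\<Sum>i<q. q * B) / q"
    unfolding c_def norm_divide by (auto intro!: divide_right_mono order_trans[OF norm_sum] sum_mono Pb simp del: sum_constant)
  then have cb: "norm c \<le> q * B" using \<open>q > 0\<close> by simp
  have bb: "norm (b n) \<le> 2 * real q * B" for n
    using Pb[of "Suc n"] cb norm_triangle_ineq4[of "P (Suc n)" c] unfolding b_def by linarith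
  define d where "d n = w (Suc n) - w n" for n
  \<comment> \<open>Subtracting the constant \<open>c\<close> from \<open>P\<close> changes no
    increment; the boundary terms vanish because \<open>w 0\<close> and \<open>w N\<close>
    do.\<close>
  have tel: "(\<Sum>n<N. (P (Suc n) - P n) * w n) = (P N - c) * w N - (P 0 - c) * w 0 - (\<Sum>n<N. b n * d n)" for N
    by (induction N) (auto simp: b_def d_def algebra_simps)
  have "(\<Sum>n<N. a n * w n) = - (\<Sum>n<N. b n * d n)"
    using tel[of N] Suc.prems by (simp add: P_def)
  then have "norm (\<Sum>n<N. a n * w n) = norm (\<Sum>n<N. b n * d n)" by simp
  also have "\<dots> \<le> (2 * real q) ^ m * (2 * real q * B) * (\<Sum>n<N. norm (((\<lambda>u n. u (Suc n) - u n) ^^ m) d n))"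
    by (rule Suc.IH) (use bper bsum bb Suc.prems in \<open>auto simp: d_def\<close>)
  also have "((\<lambda>u n. u (Suc n) - u n) ^^ m) d = ((\<lambda>u n. u (Suc n) - u n) ^^ Suc m) w"
    by (simp add: funpow_Suc_right d_def [abs_def] del: funpow.simps)
  finally show ?case by (simp add: algebra_simps)
qed

text \<open>A shift by \<open>m\<close> is a chain of \<open>m\<close> unit shifts, and each of
  these telescopes to a difference of two values between 0 and \<open>T\<close>.\<close>

lemma sum_shift_diff_le:
  fixes d :: "nat \<Rightarrow> real"
  assumes "\<And>n. 0 \<le> d n" "\<And>n. d n \<le> T"
  shows "(\<Sum>n<N. d (n + m) - d n) \<le> m * T"
proof (induction m)
  case (Suc m)
  have "(\<Sum>n<N. d (n + Suc m) - d n) = (\<Sum>n<N. d (n + m) - d n) + (\<Sum>n<N. d (Suc (n + m)) - d (n + m))"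
    by (simp add: sum.distrib[symmetric])
  also have "(\<Sum>n<N. d (Suc (n + m)) - d (n + m)) = d (N + m) - d m"
    using sum_lessThan_telescope[of "\<lambda>n. d (n + m)" N] by simp
  finally show ?case using Suc assms(1)[of m] assms(2)[of "N + m"] by (simp add: algebra_simps)
qed simp

text \<open>Each of the \<open>m\<close> summations by parts costs \<open>2 q\<close>, and a
  difference of step \<open>1 / X\<close> gains \<open>L / X\<close>. One factor
  \<open>1 / X\<close> is given back, whence the \<open>X\<close> on the right: one difference is
  kept as an increment of \<open>D\<close>, and these increments sum to at most
  \<open>m * T\<close>.\<close>

lemma periodic_sum_bound:
  fixes a :: "nat \<Rightarrow> complex" and X B T :: real
  assumes a: "q > 0" "\<And>n. a (n + q) = a n" "(\<Sum>i<q. a i) = 0" "\<And>n. norm (a n) \<le> B"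
    and m: "m > 0" and X: "X > 0"
    and w: "deriv_bounded UNIV m K L w" "L \<ge> 0" "\<And>z. K z \<ge> 0" "\<And>z. (D has_real_derivative K z) (at z)"
    and D: "\<And>z. z \<ge> 0 \<Longrightarrow> 0 \<le> D z" "\<And>z. D z \<le> T"
    and supp: "\<And>n::nat. n < m \<Longrightarrow> w (n / X) = 0" "\<And>n::nat. n \<ge> N \<Longrightarrow> w (n / X) = 0"
  shows "norm (\<Sum>n<N. a n * w (n / X)) \<le> B * X * (2 * real q * L / X) ^ m * m * T"
proof -
  obtain p where p: "m = Suc p" using m by (cases m) auto
  have B: "B \<ge> 0" using a(4)[of 0] norm_ge_zero order_trans by blast
  have eq: "((\<lambda>u n. u (Suc n) - u n) ^^ j) (\<lambda>n. v (real n / X)) = (\<lambda>n. (fdiff (1 / X) ^^ j) v (real n / X))" for j v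
    by (induction j) (auto simp: fdiff_def add_divide_distrib add.commute)
  have "norm (\<Sum>n<N. a n * w (n / X)) \<le> (2 * real q) ^ m * B *
      (\<Sum>n<N. norm (((\<lambda>u n. u (Suc n) - u n) ^^ m) (\<lambda>n. w (real n / X)) n))"
    by (rule periodic_abel_summation) (use a supp in auto)
  also have "\<dots> \<le> (2 * real q) ^ m * B * (\<Sum>n<N. (1 / X) ^ p * L ^ m * (D ((n + m) / X) - D (n / X)))"
  proof (intro mult_left_mono sum_mono)
    fix n :: nat
    have "norm ((fdiff (1 / X) ^^ Suc p) w (n / X)) \<le> (1 / X) ^ p * L ^ Suc p * (D (n / X + Suc p * (1 / X)) - D (n / X))"
      by (rule fdiff_pow_bound_integral[where K = K]) (use w X p in \<open>auto simp del: deriv_bounded.simps\<close>)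
    then show "norm (((\<lambda>u n. u (Suc n) - u n) ^^ m) (\<lambda>n. w (real n / X)) n) \<le> (1 / X) ^ p * L ^ m * (D ((n + m) / X) - D (n / X))"
      unfolding eq p by (simp add: add_divide_distrib add_ac)
  qed (use B in auto)
  also have "\<dots> = (2 * real q) ^ m * B * ((1 / X) ^ p * L ^ m * (\<Sum>n<N. D ((n + m) / X) - D (n / X)))"
    by (simp add: sum_distrib_left)
  also have "\<dots> \<le> (2 * real q) ^ m * B * ((1 / X) ^ p * L ^ m * (m * T))"
    using sum_shift_diff_le[of "\<lambda>n. D (real n / X)" T m N] D X w(2) B
    by (intro mult_left_mono) (auto simp: field_simps)
  also have "\<dots> = B * X * (2 * real q * L / X) ^ m * m * T"
    using X by (simp add: p power_divide field_simps)
  finally show ?thesis .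
qed

section \<open>The cutoff function in the logarithmic variable\<close>

lemma integrable_inverse_1_plus_power2: "integrable lborel (\<lambda>x::real. C / (1 + x\<^sup>2))"
  using integrable_inverse_1_plus_square
  by (auto simp: set_integrable_def einterval_def divide_inverse)

text \<open>\<open>t powr a\<close> is at most \<open>t ^ n + (1 / t) ^ n\<close> for
  \<open>n \<ge> \<bar>a\<bar>\<close>, and \<open>s ^ n * exp (- s) \<le> fact n\<close> treats
  both ends, with \<open>s = t\<close> and \<open>s = 1 / t\<close>. A factor \<open>1 + t^2\<close>
  is removed by passing to the exponents \<open>a\<close> and \<open>a + 2\<close>.\<close>

lemma powr_mult_exp_bounded:
  fixes a :: real
  shows "\<exists>C\<ge>0. \<forall>t>0. (1 + t\<^sup>2) ^ k * t powr a * exp (- t - 1 / t) \<le> C"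
proof (induction k arbitrary: a)
  case 0
  define n where "n = nat \<lceil>\<bar>a\<bar>\<rceil>"
  have n: "\<bar>a\<bar> \<le> real n" unfolding n_def by linarith
  have *: "s ^ n * exp (- s) \<le> fact n" if "s > 0" for s :: real
  proof -
    have "s ^ n / fact n \<le> exp s"
      using sum_le_suminf[OF summable_exp_generic[of s], of "{n}"] that
      by (simp add: exp_def divide_inverse mult.commute)
    then show ?thesis by (simp add: exp_minus field_simps)
  qed
  have "t powr a * exp (- t - 1 / t) \<le> 2 * fact n" if t: "t > 0" for t :: real
  proof -
    have "t powr a \<le> t ^ n + (1 / t) ^ n"
    proof (cases "t \<ge> 1")
      case True
      then have "t powr a \<le> t powr real n" using n by (intro powr_mono) auto
      then show ?thesis using t by (simp add: powr_realpow add_increasing2)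
    next
      case False
      then have "t powr a \<le> t powr (- real n)" using n t by (intro powr_mono') auto
      also have "\<dots> = (1 / t) ^ n" using t by (simp add: powr_minus powr_realpow power_inverse divide_inverse)
      finally show ?thesis using t by (simp add: add_increasing)
    qed
    then have "t powr a * exp (- t - 1 / t) \<le> (t ^ n + (1 / t) ^ n) * exp (- t - 1 / t)"
      by (intro mult_right_mono) auto
    also have "\<dots> = (t ^ n * exp (- t)) * exp (- (1 / t)) + ((1 / t) ^ n * exp (- (1 / t))) * exp (- t)"
      by (simp add: algebra_simps exp_diff exp_minus divide_inverse)
    also have "\<dots> \<le> fact n * 1 + fact n * 1"
      using *[OF t] *[of "1 / t"] t by (intro add_mono mult_mono) auto
    finally show ?thesis by simp
  qed
  then show ?case by (intro exI[of _ "2 * fact n"]) auto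
next
  case (Suc k)
  obtain C where C: "C \<ge> 0" "\<And>t. t > 0 \<Longrightarrow> (1 + t\<^sup>2) ^ k * t powr a * exp (- t - 1 / t) \<le> C"
    using Suc by blast
  obtain C' where C': "C' \<ge> 0" "\<And>t. t > 0 \<Longrightarrow> (1 + t\<^sup>2) ^ k * t powr (a + 2) * exp (- t - 1 / t) \<le> C'"
    using Suc by blast
  have "(1 + t\<^sup>2) ^ Suc k * t powr a * exp (- t - 1 / t) \<le> C + C'" if t: "t > 0" for t
  proof -
    have "t powr (a + 2) = t powr a * t\<^sup>2" using t by (simp add: powr_add powr_numeral)
    then have "(1 + t\<^sup>2) ^ Suc k * t powr a * exp (- t - 1 / t) =
       (1 + t\<^sup>2) ^ k * t powr a * exp (- t - 1 / t) + (1 + t\<^sup>2) ^ k * t powr (a + 2) * exp (- t - 1 / t)"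
      by (simp add: algebra_simps)
    then show ?thesis using C(2)[OF t] C'(2)[OF t] by linarith
  qed
  then show ?case using C C' by (intro exI[of _ "C + C'"]) auto
qed

lemma has_vector_derivative_complex_of_real:
  "(f has_real_derivative d) (at v) \<Longrightarrow>
    ((\<lambda>v. complex_of_real (f v)) has_vector_derivative complex_of_real d) (at v)"
  by (intro has_vector_derivative_of_real) (simp add: has_real_derivative_iff_has_vector_derivative)

section \<open>The density of \<open>F\<close> and the decay of its tail integral\<close>

definition F_density :: "real \<Rightarrow> real" where
  "F_density y = exp (- y - 1 / y) / y"

lemma continuous_on_F_density: "A \<subseteq> {0<..} \<Longrightarrow> continuous_on A F_density"
  unfolding F_density_def by (intro continuous_intros) auto

lemma F_density_weighted_bound: "\<exists>C\<ge>0::real. \<forall>y>0. (1 + y\<^sup>2) * F_density y \<le> C / (1 + y\<^sup>2)"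
proof -
  obtain C :: real where C: "C \<ge> 0" "\<forall>t>0. (1 + t\<^sup>2) ^ 2 * t powr (-1) * exp (- t - 1 / t) \<le> C"
    using powr_mult_exp_bounded[of 2 "-1"] by blast
  have "(1 + y\<^sup>2) * F_density y \<le> C / (1 + y\<^sup>2)" if "y > 0" for y
  proof -
    have p: "1 + y\<^sup>2 > 0" by (simp add: add_pos_nonneg)
    have "y powr (-1) = 1 / y" using that by (simp add: powr_minus_divide)
    with C(2)[rule_format, OF that] have "(1 + y\<^sup>2) * F_density y * (1 + y\<^sup>2) \<le> C"
      by (simp add: F_density_def power2_eq_square[of "1 + _"] mult_ac)
    then show ?thesis using p by (subst pos_le_divide_eq) auto
  qed
  with C(1) show ?thesis by blast
qed

lemma set_integrable_F_density: "set_integrable lborel {0<..} (\<lambda>y. (1 + y\<^sup>2) * F_density y)"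
proof -
  obtain C where C: "\<And>y. y > 0 \<Longrightarrow> (1 + y\<^sup>2) * F_density y \<le> C / (1 + y\<^sup>2)"
    using F_density_weighted_bound by blast
  show ?thesis unfolding set_integrable_def
  proof (rule Bochner_Integration.integrable_bound[OF integrable_inverse_1_plus_power2[of "\<bar>C\<bar>"]])
    show "(\<lambda>x. indicat_real {0<..} x *\<^sub>R ((1 + x\<^sup>2) * F_density x)) \<in> borel_measurable lborel"
      unfolding F_density_def by measurable
    have "norm (indicat_real {0<..} x *\<^sub>R ((1 + x\<^sup>2) * F_density x)) \<le> norm (\<bar>C\<bar> / (1 + x\<^sup>2))" for x
    proof (cases "x > 0")
      case True
      then have "0 \<le> (1 + x\<^sup>2) * F_density x" by (simp add: F_density_def)
      moreover have "C / (1 + x\<^sup>2) \<le> \<bar>C\<bar> / (1 + x\<^sup>2)" by (intro divide_right_mono) auto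
      ultimately show ?thesis using True C[OF True] by simp
    qed auto
    then show "AE x in lborel. norm (indicat_real {0<..} x *\<^sub>R ((1 + x\<^sup>2) * F_density x)) \<le> norm (\<bar>C\<bar> / (1 + x\<^sup>2))"
      by simp
  qed
qed

lemma set_integrable_F_density': "a \<ge> 0 \<Longrightarrow> set_integrable lborel {a<..} F_density"
proof -
  assume a: "a \<ge> 0"
  have "set_integrable lborel {0<..} F_density"
    unfolding set_integrable_def
  proof (rule Bochner_Integration.integrable_bound[OF set_integrable_F_density[unfolded set_integrable_def]])
    show "(\<lambda>x. indicat_real {0<..} x *\<^sub>R F_density x) \<in> borel_measurable lborel"
      unfolding F_density_def by measurable
    have "F_density x \<le> (1 + x\<^sup>2) * F_density x" if "x > 0" for x
      using that by (simp add: F_density_def field_simps)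
    then show "AE x in lborel. norm (indicat_real {0<..} x *\<^sub>R F_density x) \<le> norm (indicat_real {0<..} x *\<^sub>R ((1 + x\<^sup>2) * F_density x))"
      by (intro AE_I2) (auto simp: indicator_def F_density_def)
  qed
  then show ?thesis by (rule set_integrable_subset) (use a in auto)
qed

definition F_const :: real where "F_const = 1 / (2 * bessel_K 0 2)"

lemma F_eq: "F x = F_const * (LINT y:{x<..}|lborel. F_density y)"
  by (simp add: F_def F_const_def F_density_def)

text \<open>On the range \<open>y > x\<close> the weight \<open>1 + x^2\<close> is at most
  \<open>1 + y^2\<close>, so it can be moved under the integral and then enlarged to a constant
  independent of \<open>x\<close>.\<close>

lemma F_bound: "\<exists>C\<ge>0. \<forall>x>0. \<bar>F x\<bar> \<le> C / (1 + x\<^sup>2)"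
proof -
  define C where "C = (LINT y:{0<..}|lborel. (1 + y\<^sup>2) * F_density y)"
  have "C \<ge> 0" unfolding C_def set_lebesgue_integral_def
    by (intro integral_nonneg_AE AE_I2) (auto simp: indicator_def F_density_def)
  have "\<bar>F x\<bar> \<le> \<bar>F_const\<bar> * C / (1 + x\<^sup>2)" if x: "x > 0" for x
  proof -
    have p: "1 + x\<^sup>2 > 0" by (simp add: add_pos_nonneg)
    have nn: "(LINT y:{x<..}|lborel. F_density y) \<ge> 0" unfolding set_lebesgue_integral_def
      by (intro integral_nonneg_AE AE_I2) (use x in \<open>auto simp: indicator_def F_density_def\<close>)
    have "(1 + x\<^sup>2) * (LINT y:{x<..}|lborel. F_density y) = (LINT y:{x<..}|lborel. (1 + x\<^sup>2) * F_density y)"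
      by simp
    also have "\<dots> \<le> C" unfolding C_def set_lebesgue_integral_def
    proof (rule integral_mono)
      show "integrable lborel (\<lambda>y. indicat_real {x<..} y *\<^sub>R ((1 + x\<^sup>2) * F_density y))"
        using set_integrable_mult_right[OF set_integrable_F_density'[of x], of "1 + x\<^sup>2"] x
        by (simp add: set_integrable_def)
      show "integrable lborel (\<lambda>y. indicat_real {0<..} y *\<^sub>R ((1 + y\<^sup>2) * F_density y))"
        using set_integrable_F_density by (simp add: set_integrable_def)
      fix y
      show "indicat_real {x<..} y *\<^sub>R ((1 + x\<^sup>2) * F_density y) \<le> indicat_real {0<..} y *\<^sub>R ((1 + y\<^sup>2) * F_density y)"
      proof (cases "y > x")
        case True
        then have "x\<^sup>2 \<le> y\<^sup>2" using x by (intro power_mono) auto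
        then have "(1 + x\<^sup>2) * F_density y \<le> (1 + y\<^sup>2) * F_density y"
          using True x by (intro mult_right_mono) (auto simp: F_density_def)
        then show ?thesis using True x by simp
      qed (auto simp: indicator_def F_density_def)
    qed
    finally have "(LINT y:{x<..}|lborel. F_density y) \<le> C / (1 + x\<^sup>2)"
      using p by (simp add: field_simps)
    then show ?thesis using nn unfolding F_eq abs_mult times_divide_eq_right[symmetric]
      by (intro mult_left_mono) auto
  qed
  then show ?thesis using \<open>C \<ge> 0\<close> by (intro exI[of _ "\<bar>F_const\<bar> * C"]) auto
qed

text \<open>Beyond the cut \<open>a = x / 2\<close> the tail integral is a constant minus an
  integral over a compact interval away from 0, where the density is continuous.\<close>

lemma F_has_real_derivative:
  assumes x: "x > 0"
  shows "(F has_real_derivative - F_const * F_density x) (at x)"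
proof -
  define a b where "a = x / 2" and "b = 2 * x"
  have ab: "0 < a" "a < x" "x < b" using x by (auto simp: a_def b_def)
  define J where "J y = (LINT z:{y<..}|lborel. F_density z)" for y
  have eq: "J y = J a - integral {a..y} F_density" if y: "a \<le> y" for y
  proof -
    have i: "set_integrable lborel {a<..y} F_density"
      by (rule set_integrable_subset[OF set_integrable_F_density'[of a]]) (use ab in auto)
    have un: "{a<..} = {a<..y} \<union> {y<..}" using y by auto
    have "J a = (LINT z:{a<..y}|lborel. F_density z) + J y"
      unfolding J_def un by (rule set_integral_Un) (use i set_integrable_F_density'[of y] ab y in auto)
    also have "(LINT z:{a<..y}|lborel. F_density z) = integral {a<..y} F_density"
      by (rule set_borel_integral_eq_integral(2)[OF i])
    also have "\<dots> = integral {a..y} F_density"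
      by (rule integral_subset_negligible) (auto intro: negligible_subset[of "{a}"])
    finally show ?thesis by simp
  qed
  have "((\<lambda>y. J a - integral {a..y} F_density) has_real_derivative 0 - F_density x) (at x within {a..b})"
    by (intro derivative_intros integral_has_real_derivative continuous_on_F_density) (use ab in auto)
  then have "((\<lambda>y. J a - integral {a..y} F_density) has_real_derivative - F_density x) (at x)"
    using ab by (simp add: at_within_Icc_at)
  then have "(J has_real_derivative - F_density x) (at x)"
    by (rule has_field_derivative_transform_within_open[of _ _ _ "{a<..<b}"]) (use ab in \<open>auto simp: eq[symmetric]\<close>)
  from DERIV_cmult[OF this, of F_const] show ?thesis
    unfolding F_eq [abs_def] J_def by simp
qed

text \<open>Differentiation produces a combination of the members with parameters \<open>a\<close>,
  \<open>a + 1\<close> and \<open>a - 1\<close>, so the family is closed under it. The weight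
  \<open>C / (1 + exp (2 * v))\<close> is \<open>C / (1 + x^2)\<close> for \<open>x = exp v\<close>,
  integrable with respect to \<open>x\<close>.\<close>

lemma deriv_bounded_exp_sum:
  "\<exists>C\<ge>0. deriv_bounded UNIV m (\<lambda>v. C / (1 + exp (2 * v))) 1
     (\<lambda>v. complex_of_real (exp (a * v - exp v - exp (- v))))"
proof (induction m arbitrary: a)
  have bnd: "\<exists>C\<ge>0. \<forall>v. norm (complex_of_real (exp (a * v - exp v - exp (- v)))) \<le> C / (1 + exp (2 * v))" for a
  proof -
    obtain C where C: "C \<ge> 0" "\<And>t. t > 0 \<Longrightarrow> (1 + t\<^sup>2) ^ 1 * t powr a * exp (- t - 1 / t) \<le> C"
      using powr_mult_exp_bounded[of 1 a] by auto
    have "norm (complex_of_real (exp (a * v - exp v - exp (- v)))) \<le> C / (1 + exp (2 * v))" for v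
    proof -
      have "exp (a * v - exp v - exp (- v)) = exp v powr a * exp (- exp v - 1 / exp v)"
        by (simp add: powr_def exp_add[symmetric] exp_minus divide_inverse)
      moreover have "(exp v)\<^sup>2 = exp (2 * v)" by (simp add: exp_double)
      moreover have "1 + exp (2 * v) > 0" by (simp add: add_pos_pos)
      ultimately show ?thesis using C(2)[of "exp v"]
        by (simp only: norm_of_real abs_mult abs_exp_cancel pos_le_divide_eq) (simp add: mult_ac)
    qed
    with C(1) show ?thesis by blast
  qed
  case 0
  show ?case using bnd[of a] by auto
  case (Suc m)
  let ?g = "\<lambda>a v. complex_of_real (exp (a * v - exp v - exp (- v)))"
  obtain C0 where C0: "C0 \<ge> 0" "\<And>v. norm (?g a v) \<le> C0 / (1 + exp (2 * v))" using bnd[of a] by blast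
  obtain C1 where C1: "C1 \<ge> 0" "deriv_bounded UNIV m (\<lambda>v. C1 / (1 + exp (2 * v))) 1 (?g a)" using Suc by blast
  obtain C2 where C2: "C2 \<ge> 0" "deriv_bounded UNIV m (\<lambda>v. C2 / (1 + exp (2 * v))) 1 (?g (a + 1))" using Suc by blast
  obtain C3 where C3: "C3 \<ge> 0" "deriv_bounded UNIV m (\<lambda>v. C3 / (1 + exp (2 * v))) 1 (?g (a - 1))" using Suc by blast
  define C where "C = C0 + (\<bar>a\<bar> * C1 + (C2 + C3))"
  have C: "C \<ge> 0" "C0 \<le> C" "\<bar>a\<bar> * C1 + (C2 + C3) \<le> C" using C0 C1 C2 C3 by (auto simp: C_def)
  define g' where "g' v = complex_of_real a * ?g a v + ((-1) * ?g (a + 1) v + ?g (a - 1) v)" for v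
  have pos: "1 + exp (2 * v) > 0" for v :: real by (simp add: add_pos_pos)
  have g': "deriv_bounded UNIV m (\<lambda>v. norm (complex_of_real a) * (C1 / (1 + exp (2 * v))) +
      (norm (-1 :: complex) * (C2 / (1 + exp (2 * v))) + C3 / (1 + exp (2 * v)))) 1 g'"
    unfolding g'_def by (intro deriv_bounded_add deriv_bounded_cmult C1 C2 C3)
  have "deriv_bounded UNIV m (\<lambda>v. C / (1 + exp (2 * v)) * 1) 1 g'"
  proof (rule deriv_bounded_mono[OF g'])
    fix v :: real
    have "norm (complex_of_real a) * (C1 / (1 + exp (2 * v))) +
      (norm (-1 :: complex) * (C2 / (1 + exp (2 * v))) + C3 / (1 + exp (2 * v)))
       = (\<bar>a\<bar> * C1 + (C2 + C3)) / (1 + exp (2 * v))" by (simp add: add_divide_distrib)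
    also have "\<dots> \<le> C / (1 + exp (2 * v))" using C pos[of v] by (intro divide_right_mono) auto
    finally show "norm (complex_of_real a) * (C1 / (1 + exp (2 * v))) +
      (norm (-1 :: complex) * (C2 / (1 + exp (2 * v))) + C3 / (1 + exp (2 * v))) \<le> C / (1 + exp (2 * v)) * 1" by simp
    show "0 \<le> norm (complex_of_real a) * (C1 / (1 + exp (2 * v))) +
      (norm (-1 :: complex) * (C2 / (1 + exp (2 * v))) + C3 / (1 + exp (2 * v)))"
      using C1 C2 C3 pos[of v] by auto
  qed auto
  moreover have "(?g a has_vector_derivative g' v) (at v)" for v
  proof -
    have "((\<lambda>v. exp (a * v - exp v - exp (- v))) has_real_derivative
        (a * exp (a * v - exp v - exp (- v)) - exp ((a + 1) * v - exp v - exp (- v)) + exp ((a - 1) * v - exp v - exp (- v)))) (at v)"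
      by (auto intro!: derivative_eq_intros simp: algebra_simps exp_add exp_diff exp_minus divide_inverse)
    from has_vector_derivative_complex_of_real[OF this] show ?thesis
      unfolding g'_def by (simp add: algebra_simps)
  qed
  moreover have "norm (?g a v) \<le> C / (1 + exp (2 * v))" for v
    using C0(2)[of v] C pos[of v] by (meson divide_right_mono less_imp_le order_trans)
  ultimately show ?case using C(1) by (intro exI[of _ C]) auto
qed

text \<open>In the variable \<open>v\<close> the derivative of \<open>F\<close> is, up to
  \<open>F_const\<close>, the member \<open>a = 0\<close> of the family just treated;
  \<open>F\<close> itself has the decay of \<open>F_bound\<close>.\<close>

lemma deriv_bounded_F:
  "\<exists>C\<ge>0. deriv_bounded UNIV m (\<lambda>v. C / (1 + exp (2 * v))) 1 (\<lambda>v. complex_of_real (F (exp v)))"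
proof -
  let ?g = "\<lambda>v. complex_of_real (exp (0 * v - exp v - exp (- v)))"
  obtain C1 where C1: "C1 \<ge> 0" "deriv_bounded UNIV m (\<lambda>v. C1 / (1 + exp (2 * v))) 1 ?g"
    using deriv_bounded_exp_sum by blast
  obtain C0 where C0: "C0 \<ge> 0" "\<And>x. x > 0 \<Longrightarrow> \<bar>F x\<bar> \<le> C0 / (1 + x\<^sup>2)" using F_bound by blast
  define C where "C = C0 + \<bar>F_const\<bar> * C1"
  have C: "C \<ge> 0" "C0 \<le> C" "\<bar>F_const\<bar> * C1 \<le> C" using C0 C1 by (auto simp: C_def)
  have pos: "1 + exp (2 * v) > 0" for v :: real by (simp add: add_pos_pos)
  have "deriv_bounded UNIV m (\<lambda>v. C / (1 + exp (2 * v)) * 1) 1 (\<lambda>v. complex_of_real (- F_const) * ?g v)"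
  proof (rule deriv_bounded_mono[OF deriv_bounded_cmult[OF C1(2)]])
    fix v :: real
    have "\<bar>F_const\<bar> * C1 / (1 + exp (2 * v)) \<le> C / (1 + exp (2 * v))"
      using C pos[of v] by (intro divide_right_mono) auto
    then show "cmod (complex_of_real (- F_const)) * (C1 / (1 + exp (2 * v))) \<le> C / (1 + exp (2 * v)) * 1" by simp
  qed (use C1 pos in \<open>auto intro!: divide_nonneg_pos\<close>)
  moreover have "((\<lambda>v. complex_of_real (F (exp v))) has_vector_derivative complex_of_real (- F_const) * ?g v) (at v)" for v
  proof -
    have "((\<lambda>v. F (exp v)) has_real_derivative (- F_const * F_density (exp v)) * exp v) (at v)"
      by (rule DERIV_chain2[OF F_has_real_derivative]) auto
    also have "(- F_const * F_density (exp v)) * exp v = - F_const * exp (0 * v - exp v - exp (- v))"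
      by (simp add: F_density_def exp_minus divide_inverse)
    finally show ?thesis
      by (metis has_vector_derivative_complex_of_real of_real_mult)
  qed
  moreover have "norm (complex_of_real (F (exp v))) \<le> C / (1 + exp (2 * v))" for v
  proof -
    have "\<bar>F (exp v)\<bar> \<le> C0 / (1 + exp (2 * v))" using C0(2)[of "exp v"] by (simp add: exp_double)
    also have "\<dots> \<le> C / (1 + exp (2 * v))" using C pos[of v] by (intro divide_right_mono) auto
    finally show ?thesis by simp
  qed
  ultimately have "deriv_bounded UNIV (Suc m) (\<lambda>v. C / (1 + exp (2 * v))) 1 (\<lambda>v. complex_of_real (F (exp v)))"
    unfolding deriv_bounded.simps
    by (intro conjI ballI exI[of _ "\<lambda>v. complex_of_real (- F_const) * ?g v"])
  then show ?thesis using C(1) deriv_bounded_Suc_D by blast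
qed

section \<open>Decay of the Mellin transform\<close>

text \<open>On \<open>Re u = 1\<close> the kernel \<open>x powr (u - 1)\<close> is
  \<open>x powr (i \<tau>)\<close> with measure \<open>dx\<close>. The integral therefore stays in
  \<open>x\<close>, while \<open>g\<close> is a function of \<open>ln x\<close>, so that a scaling
  of \<open>x\<close> becomes a translation of \<open>g\<close>.\<close>

definition log_mellin :: "real \<Rightarrow> (real \<Rightarrow> complex) \<Rightarrow> complex" where
  "log_mellin \<tau> g = (LINT x|lborel. indicator {0<..} x *\<^sub>R (g (ln x) * exp (\<i> * of_real (\<tau> * ln x))))"

definition log_integrable :: "(real \<Rightarrow> complex) \<Rightarrow> bool" where
  "log_integrable g \<longleftrightarrow> integrable lborel (\<lambda>x. indicator {0<..} x *\<^sub>R g (ln x))"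

lemma log_integrable_twist:
  assumes "log_integrable g"
  shows "integrable lborel (\<lambda>x. indicator {0<..} x *\<^sub>R (g (ln x) * exp (\<i> * of_real (\<tau> * ln x))))"
proof -
  have m: "(\<lambda>x. indicator {0<..} x *\<^sub>R g (ln x)) \<in> borel_measurable lborel"
    using assms unfolding log_integrable_def by (rule borel_measurable_integrable)
  have "(\<lambda>x. (indicator {0<..} x *\<^sub>R g (ln x)) * exp (\<i> * of_real (\<tau> * ln x))) \<in> borel_measurable lborel"
    by (intro borel_measurable_times m) measurable
  then show ?thesis
    by (intro Bochner_Integration.integrable_bound[OF assms[unfolded log_integrable_def]])
       (auto simp: norm_mult)
qed

lemma log_integrable_shift:
  assumes "log_integrable g"
  shows "log_integrable (\<lambda>v. g (v + h))"
proof -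
  have "integrable lborel (\<lambda>x. indicator {0<..} (0 + exp h * x) *\<^sub>R g (ln (0 + exp h * x)))"
    using assms unfolding log_integrable_def
    by (intro lborel_integrable_real_affine[where f = "\<lambda>x. indicator {0<..} x *\<^sub>R g (ln x)"]) auto
  also have "(\<lambda>x. indicator {0<..} (0 + exp h * x) *\<^sub>R g (ln (0 + exp h * x))) =
      (\<lambda>x. indicator {0<..} x *\<^sub>R g (ln x + h))"
    by (auto simp: indicator_def zero_less_mult_iff ln_mult add.commute)
  finally show ?thesis unfolding log_integrable_def .
qed

lemma log_integrable_fdiff:
  assumes "log_integrable g"
  shows "log_integrable (fdiff h g)"
  using Bochner_Integration.integrable_diff[OF log_integrable_shift[OF assms, of h, unfolded log_integrable_def] assms[unfolded log_integrable_def]]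
  by (simp add: log_integrable_def fdiff_def [abs_def] scaleR_diff_right)

lemma log_mellin_shift:
  "log_mellin \<tau> g = exp (of_real h) * exp (\<i> * of_real (\<tau> * h)) * log_mellin \<tau> (\<lambda>v. g (v + h))"
proof -
  let ?f = "\<lambda>x. indicator {0<..} x *\<^sub>R (g (ln x) * exp (\<i> * of_real (\<tau> * ln x)))"
  have "log_mellin \<tau> g = \<bar>exp h\<bar> *\<^sub>R (LINT x|lborel. ?f (0 + exp h * x))"
    unfolding log_mellin_def by (rule lborel_integral_real_affine) auto
  also have "(\<lambda>x. ?f (0 + exp h * x)) = (\<lambda>x. exp (\<i> * of_real (\<tau> * h)) *
      (indicator {0<..} x *\<^sub>R (g (ln x + h) * exp (\<i> * of_real (\<tau> * ln x)))))"
  proof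
    fix x :: real
    show "?f (0 + exp h * x) = exp (\<i> * of_real (\<tau> * h)) *
      (indicator {0<..} x *\<^sub>R (g (ln x + h) * exp (\<i> * of_real (\<tau> * ln x))))"
    proof (cases "x > 0")
      case True
      then have "ln (exp h * x) = ln x + h" by (simp add: ln_mult)
      then show ?thesis using True
        by (simp add: distrib_left exp_add mult_ac)
    next
      case False
      then have "\<not> exp h * x > 0" by (simp add: zero_less_mult_iff)
      then show ?thesis using False by simp
    qed
  qed
  finally show ?thesis
    by (simp add: log_mellin_def scaleR_conv_of_real exp_of_real)
qed

text \<open>With \<open>h = \<pi> / \<bar>\<tau>\<bar>\<close> the twist by \<open>x\<^sup>i\<^sup>\<tau>\<close> changes sign under \<open>x \<mapsto> e\<^sup>h x\<close>, so differencing does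
  not decrease the transform; this replaces repeated integration by parts.\<close>

lemma norm_log_mellin_le_fdiff:
  assumes "log_integrable g" "\<tau> \<noteq> 0"
  shows "norm (log_mellin \<tau> g) \<le> norm (log_mellin \<tau> (fdiff (pi / \<bar>\<tau>\<bar>) g))"
proof -
  define h where "h = pi / \<bar>\<tau>\<bar>"
  have "\<tau> * h = pi \<or> \<tau> * h = - pi" using assms(2) by (auto simp: h_def abs_if)
  then have "exp (\<i> * of_real (\<tau> * h)) = -1"
    by (elim disjE) (simp_all add: exp_minus exp_pi_i' del: of_real_mult)
  then have s: "log_mellin \<tau> g = - (exp (of_real h) * log_mellin \<tau> (\<lambda>v. g (v + h)))"
    using log_mellin_shift[of \<tau> g h] by simp
  then have s': "log_mellin \<tau> (\<lambda>v. g (v + h)) = - (of_real (exp (- h)) * log_mellin \<tau> g)"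
    by (simp add: exp_minus exp_of_real field_simps)
  have "log_mellin \<tau> (fdiff h g) = log_mellin \<tau> (\<lambda>v. g (v + h)) - log_mellin \<tau> g"
    using Bochner_Integration.integral_diff[OF log_integrable_twist[OF log_integrable_shift[OF assms(1)], of h \<tau>]
        log_integrable_twist[OF assms(1), of \<tau>]]
    by (simp add: log_mellin_def fdiff_def algebra_simps)
  \<comment> \<open>The shifted transform is \<open>- exp (- h)\<close> times the original one, so
    the two terms reinforce each other, and the factor \<open>1 + exp (- h)\<close> is at least
    1.\<close>
  also have "\<dots> = - (of_real (1 + exp (- h)) * log_mellin \<tau> g)"
    unfolding s' by (simp add: algebra_simps)
  finally have "norm (log_mellin \<tau> (fdiff h g)) = (1 + exp (- h)) * norm (log_mellin \<tau> g)"
    by (simp only: norm_minus_cancel norm_mult norm_of_real) (simp add: abs_of_pos add_pos_pos)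
  moreover have "1 * norm (log_mellin \<tau> g) \<le> (1 + exp (- h)) * norm (log_mellin \<tau> g)"
    by (intro mult_right_mono) auto
  ultimately show ?thesis by (simp add: h_def)
qed

lemma norm_log_mellin_le_fdiff_pow:
  assumes "log_integrable g" "\<tau> \<noteq> 0"
  shows "norm (log_mellin \<tau> g) \<le> norm (log_mellin \<tau> ((fdiff (pi / \<bar>\<tau>\<bar>) ^^ m) g))"
    and "log_integrable ((fdiff (pi / \<bar>\<tau>\<bar>) ^^ m) g)"
proof -
  let ?h = "pi / \<bar>\<tau>\<bar>"
  have "norm (log_mellin \<tau> g) \<le> norm (log_mellin \<tau> ((fdiff ?h ^^ m) g)) \<and> log_integrable ((fdiff ?h ^^ m) g)"
  proof (induction m)
    case (Suc m)
    then show ?case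
      using norm_log_mellin_le_fdiff[of "(fdiff ?h ^^ m) g" \<tau>] log_integrable_fdiff[of "(fdiff ?h ^^ m) g" ?h] assms(2)
      by simp
  qed (use assms in simp)
  then show "norm (log_mellin \<tau> g) \<le> norm (log_mellin \<tau> ((fdiff ?h ^^ m) g))" "log_integrable ((fdiff ?h ^^ m) g)"
    by auto
qed

section \<open>The transform of \<open>F\<close> on the line \<open>Re u = 1\<close>\<close>

abbreviation "F_log \<equiv> (\<lambda>v. complex_of_real (F (exp v)))"

lemma continuous_F_log: "continuous_on UNIV F_log"
proof -
  obtain C where "deriv_bounded UNIV (Suc 0) (\<lambda>v. C / (1 + exp (2 * v))) 1 F_log" using deriv_bounded_F by blast
  then obtain g' where "\<And>z. (F_log has_vector_derivative g' z) (at z)"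
    by (rule deriv_bounded_SucE) auto
  then show ?thesis by (meson has_vector_derivative_continuous continuous_at_imp_continuous_on)
qed

lemma measurable_F_log [measurable]: "F_log \<in> borel_measurable borel"
  using continuous_F_log by (rule borel_measurable_continuous_onI)

lemma log_bound_transfer:
  assumes "\<And>v. norm (g v) \<le> C / (1 + exp (2 * v))" "C \<ge> 0"
  shows "norm (indicator {0<..} x *\<^sub>R (g (ln x) :: complex)) \<le> C / (1 + x\<^sup>2)"
proof (cases "x > 0")
  case True
  then have "exp (2 * ln x) = x\<^sup>2" by (simp add: exp_double)
  then show ?thesis using assms(1)[of "ln x"] True by simp
qed (use assms(2) in auto)

lemma log_integrable_F: "log_integrable F_log"
proof -
  obtain C where C: "C \<ge> 0" "deriv_bounded UNIV 0 (\<lambda>v. C / (1 + exp (2 * v))) 1 F_log" using deriv_bounded_F by blast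
  show ?thesis unfolding log_integrable_def
  proof (rule Bochner_Integration.integrable_bound[OF integrable_inverse_1_plus_power2[of C]])
    show "AE x in lborel. norm (indicat_real {0<..} x *\<^sub>R F_log (ln x)) \<le> norm (C / (1 + x\<^sup>2))"
      using log_bound_transfer[of F_log C] C by (intro AE_I2) (auto intro: order_trans[OF _ abs_ge_self])
  qed measurable
qed

lemma mellin_F_eq: "mellin F (Complex 1 \<tau>) = log_mellin \<tau> F_log"
  unfolding mellin_def log_mellin_def set_lebesgue_integral_def
proof (rule Bochner_Integration.integral_cong[OF refl])
  fix x :: real
  have "Complex 1 \<tau> - 1 = \<i> * of_real \<tau>" by (simp add: complex_eq_iff)
  then show "indicat_real {0<..} x *\<^sub>R (complex_of_real (F x) * complex_of_real x powr (Complex 1 \<tau> - 1)) =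
    indicat_real {0<..} x *\<^sub>R (F_log (ln x) * exp (\<i> * complex_of_real (\<tau> * ln x)))"
    by (auto simp: indicator_def powr_def Ln_of_real mult_ac)
qed

text \<open>Differencing \<open>m\<close> times with step \<open>pi / \<bar>\<tau>\<bar>\<close>
  gains \<open>(pi / \<bar>\<tau>\<bar>) ^ m\<close>; what remains is the integral of the majorant
  \<open>C / (1 + x^2)\<close>, the same for all \<open>\<tau>\<close>.\<close>

lemma mellin_F_decay: "\<exists>C\<ge>0. \<forall>\<tau>. \<bar>\<tau>\<bar> ^ m * norm (mellin F (Complex 1 \<tau>)) \<le> C"
proof -
  obtain C where C: "C \<ge> 0" "deriv_bounded UNIV m (\<lambda>v. C / (1 + exp (2 * v))) 1 F_log" using deriv_bounded_F by blast
  define I where "I = (LINT x|lborel. C / (1 + x\<^sup>2))"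
  have anti: "antimono (\<lambda>v. C / (1 + exp (2 * v)))"
    using C(1) by (auto simp: antimono_def add_pos_pos intro!: divide_left_mono)
  have bnd: "norm (log_mellin \<tau> g) \<le> B * I"
    if "log_integrable g" "\<And>v. norm (g v) \<le> B * (C / (1 + exp (2 * v)))" "B \<ge> 0" for g \<tau> B
  proof -
    have "norm (log_mellin \<tau> g) \<le> (LINT x|lborel. B * C / (1 + x\<^sup>2))"
      unfolding log_mellin_def
    proof (rule Bochner_Integration.integral_norm_bound_integral[OF log_integrable_twist[OF that(1)] integrable_inverse_1_plus_power2])
      fix x
      show "norm (indicat_real {0<..} x *\<^sub>R (g (ln x) * exp (\<i> * complex_of_real (\<tau> * ln x)))) \<le> B * C / (1 + x\<^sup>2)"
        using log_bound_transfer[of g "B * C" x] that C by (simp add: norm_mult)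
    qed
    also have "\<dots> = B * I" unfolding I_def by (simp flip: times_divide_eq_right)
    finally show ?thesis .
  qed
  have I: "I \<ge> 0" unfolding I_def using C by (intro integral_nonneg_AE AE_I2) auto
  have "\<bar>\<tau>\<bar> ^ m * norm (mellin F (Complex 1 \<tau>)) \<le> pi ^ m * I" for \<tau>
  proof (cases "\<tau> = 0")
    case False
    have "norm (log_mellin \<tau> F_log) \<le> norm (log_mellin \<tau> ((fdiff (pi / \<bar>\<tau>\<bar>) ^^ m) F_log))"
      by (rule norm_log_mellin_le_fdiff_pow(1)[OF log_integrable_F False])
    also have "\<dots> \<le> (pi / \<bar>\<tau>\<bar>) ^ m * I"
    proof (rule bnd[OF norm_log_mellin_le_fdiff_pow(2)[OF log_integrable_F False]])
      show "norm ((fdiff (pi / \<bar>\<tau>\<bar>) ^^ m) F_log v) \<le> (pi / \<bar>\<tau>\<bar>) ^ m * (C / (1 + exp (2 * v)))" for v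
        using fdiff_pow_bound_antimono[OF C(2) anti, of "pi / \<bar>\<tau>\<bar>" v] by simp
    qed auto
    finally show ?thesis using False by (simp add: mellin_F_eq power_divide field_simps)
  next
    case True
    have "norm (log_mellin \<tau> F_log) \<le> 1 * I"
      by (rule bnd[OF log_integrable_F]) (use deriv_bounded_norm[OF C(2)] in auto)
    then show ?thesis using I True by (cases m) (auto simp: mellin_F_eq)
  qed
  then show ?thesis using I by (intro exI[of _ "pi ^ m * I"]) auto
qed

lemma measurable_mellin_F: "(\<lambda>\<tau>. mellin F (Complex 1 \<tau>)) \<in> borel_measurable borel"
proof -
  have "(\<lambda>\<tau>. LINT x|lborel. indicator {0<..} x *\<^sub>R (F_log (ln x) * exp (\<i> * of_real (\<tau> * ln x)))) \<in> borel_measurable borel"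
    by (rule lborel.borel_measurable_lebesgue_integral) measurable
  then show ?thesis unfolding mellin_F_eq log_mellin_def .
qed

text \<open>With \<open>s = \<tau> / 2\<close> the arguments are \<open>1 + i s\<close> and
  \<open>1/2 - i s\<close>. The reflection formula gives \<open>pi s / sinh (pi s)\<close> and
  \<open>cosh (pi s) / pi\<close> for the squared moduli of the Gamma and the reciprocal Gamma
  value. The exponential factors cancel, and the square of the quotient is
  \<open>s coth (pi s)\<close>, at most \<open>1 + \<bar>s\<bar>\<close>. At \<open>s = 0\<close>
  these formulas degenerate and the value is computed directly.\<close>

lemma Gamma_ratio_bound:
  "norm (Gamma ((1 + Complex 1 \<tau>) / 2) / Gamma ((2 - Complex 1 \<tau>) / 2)) \<le> 1 + \<bar>\<tau>\<bar>"
proof (cases "\<tau> = 0")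
  case True
  have "Gamma ((1 + Complex 1 \<tau>) / 2) = 1" "Gamma ((2 - Complex 1 \<tau>) / 2) = complex_of_real (sqrt pi)"
    using True by (simp_all add: Complex_eq Gamma_one_half_complex)
  moreover have "sqrt pi \<ge> 1" using pi_ge_two by simp
  ultimately show ?thesis using True by (simp add: norm_divide field_simps)
next
  case False
  define s where "s = \<tau> / 2"
  have s: "s \<noteq> 0" using False by (simp add: s_def)
  have e1: "(1 + Complex 1 \<tau>) / 2 = 1 + \<i> * of_real s" and e2: "(2 - Complex 1 \<tau>) / 2 = 1 / 2 - \<i> * of_real s"
    by (auto simp: complex_eq_iff s_def)
  have sn: "sin (of_real pi * (\<i> * of_real s)) = \<i> * of_real (sinh (pi * s))"
  proof -
    have eq: "of_real pi * (\<i> * of_real s) = \<i> * complex_of_real (pi * s)" by simp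
    show ?thesis
      unfolding eq by (simp add: sin_i_times sinh_def exp_of_real exp_minus del: of_real_mult)
  qed
  have cs: "sin (of_real pi * (1 / 2 - \<i> * of_real s)) = of_real (cosh (pi * s))"
  proof -
    have "of_real pi * (1 / 2 - \<i> * of_real s) = of_real pi / 2 - \<i> * of_real (pi * s)"
      by (simp add: algebra_simps)
    then have "sin (of_real pi * (1 / 2 - \<i> * of_real s)) = cos (\<i> * of_real (pi * s))"
      by (simp only: cos_sin_eq)
    also have "\<dots> = of_real (cosh (pi * s))"
      by (simp add: cos_i_times cosh_def exp_of_real exp_minus del: of_real_mult)
    finally show ?thesis .
  qed
  have sh: "sinh (pi * s) \<noteq> 0" using s by simp
  have g1: "Gamma (1 + \<i> * of_real s) * Gamma (1 - \<i> * of_real s) = of_real (pi * s / sinh (pi * s))"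
  proof -
    have "\<i> * of_real s \<notin> \<int>\<^sub>\<le>\<^sub>0" using s by (auto elim!: nonpos_Ints_cases simp: complex_eq_iff)
    then have "Gamma (1 + \<i> * of_real s) = \<i> * of_real s * Gamma (\<i> * of_real s)"
      using Gamma_plus1[of "\<i> * of_real s"] by (simp add: add.commute)
    then have "Gamma (1 + \<i> * of_real s) * Gamma (1 - \<i> * of_real s) =
        \<i> * of_real s * (of_real pi / (\<i> * of_real (sinh (pi * s))))"
      using Gamma_reflection_complex[of "\<i> * of_real s"] unfolding sn by (simp add: mult_ac)
    then show ?thesis using sh by (simp add: field_simps)
  qed
  have g2: "rGamma (1 / 2 - \<i> * of_real s) * rGamma (1 / 2 + \<i> * of_real s) = of_real (cosh (pi * s) / pi)"
    using rGamma_reflection_complex[of "1 / 2 - \<i> * of_real s"] unfolding cs by (simp add: algebra_simps)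
  have n1: "(norm (Gamma (1 + \<i> * of_real s)))\<^sup>2 = pi * s / sinh (pi * s)"
  proof -
    have "cnj (Gamma (1 + \<i> * of_real s)) = Gamma (1 - \<i> * of_real s)" by (simp add: cnj_Gamma)
    then have "complex_of_real ((norm (Gamma (1 + \<i> * of_real s)))\<^sup>2) = of_real (pi * s / sinh (pi * s))"
      using g1 complex_norm_square[of "Gamma (1 + \<i> * of_real s)"] by simp
    then show ?thesis by (simp only: of_real_eq_iff)
  qed
  have n2: "(norm (rGamma (1 / 2 - \<i> * of_real s)))\<^sup>2 = cosh (pi * s) / pi"
  proof -
    have "cnj (rGamma (1 / 2 - \<i> * of_real s)) = rGamma (1 / 2 + \<i> * of_real s)" by (simp add: cnj_rGamma)
    then have "complex_of_real ((norm (rGamma (1 / 2 - \<i> * of_real s)))\<^sup>2) = of_real (cosh (pi * s) / pi)"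
      using g2 complex_norm_square[of "rGamma (1 / 2 - \<i> * of_real s)"] by simp
    then show ?thesis by (simp only: of_real_eq_iff)
  qed
  define R where "R = norm (Gamma ((1 + Complex 1 \<tau>) / 2) / Gamma ((2 - Complex 1 \<tau>) / 2))"
  have "R = norm (Gamma (1 + \<i> * of_real s)) * norm (rGamma (1 / 2 - \<i> * of_real s))"
    unfolding R_def e1 e2 unfolding Gamma_def[of "1 / 2 - _"] divide_inverse[of _ "inverse _"] by (simp add: norm_mult)
  then have "R\<^sup>2 = s * cosh (pi * s) / sinh (pi * s)"
    by (simp add: power_mult_distrib n1 n2)
  also have "\<dots> = \<bar>s\<bar> * cosh (pi * \<bar>s\<bar>) / sinh (pi * \<bar>s\<bar>)"
    by (cases "s \<ge> 0") auto
  also have "\<dots> \<le> 1 + \<bar>s\<bar>"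
  proof -
    define x where "x = pi * \<bar>s\<bar>"
    have x: "x > 0" using s by (simp add: x_def)
    \<comment> \<open>This gives \<open>\<bar>s\<bar> \<le> sinh x\<close> because
      \<open>pi / 2 \<ge> 1\<close>; with \<open>cosh x = sinh x + exp (- x)\<close> the quotient
      then exceeds \<open>\<bar>s\<bar>\<close> by at most 1.\<close>
    have "x / 2 \<le> sinh x"
    proof -
      have "exp (- x) \<le> 1" "1 + x \<le> exp x" using x exp_ge_add_one_self[of x] by auto
      then have "x \<le> exp x - exp (- x)" by linarith
      then show ?thesis by (simp add: sinh_def)
    qed
    then have sx: "\<bar>s\<bar> \<le> sinh x"
      using pi_ge_two mult_right_mono[of 2 pi "\<bar>s\<bar>"] by (simp add: x_def)
    have "cosh x = sinh x + exp (- x)" by (simp add: cosh_def sinh_def field_simps)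
    moreover have "\<bar>s\<bar> * exp (- x) \<le> sinh x * 1" using sx x by (intro mult_mono) auto
    moreover have "sinh x > 0" using x by simp
    ultimately show ?thesis unfolding x_def[symmetric] by (simp add: divide_le_eq algebra_simps)
  qed
  also have "\<dots> \<le> (1 + \<bar>\<tau>\<bar>)\<^sup>2" by (simp add: s_def power2_eq_square algebra_simps)
  finally have "R \<le> 1 + \<bar>\<tau>\<bar>" by (rule power2_le_imp_le) auto
  then show ?thesis by (simp add: R_def)
qed

text \<open>The Taylor remainder \<open>exp (i x) - 1 - i x\<close> is at most \<open>x^2\<close> in
  modulus, so the difference quotient is off by at most \<open>\<bar>y - v\<bar>\<close> times the
  second absolute moment of \<open>\<rho>\<close>. No limit theorem for integrals is
  involved.\<close>

lemma fourier_has_vector_derivative: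
  fixes \<rho> :: "real \<Rightarrow> complex"
  assumes [measurable]: "\<rho> \<in> borel_measurable borel"
    and int: "\<And>j. integrable lborel (\<lambda>\<tau>. \<bar>\<tau>\<bar> ^ j * norm (\<rho> \<tau>))"
  shows "((\<lambda>v. LINT \<tau>|lborel. \<rho> \<tau> * iexp (- (\<tau> * v))) has_vector_derivative
           (LINT \<tau>|lborel. \<rho> \<tau> * (- \<i> * of_real \<tau>) * iexp (- (\<tau> * v)))) (at v)"
proof -
  define h where "h v = (LINT \<tau>|lborel. \<rho> \<tau> * iexp (- (\<tau> * v)))" for v
  define h' where "h' = (LINT \<tau>|lborel. \<rho> \<tau> * (- \<i> * of_real \<tau>) * iexp (- (\<tau> * v)))"
  define K where "K = (LINT \<tau>|lborel. \<bar>\<tau>\<bar> ^ 2 * norm (\<rho> \<tau>))"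
  have i0: "integrable lborel (\<lambda>\<tau>. \<rho> \<tau> * iexp (- (\<tau> * v)))" for v
    by (rule Bochner_Integration.integrable_bound[OF int[of 0]]) (auto simp: norm_mult)
  have i1: "integrable lborel (\<lambda>\<tau>. \<rho> \<tau> * (- \<i> * of_real \<tau>) * iexp (- (\<tau> * v)))" for v
    by (rule Bochner_Integration.integrable_bound[OF int[of 1]]) (auto simp: norm_mult mult_ac)
  have *: "norm (h y - h v - (y - v) *\<^sub>R h') \<le> (y - v)\<^sup>2 * K" for y
  proof -
    have "h y - h v - (y - v) *\<^sub>R h' = (LINT \<tau>|lborel. \<rho> \<tau> * iexp (- (\<tau> * y)) - \<rho> \<tau> * iexp (- (\<tau> * v))
       - (y - v) *\<^sub>R (\<rho> \<tau> * (- \<i> * of_real \<tau>) * iexp (- (\<tau> * v))))"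
      unfolding h_def h'_def using i0[of y] i0[of v] i1[of v]
      by (simp add: Bochner_Integration.integral_diff)
    also have "norm \<dots> \<le> (LINT \<tau>|lborel. (y - v)\<^sup>2 * (\<bar>\<tau>\<bar> ^ 2 * norm (\<rho> \<tau>)))"
    proof (rule Bochner_Integration.integral_norm_bound_integral)
      show "integrable lborel (\<lambda>\<tau>. \<rho> \<tau> * iexp (- (\<tau> * y)) - \<rho> \<tau> * iexp (- (\<tau> * v))
         - (y - v) *\<^sub>R (\<rho> \<tau> * (- \<i> * of_real \<tau>) * iexp (- (\<tau> * v))))"
        by (intro Bochner_Integration.integrable_diff i0 Bochner_Integration.integrable_scaleR_right i1)
      show "integrable lborel (\<lambda>\<tau>. (y - v)\<^sup>2 * (\<bar>\<tau>\<bar> ^ 2 * norm (\<rho> \<tau>)))"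
        by (intro integrable_mult_right int)
      fix \<tau> :: real
      define x where "x = - (\<tau> * (y - v))"
      have "iexp (- (\<tau> * y)) = iexp (- (\<tau> * v)) * iexp x"
        unfolding exp_add[symmetric] x_def by (simp add: algebra_simps)
      then have "\<rho> \<tau> * iexp (- (\<tau> * y)) - \<rho> \<tau> * iexp (- (\<tau> * v)) - (y - v) *\<^sub>R (\<rho> \<tau> * (- \<i> * of_real \<tau>) * iexp (- (\<tau> * v)))
         = \<rho> \<tau> * iexp (- (\<tau> * v)) * (iexp x - (1 + \<i> * of_real x))"
        by (simp add: algebra_simps x_def scaleR_conv_of_real)
      moreover have "norm (iexp x - (1 + \<i> * of_real x)) \<le> \<bar>x\<bar>\<^sup>2"
      proof -
        have "norm (iexp x - (1 + \<i> * of_real x)) \<le> \<bar>x\<bar>\<^sup>2 / 2"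
          using iexp_approx1[of x 1] by (simp add: numeral_2_eq_2)
        also have "\<dots> \<le> \<bar>x\<bar>\<^sup>2" by simp
        finally show ?thesis .
      qed
      ultimately have "norm (\<rho> \<tau> * iexp (- (\<tau> * y)) - \<rho> \<tau> * iexp (- (\<tau> * v)) - (y - v) *\<^sub>R (\<rho> \<tau> * (- \<i> * of_real \<tau>) * iexp (- (\<tau> * v))))
         \<le> norm (\<rho> \<tau>) * \<bar>x\<bar>\<^sup>2"
        by (simp add: norm_mult mult_left_mono)
      also have "\<dots> = (y - v)\<^sup>2 * (\<bar>\<tau>\<bar> ^ 2 * norm (\<rho> \<tau>))"
        by (simp add: x_def power_mult_distrib mult_ac)
      finally show "norm (\<rho> \<tau> * iexp (- (\<tau> * y)) - \<rho> \<tau> * iexp (- (\<tau> * v)) - (y - v) *\<^sub>R (\<rho> \<tau> * (- \<i> * of_real \<tau>) * iexp (- (\<tau> * v))))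
         \<le> (y - v)\<^sup>2 * (\<bar>\<tau>\<bar> ^ 2 * norm (\<rho> \<tau>))" .
    qed
    also have "\<dots> = (y - v)\<^sup>2 * K" unfolding K_def by simp
    finally show ?thesis .
  qed
  have "(h has_derivative (\<lambda>t. t *\<^sub>R h')) (at v)"
  proof (rule has_derivativeI_sandwich[of 1])
    show "bounded_linear (\<lambda>t. t *\<^sub>R h')" by (rule bounded_linear_scaleR_left)
    fix y assume "y \<noteq> v"
    then show "norm (h y - h v - (y - v) *\<^sub>R h') / norm (y - v) \<le> \<bar>y - v\<bar> * K"
      using *[of y] by (simp add: divide_le_eq power2_eq_square algebra_simps abs_mult_self_eq flip: power2_eq_square)
  next
    show "((\<lambda>y. \<bar>y - v\<bar> * K) \<longlongrightarrow> 0) (at v)"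
      by (auto intro!: tendsto_eq_intros)
  qed auto
  then show ?thesis unfolding has_vector_derivative_def h_def h'_def .
qed

text \<open>A derivative multiplies the density by \<open>- i \<tau>\<close>, and finiteness of all
  absolute moments survives this.\<close>

lemma deriv_bounded_fourier:
  fixes \<rho> :: "real \<Rightarrow> complex"
  assumes "\<rho> \<in> borel_measurable borel" "\<And>j. integrable lborel (\<lambda>\<tau>. \<bar>\<tau>\<bar> ^ j * norm (\<rho> \<tau>))"
  shows "\<exists>K\<ge>0. deriv_bounded UNIV m (\<lambda>_. K) 1 (\<lambda>v. LINT \<tau>|lborel. \<rho> \<tau> * iexp (- (\<tau> * v)))"
  using assms
proof (induction m arbitrary: \<rho>)
  have bnd: "norm (LINT \<tau>|lborel. \<rho> \<tau> * iexp (- (\<tau> * v))) \<le> (LINT \<tau>|lborel. norm (\<rho> \<tau>))" for \<rho> v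
    by (rule order_trans[OF integral_norm_bound]) (simp add: norm_mult)
  {
    case 0
    have "deriv_bounded UNIV 0 (\<lambda>_. LINT \<tau>|lborel. norm (\<rho> \<tau>)) 1 (\<lambda>v. LINT \<tau>|lborel. \<rho> \<tau> * iexp (- (\<tau> * v)))"
      unfolding deriv_bounded.simps using bnd by blast
    moreover have "(LINT \<tau>|lborel. norm (\<rho> \<tau>)) \<ge> 0" by simp
    ultimately show ?case by blast
  next
    case (Suc m)
    let ?r = "\<lambda>\<tau>. \<rho> \<tau> * (- \<i> * of_real \<tau>)"
    have "\<exists>K\<ge>0. deriv_bounded UNIV m (\<lambda>_. K) 1 (\<lambda>v. LINT \<tau>|lborel. ?r \<tau> * iexp (- (\<tau> * v)))"
    proof (rule Suc.IH)
      show "?r \<in> borel_measurable borel" using Suc.prems(1) by measurable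
      show "integrable lborel (\<lambda>\<tau>. \<bar>\<tau>\<bar> ^ j * norm (?r \<tau>))" for j
        using Suc.prems(2)[of "Suc j"] by (simp add: norm_mult mult_ac)
    qed
    then obtain K where K: "K \<ge> 0" "deriv_bounded UNIV m (\<lambda>_. K) 1 (\<lambda>v. LINT \<tau>|lborel. ?r \<tau> * iexp (- (\<tau> * v)))" by blast
    define K' where "K' = K + (LINT \<tau>|lborel. norm (\<rho> \<tau>))"
    have K': "K \<le> K'" "(LINT \<tau>|lborel. norm (\<rho> \<tau>)) \<le> K'" using K by (auto simp: K'_def)
    have "deriv_bounded UNIV m (\<lambda>_. K' * 1) 1 (\<lambda>v. LINT \<tau>|lborel. ?r \<tau> * iexp (- (\<tau> * v)))"
      by (rule deriv_bounded_mono[OF K(2)]) (use K K' in auto)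
    moreover have "norm (LINT \<tau>|lborel. \<rho> \<tau> * iexp (- (\<tau> * v))) \<le> K'" for v
      using bnd K'(2) by (rule order_trans)
    ultimately have "deriv_bounded UNIV (Suc m) (\<lambda>_. K') 1 (\<lambda>v. LINT \<tau>|lborel. \<rho> \<tau> * iexp (- (\<tau> * v)))"
      unfolding deriv_bounded.simps
      by (intro conjI ballI exI[of _ "\<lambda>v. LINT \<tau>|lborel. ?r \<tau> * iexp (- (\<tau> * v))"] fourier_has_vector_derivative Suc.prems)
    moreover have "K' \<ge> 0" using K K' by linarith
    ultimately show ?case by blast
  }
qed

text \<open>The part of the integrand of \<open>t H(t)\<close> that does not depend on
  \<open>t\<close>. For \<open>t = exp v\<close> and \<open>u = 1 + i \<tau>\<close> the factor
  \<open>t * (pi * t) powr (- u)\<close> equals \<open>pi powr (- u)\<close> times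
  \<open>exp (- i \<tau> v)\<close>: on the line \<open>Re u = 1\<close> the growth of
  \<open>t\<close> is cancelled, so \<open>t H(t)\<close> is a Fourier integral in
  \<open>v\<close>.\<close>

definition H_density :: "real \<Rightarrow> complex" where
  "H_density \<tau> = complex_of_real (sqrt pi) / (2 * complex_of_real pi) *
     (Gamma ((1 + Complex 1 \<tau>) / 2) / Gamma ((2 - Complex 1 \<tau>) / 2)) *
     exp (- Complex 1 \<tau> * of_real (ln pi)) * mellin F (Complex 1 \<tau>)"

lemma exp_mult_H_eq: "complex_of_real (exp v) * H (exp v) = (LINT \<tau>|lborel. H_density \<tau> * iexp (- (\<tau> * v)))"
proof -
  have *: "complex_of_real (pi * exp v) powr (- Complex 1 \<tau>) =
      exp (- Complex 1 \<tau> * of_real (ln pi)) * iexp (- (\<tau> * v)) * complex_of_real (exp (- v))" for \<tau>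
  proof -
    have "complex_of_real (pi * exp v) powr (- Complex 1 \<tau>) = exp (- Complex 1 \<tau> * of_real (ln pi + v))"
      using Ln_of_real[of "pi * exp v"] by (simp add: powr_def ln_mult)
    also have "- Complex 1 \<tau> * of_real (ln pi + v) = - Complex 1 \<tau> * of_real (ln pi) + \<i> * complex_of_real (- (\<tau> * v)) + of_real (- v)"
      by (simp add: complex_eq_iff algebra_simps)
    finally show ?thesis by (simp only: exp_add exp_of_real)
  qed
  have "complex_of_real (exp v) * H (exp v) =
     (LINT \<tau>|lborel. complex_of_real (exp v) * (complex_of_real (sqrt pi) / (2 * complex_of_real pi * \<i>)) *
       (Gamma ((1 + Complex 1 \<tau>) / 2) / Gamma ((2 - Complex 1 \<tau>) / 2)
          * complex_of_real (pi * exp v) powr (- Complex 1 \<tau>) * mellin F (Complex 1 \<tau>) * \<i>))"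
    unfolding H_def vertical_integral_def by (subst integral_mult_right_zero) (simp only: mult_ac)
  also have "\<dots> = (LINT \<tau>|lborel. H_density \<tau> * iexp (- (\<tau> * v)))"
  proof (rule Bochner_Integration.integral_cong[OF refl])
    fix \<tau>
    have "complex_of_real (exp v) * complex_of_real (exp (- v)) = 1"
      by (simp flip: of_real_mult exp_add)
    then show "complex_of_real (exp v) * (complex_of_real (sqrt pi) / (2 * complex_of_real pi * \<i>)) *
       (Gamma ((1 + Complex 1 \<tau>) / 2) / Gamma ((2 - Complex 1 \<tau>) / 2)
          * complex_of_real (pi * exp v) powr (- Complex 1 \<tau>) * mellin F (Complex 1 \<tau>) * \<i>) = H_density \<tau> * iexp (- (\<tau> * v))"
      unfolding H_density_def * by (simp add: field_simps)
  qed
  finally show ?thesis .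
qed

lemma H_density_integrable: "integrable lborel (\<lambda>\<tau>. \<bar>\<tau>\<bar> ^ j * norm (H_density \<tau>))"
  and H_density_measurable: "H_density \<in> borel_measurable borel"
proof -
  have c1: "continuous_on UNIV (\<lambda>\<tau>. Gamma ((1 + Complex 1 \<tau>) / 2))"
  proof (rule continuous_on_compose2[OF continuous_on_Gamma[of "- \<int>\<^sub>\<le>\<^sub>0"]])
    have "(1 + Complex 1 \<tau>) / 2 \<notin> \<int>\<^sub>\<le>\<^sub>0" for \<tau>
      by (auto elim!: nonpos_Ints_cases simp: complex_eq_iff)
    then show "range (\<lambda>\<tau>. (1 + Complex 1 \<tau>) / 2) \<subseteq> - \<int>\<^sub>\<le>\<^sub>0" by auto
  qed (auto simp: Complex_eq intro!: continuous_intros)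
  have c2: "continuous_on UNIV (\<lambda>\<tau>. rGamma ((2 - Complex 1 \<tau>) / 2))"
    by (rule continuous_on_compose2[OF continuous_on_rGamma[of UNIV]]) (auto simp: Complex_eq intro!: continuous_intros)
  have c3: "continuous_on UNIV (\<lambda>\<tau>. exp (- Complex 1 \<tau> * of_real (ln pi)))"
    unfolding Complex_eq by (intro continuous_intros)
  have m: "(\<lambda>\<tau>. complex_of_real (sqrt pi) / (2 * complex_of_real pi) *
     (Gamma ((1 + Complex 1 \<tau>) / 2) * rGamma ((2 - Complex 1 \<tau>) / 2)) *
     exp (- Complex 1 \<tau> * of_real (ln pi)) * mellin F (Complex 1 \<tau>)) \<in> borel_measurable borel"
    by (intro borel_measurable_times borel_measurable_const borel_measurable_continuous_onI[OF c1]
        borel_measurable_continuous_onI[OF c2] borel_measurable_continuous_onI[OF c3] measurable_mellin_F)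
  moreover have "(\<lambda>\<tau>. complex_of_real (sqrt pi) / (2 * complex_of_real pi) *
     (Gamma ((1 + Complex 1 \<tau>) / 2) * rGamma ((2 - Complex 1 \<tau>) / 2)) *
     exp (- Complex 1 \<tau> * of_real (ln pi)) * mellin F (Complex 1 \<tau>)) = H_density"
    unfolding H_density_def [abs_def] Gamma_def[of "(2 - _) / 2"] divide_inverse[of _ "inverse _"] inverse_inverse_eq ..
  ultimately show meas: "H_density \<in> borel_measurable borel" by simp
  \<comment> \<open>The four decay bounds match the expansion of
    \<open>(1 + \<bar>\<tau>\<bar>) * (1 + \<tau>^2)\<close>: the Gamma quotient grows at most
    linearly, and the integrable majorant \<open>1 / (1 + \<tau>^2)\<close> takes two more
    powers.\<close>
  obtain C0 where C0: "\<And>\<tau>. \<bar>\<tau>\<bar> ^ j * norm (mellin F (Complex 1 \<tau>)) \<le> C0" using mellin_F_decay by blast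
  obtain C1 where C1: "\<And>\<tau>. \<bar>\<tau>\<bar> ^ (j + 1) * norm (mellin F (Complex 1 \<tau>)) \<le> C1" using mellin_F_decay by blast
  obtain C2 where C2: "\<And>\<tau>. \<bar>\<tau>\<bar> ^ (j + 2) * norm (mellin F (Complex 1 \<tau>)) \<le> C2" using mellin_F_decay by blast
  obtain C3 where C3: "\<And>\<tau>. \<bar>\<tau>\<bar> ^ (j + 3) * norm (mellin F (Complex 1 \<tau>)) \<le> C3" using mellin_F_decay by blast
  define A where "A = norm (complex_of_real (sqrt pi) / (2 * complex_of_real pi)) * exp (- ln pi)"
  have A: "A \<ge> 0" by (simp add: A_def)
  show "integrable lborel (\<lambda>\<tau>. \<bar>\<tau>\<bar> ^ j * norm (H_density \<tau>))"
  proof (rule Bochner_Integration.integrable_bound[OF integrable_inverse_1_plus_power2[of "A * (C0 + C1 + C2 + C3)"]])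
    show "(\<lambda>\<tau>. \<bar>\<tau>\<bar> ^ j * norm (H_density \<tau>)) \<in> borel_measurable lborel" using meas by measurable
    have "\<bar>\<tau>\<bar> ^ j * norm (H_density \<tau>) \<le> A * (C0 + C1 + C2 + C3) / (1 + \<tau>\<^sup>2)" for \<tau>
    proof -
      let ?M = "norm (mellin F (Complex 1 \<tau>))"
      let ?R = "norm (Gamma ((1 + Complex 1 \<tau>) / 2) / Gamma ((2 - Complex 1 \<tau>) / 2))"
      have "norm (exp (- Complex 1 \<tau> * of_real (ln pi))) = exp (- ln pi)"
        by (simp add: norm_exp_eq_Re)
      then have "norm (H_density \<tau>) = A * ?R * ?M"
        unfolding H_density_def norm_mult A_def by simp
      also have "\<dots> \<le> A * (1 + \<bar>\<tau>\<bar>) * ?M"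
        by (intro mult_right_mono mult_left_mono Gamma_ratio_bound A) auto
      finally have "(\<bar>\<tau>\<bar> ^ j * norm (H_density \<tau>)) * (1 + \<tau>\<^sup>2) \<le> (\<bar>\<tau>\<bar> ^ j * (A * (1 + \<bar>\<tau>\<bar>) * ?M)) * (1 + \<bar>\<tau>\<bar>\<^sup>2)"
        using A by (intro mult_mono) auto
      also have "\<dots> = A * (\<bar>\<tau>\<bar> ^ j * ?M + \<bar>\<tau>\<bar> ^ (j + 1) * ?M + \<bar>\<tau>\<bar> ^ (j + 2) * ?M + \<bar>\<tau>\<bar> ^ (j + 3) * ?M)"
        by (simp add: algebra_simps power_add power2_eq_square power3_eq_cube)
      also have "\<dots> \<le> A * (C0 + C1 + C2 + C3)"
        by (intro mult_left_mono add_mono C0 C1 C2 C3 A)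
      finally show ?thesis by (subst pos_le_divide_eq) (auto simp: add_pos_nonneg)
    qed
    note bnd = this
    have "norm (\<bar>\<tau>\<bar> ^ j * norm (H_density \<tau>)) \<le> norm (A * (C0 + C1 + C2 + C3) / (1 + \<tau>\<^sup>2))" for \<tau>
    proof -
      have "norm (\<bar>\<tau>\<bar> ^ j * norm (H_density \<tau>)) = \<bar>\<tau>\<bar> ^ j * norm (H_density \<tau>)" by simp
      also note bnd
      also have "A * (C0 + C1 + C2 + C3) / (1 + \<tau>\<^sup>2) \<le> norm (A * (C0 + C1 + C2 + C3) / (1 + \<tau>\<^sup>2))"
        unfolding real_norm_def by (rule abs_ge_self)
      finally show ?thesis .
    qed
    then show "AE \<tau> in lborel. norm (\<bar>\<tau>\<bar> ^ j * norm (H_density \<tau>)) \<le> norm (A * (C0 + C1 + C2 + C3) / (1 + \<tau>\<^sup>2))"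
      by (intro AE_I2)
  qed
qed

definition FH_log :: "real \<Rightarrow> complex" where
  "FH_log v = complex_of_real (F (exp v)) + complex_of_real (exp v) * H (exp v)"

lemma deriv_bounded_FH: "\<exists>K\<ge>0. deriv_bounded UNIV m (\<lambda>_. K) 1 FH_log"
proof -
  obtain C where C: "C \<ge> 0" "deriv_bounded UNIV m (\<lambda>v. C / (1 + exp (2 * v))) 1 F_log" using deriv_bounded_F by blast
  have F: "deriv_bounded UNIV m (\<lambda>_. C) 1 F_log"
    by (rule deriv_bounded_mono[OF C(2)]) (use C(1) in \<open>auto simp: divide_le_eq add_pos_pos algebra_simps\<close>)
  obtain K where K: "K \<ge> 0" "deriv_bounded UNIV m (\<lambda>_. K) 1 (\<lambda>v. LINT \<tau>|lborel. H_density \<tau> * iexp (- (\<tau> * v)))"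
    using deriv_bounded_fourier[OF H_density_measurable H_density_integrable] by blast
  from deriv_bounded_add[OF F K(2)] have "deriv_bounded UNIV m (\<lambda>_. C + K) 1 FH_log"
    unfolding exp_mult_H_eq[symmetric] FH_log_def [abs_def] .
  then show ?thesis using C K by (intro exI[of _ "C + K"]) auto
qed

section \<open>Integration by parts in the archimedean integral\<close>

text \<open>The two bases are \<open>cis (arccos x)\<close> and its conjugate, so de Moivre applies.
  At the endpoints the sine of a multiple of \<open>pi\<close> agrees with the default value
  0.\<close>

lemma theta_infty_eq_sin:
  assumes "\<bar>x\<bar> \<le> 1"
  shows "theta_infty k x = - sin (real (k - 1) * arccos x) / pi"
proof (cases "\<bar>x\<bar> < 1")
  case True
  have x: "-1 \<le> x" "x \<le> 1" using True by auto
  have z: "complex_of_real x + \<i> * complex_of_real (sqrt (1 - x\<^sup>2)) = cis (arccos x)"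
    using x by (simp add: complex_eq_iff cos_arccos_abs sin_arccos_abs)
  have z': "complex_of_real x - \<i> * complex_of_real (sqrt (1 - x\<^sup>2)) = cis (- arccos x)"
    using x by (simp add: complex_eq_iff cos_arccos_abs sin_arccos_abs)
  have Im: "Im (cis a ^ m) = sin (real m * a)" for a m
    by (simp only: Complex.DeMoivre cis.sel)
  show ?thesis unfolding theta_infty_def z z' using True by (simp add: Im)
next
  case False
  then have "x = 1 \<or> x = -1" using assms by auto
  moreover have "sin (real m * pi) = 0" for m by (rule sin_npi)
  ultimately show ?thesis by (auto simp: theta_infty_def)
qed

lemma abs_sin_mult_le: "\<bar>sin (real m * t)\<bar> \<le> m * \<bar>sin t\<bar>"
proof (induction m)
  case (Suc m)
  have "\<bar>sin (real (Suc m) * t)\<bar> = \<bar>sin (real m * t) * cos t + cos (real m * t) * sin t\<bar>"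
    using sin_add[of "real m * t" t] by (simp add: distrib_right add.commute)
  also have "\<dots> \<le> \<bar>sin (real m * t)\<bar> * \<bar>cos t\<bar> + \<bar>cos (real m * t)\<bar> * \<bar>sin t\<bar>"
    by (metis abs_mult abs_triangle_ineq)
  also have "\<dots> \<le> (m * \<bar>sin t\<bar>) * 1 + 1 * \<bar>sin t\<bar>"
    using Suc by (intro add_mono mult_mono) auto
  finally show ?case by (simp add: algebra_simps)
qed simp

lemma abs_theta_infty_le:
  assumes "\<bar>x\<bar> \<le> 1"
  shows "\<bar>theta_infty k x\<bar> \<le> real (k - 1) * sqrt (1 - x\<^sup>2)"
proof -
  have "\<bar>theta_infty k x\<bar> = \<bar>sin (real (k - 1) * arccos x)\<bar> / pi"
    using assms by (simp add: theta_infty_eq_sin)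
  also have "\<dots> \<le> \<bar>sin (real (k - 1) * arccos x)\<bar> / 1"
    using pi_ge_two by (intro divide_left_mono) auto
  also have "\<dots> \<le> real (k - 1) * \<bar>sin (arccos x)\<bar>" using abs_sin_mult_le[of "k - 1"] by simp
  also have "sin (arccos x) = sqrt (1 - x\<^sup>2)" using assms by (simp add: sin_arccos_abs)
  finally show ?thesis using assms by (simp add: abs_square_le_1)
qed

text \<open>The derivative for \<open>\<bar>x\<bar> < 1\<close>. It is unbounded near the endpoints,
  but only like an integrable inverse square root; at the endpoints themselves division by zero
  makes it 0.\<close>

definition theta_infty' :: "nat \<Rightarrow> real \<Rightarrow> real" where
  "theta_infty' k x = real (k - 1) * cos (real (k - 1) * arccos x) / (pi * sqrt (1 - x\<^sup>2))"

lemma theta_infty_has_real_derivative: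
  assumes "\<bar>x\<bar> < 1"
  shows "(theta_infty k has_real_derivative theta_infty' k x) (at x)"
proof -
  have "((\<lambda>x. - sin (real (k - 1) * arccos x) / pi) has_real_derivative theta_infty' k x) (at x)"
    using assms unfolding theta_infty'_def by (auto intro!: derivative_eq_intros simp: field_simps)
  then show ?thesis
    by (rule has_field_derivative_transform_within_open[of _ _ _ "{-1<..<1}"])
       (use assms in \<open>auto simp: theta_infty_eq_sin\<close>)
qed

lemma abs_theta_infty'_le: "\<bar>theta_infty' k x\<bar> \<le> real (k - 1) * (1 / sqrt (1 - x\<^sup>2))" if "\<bar>x\<bar> < 1"
proof -
  have s: "sqrt (1 - x\<^sup>2) > 0" using that by (simp add: abs_square_less_1)
  have "\<bar>theta_infty' k x\<bar> = real (k - 1) * \<bar>cos (real (k - 1) * arccos x)\<bar> / (pi * sqrt (1 - x\<^sup>2))"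
    using s by (simp add: theta_infty'_def abs_mult)
  also have "\<dots> \<le> real (k - 1) * 1 / (1 * sqrt (1 - x\<^sup>2))"
    using s pi_ge_two by (intro frac_le mult_mono mult_left_mono) auto
  finally show ?thesis by simp
qed

text \<open>\<open>x / (1 - x^2)\<close> is the derivative of \<open>ln t\<close>; its pole at the
  endpoints is weakened by the zero of \<open>theta_infty\<close> to an integrable inverse square
  root.\<close>

lemma abs_theta_infty_quotient_le:
  assumes "\<bar>x\<bar> < 1"
  shows "\<bar>theta_infty k x * (x / (1 - x\<^sup>2))\<bar> \<le> real (k - 1) * (1 / sqrt (1 - x\<^sup>2))"
proof -
  have s: "1 - x\<^sup>2 > 0" using assms by (simp add: abs_square_less_1)
  have "\<bar>theta_infty k x * (x / (1 - x\<^sup>2))\<bar> = \<bar>theta_infty k x\<bar> * (\<bar>x\<bar> / (1 - x\<^sup>2))"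
    using s by (simp add: abs_mult)
  also have "\<dots> \<le> (real (k - 1) * sqrt (1 - x\<^sup>2)) * (1 / (1 - x\<^sup>2))"
    using s assms by (intro mult_mono divide_right_mono abs_theta_infty_le) auto
  also have "\<dots> = real (k - 1) * (1 / sqrt (1 - x\<^sup>2))"
    using s real_sqrt_mult_self[of "1 - x\<^sup>2"] by (simp add: field_simps)
  finally show ?thesis .
qed

lemma has_integral_inverse_sqrt: "((\<lambda>x. 1 / sqrt (1 - x\<^sup>2)) has_integral pi) {-1..1::real}"
proof -
  have "((\<lambda>x. 1 / sqrt (1 - x\<^sup>2)) has_integral (arcsin 1 - arcsin (-1))) {-1..1::real}"
  proof (rule fundamental_theorem_of_calculus_interior)
    fix x :: real assume x: "x \<in> {-1<..<1}"
    then have "(arcsin has_real_derivative 1 / sqrt (1 - x\<^sup>2)) (at x)"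
      by (auto intro!: derivative_eq_intros simp: field_simps)
    then show "(arcsin has_vector_derivative 1 / sqrt (1 - x\<^sup>2)) (at x)"
      by (simp add: has_real_derivative_iff_has_vector_derivative)
  qed (auto intro!: continuous_on_arcsin')
  then show ?thesis by simp
qed

lemma e_has_vector_derivative:
  "((\<lambda>x. e (- \<omega> * x)) has_vector_derivative (- 2 * of_real pi * \<i> * of_real \<omega>) * e (- \<omega> * x)) (at x)"
proof -
  have "((\<lambda>z. exp (2 * complex_of_real pi * \<i> * (- of_real \<omega> * z))) has_field_derivative
      exp (2 * complex_of_real pi * \<i> * (- of_real \<omega> * of_real x)) * (2 * complex_of_real pi * \<i> * (- of_real \<omega>))) (at (of_real x))"
    by (auto intro!: derivative_eq_intros)
  from has_vector_derivative_real_field[OF this] show ?thesis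
    by (simp add: e_def mult_ac)
qed

text \<open>For \<open>\<bar>x\<bar> < 1\<close> and \<open>c > 0\<close> this is the logarithm of
  \<open>t = c / sqrt (1 - x^2)\<close>, written as a sum to show that \<open>c\<close>, and with it
  \<open>n\<close>, only translates.\<close>

definition log_shift :: "real \<Rightarrow> real \<Rightarrow> real" where
  "log_shift c x = ln c - ln (1 - x\<^sup>2) / 2"

text \<open>One integration by parts; the boundary terms vanish because \<open>theta_infty k\<close> is \<open>O(sqrt (1 - x\<^sup>2))\<close>.\<close>

lemma I_int_by_parts:
  fixes l f k :: nat and n \<xi> :: int and g' :: "real \<Rightarrow> complex"
  assumes pos: "l > 0" "f > 0" "n > 0"
    and g': "\<And>v. (FH_log has_vector_derivative g' v) (at v)"
    and K: "\<And>v. norm (FH_log v) \<le> K"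
  defines "\<omega> \<equiv> real_of_int \<xi> * sqrt (real_of_int n) / (2 * (real l * (real f)\<^sup>2))"
    and "c \<equiv> real l * (real f)\<^sup>2 / (2 * sqrt (real_of_int n))"
  shows "((\<lambda>x. (theta_infty' k x * FH_log (log_shift c x)
                + (theta_infty k x * (x / (1 - x\<^sup>2))) * g' (log_shift c x)) * e (- \<omega> * x))
          has_integral (2 * of_real pi * \<i> * of_real \<omega>) * I_int k l f \<xi> n) {-1..1}"
proof -
  define U where "U x = theta_infty k x * FH_log (log_shift c x) * e (- \<omega> * x)" for x
  define D where "D x = (theta_infty' k x * FH_log (log_shift c x)
                + (theta_infty k x * (x / (1 - x\<^sup>2))) * g' (log_shift c x)) * e (- \<omega> * x)" for x
  have c: "c > 0" using pos by (simp add: c_def)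
  have deriv: "(U has_vector_derivative D x + (- 2 * of_real pi * \<i> * of_real \<omega>) * U x) (at x)"
    if x: "x \<in> {-1<..<1}" for x
  proof -
    have x': "\<bar>x\<bar> < 1" "1 - x\<^sup>2 > 0" using x by (auto simp: abs_square_less_1)
    have 1: "((\<lambda>x. complex_of_real (theta_infty k x)) has_vector_derivative complex_of_real (theta_infty' k x)) (at x)"
      by (rule has_vector_derivative_complex_of_real[OF theta_infty_has_real_derivative[OF x'(1)]])
    have "(log_shift c has_real_derivative x / (1 - x\<^sup>2)) (at x)"
      unfolding log_shift_def [abs_def] using x' by (auto intro!: derivative_eq_intros simp: field_simps)
    then have 2: "((\<lambda>x. FH_log (log_shift c x)) has_vector_derivative (x / (1 - x\<^sup>2)) *\<^sub>R g' (log_shift c x)) (at x)"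
      using vector_diff_chain_at[of "log_shift c" "x / (1 - x\<^sup>2)" x FH_log, OF _ g']
      by (simp add: o_def has_real_derivative_iff_has_vector_derivative)
    show ?thesis unfolding U_def [abs_def] D_def
      by (rule has_vector_derivative_eq_rhs[OF has_vector_derivative_mult[OF has_vector_derivative_mult[OF 1 2] e_has_vector_derivative]])
         (simp add: algebra_simps scaleR_conv_of_real)
  qed
  have endp: "theta_infty k x = 0" if "\<bar>x\<bar> \<ge> 1" for x using that by (simp add: theta_infty_def)
  \<comment> \<open>At the endpoints the singularity of \<open>t\<close> sits in the argument of
    \<open>FH_log\<close>. Since \<open>FH_log\<close> is bounded by \<open>K\<close> and
    \<open>theta_infty\<close> tends to 0, \<open>U\<close> tends to its value 0 there.\<close>
  have cont: "continuous_on {-1..1} U"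
    unfolding continuous_on_def
  proof
    fix x :: real assume x: "x \<in> {-1..1}"
    show "(U \<longlongrightarrow> U x) (at x within {-1..1})"
    proof (cases "\<bar>x\<bar> < 1")
      case True
      then have "isCont U x" by (intro has_vector_derivative_continuous[OF deriv]) auto
      then show ?thesis by (simp add: isCont_def Lim_at_imp_Lim_at_within)
    next
      case False
      then have U0: "U x = 0" using endp[of x] by (simp add: U_def)
      have "((\<lambda>y. K * (real (k - 1) * sqrt (1 - y\<^sup>2))) \<longlongrightarrow> K * (real (k - 1) * sqrt (1 - x\<^sup>2))) (at x within {-1..1})"
        by (intro tendsto_intros)
      moreover have "x\<^sup>2 = 1" using False x by (auto simp: abs_if split: if_splits)
      ultimately have lim: "((\<lambda>y. K * (real (k - 1) * sqrt (1 - y\<^sup>2))) \<longlongrightarrow> 0) (at x within {-1..1})" by simp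
      have "\<forall>\<^sub>F y in at x within {-1..1}. norm (U y) \<le> K * (real (k - 1) * sqrt (1 - y\<^sup>2))"
        unfolding eventually_at_topological
      proof (intro exI[of _ UNIV] conjI ballI impI)
        fix y :: real assume "y \<in> {-1..1}"
        then have "\<bar>theta_infty k y\<bar> \<le> real (k - 1) * sqrt (1 - y\<^sup>2)" by (intro abs_theta_infty_le) auto
        then have "norm (FH_log (log_shift c y)) * \<bar>theta_infty k y\<bar> \<le> K * (real (k - 1) * sqrt (1 - y\<^sup>2))"
          using K[of "log_shift c y"] order_trans[OF norm_ge_zero K] by (intro mult_mono) auto
        then show "norm (U y) \<le> K * (real (k - 1) * sqrt (1 - y\<^sup>2))" by (simp add: U_def norm_mult mult_ac)
      qed auto
      then have "(U \<longlongrightarrow> 0) (at x within {-1..1})" using lim by (rule Lim_null_comparison)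
      then show ?thesis using U0 by simp
    qed
  qed
  have I: "I_int k l f \<xi> n = integral {-1..1} U"
  proof -
    have "I_int k l f \<xi> n = (LINT x:{-1..1}|lborel. U x)"
      unfolding I_int_def
    proof (rule set_lebesgue_integral_cong)
      show "\<forall>x. x \<in> {-1..1} \<longrightarrow>
        (let t = real l * (real f)\<^sup>2 * (4 * real_of_int n) powr (- 1 / 2) / sqrt (1 - x\<^sup>2)
         in complex_of_real (theta_infty k x)
            * (complex_of_real (F t) + complex_of_real t * H t)
            * e (- x * real_of_int \<xi> * sqrt (real_of_int n) / (2 * real l * (real f)\<^sup>2))) = U x"
      proof (intro allI impI)
        fix x :: real assume "x \<in> {-1..1}"
        show "(let t = real l * (real f)\<^sup>2 * (4 * real_of_int n) powr (- 1 / 2) / sqrt (1 - x\<^sup>2)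
           in complex_of_real (theta_infty k x)
              * (complex_of_real (F t) + complex_of_real t * H t)
              * e (- x * real_of_int \<xi> * sqrt (real_of_int n) / (2 * real l * (real f)\<^sup>2))) = U x"
        proof (cases "\<bar>x\<bar> < 1")
          case True
          then have x': "1 - x\<^sup>2 > 0" by (simp add: abs_square_less_1)
          have "(4 * real_of_int n) powr (- 1 / 2) = 1 / sqrt (4 * real_of_int n)"
            using pos by (simp add: powr_minus_divide powr_half_sqrt)
          then have "(4 * real_of_int n) powr (- 1 / 2) = 1 / (2 * sqrt (real_of_int n))"
            by (simp add: real_sqrt_mult)
          then have t: "real l * (real f)\<^sup>2 * (4 * real_of_int n) powr (- 1 / 2) / sqrt (1 - x\<^sup>2) = c / sqrt (1 - x\<^sup>2)"
            by (simp add: c_def)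
          have "c / sqrt (1 - x\<^sup>2) = exp (log_shift c x)"
            using c x' by (simp add: log_shift_def exp_diff ln_sqrt[symmetric])
          moreover have "- x * real_of_int \<xi> * sqrt (real_of_int n) / (2 * real l * (real f)\<^sup>2) = - \<omega> * x"
            by (simp add: \<omega>_def mult_ac)
          ultimately show ?thesis unfolding Let_def t U_def FH_log_def by simp
        next
          case False
          then show ?thesis using endp[of x] by (simp add: U_def Let_def)
        qed
      qed
    qed simp
    also have "\<dots> = integral {-1..1} U"
      by (rule set_borel_integral_eq_integral(2)[OF borel_integrable_atLeastAtMost'[OF cont]])
    finally show ?thesis .
  qed
  have Ui: "(U has_integral I_int k l f \<xi> n) {-1..1}"
    unfolding I using cont by (intro integrable_integral integrable_continuous_interval)
  have "((\<lambda>x. D x + (- 2 * of_real pi * \<i> * of_real \<omega>) * U x) has_integral (U 1 - U (-1))) {-1..1}"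
    by (rule fundamental_theorem_of_calculus_interior) (use deriv cont in auto)
  from has_integral_add[OF this has_integral_mult_right[OF Ui, of "2 * of_real pi * \<i> * of_real \<omega>"]]
  have "(D has_integral (2 * of_real pi * \<i> * of_real \<omega>) * I_int k l f \<xi> n) {-1..1}"
    by (simp add: U_def endp)
  then show ?thesis unfolding D_def .
qed

section \<open>The weight function\<close>

context
  fixes G :: "real \<Rightarrow> complex"
  assumes G: "G \<in> Cc_infty {1/4..5/4}"
begin

lemma nth_deriv_0 [simp]: "nth_deriv 0 G = G"
  by (simp add: nth_deriv_def)

lemma nth_deriv_has_vector_derivative:
  "(nth_deriv j G has_vector_derivative nth_deriv (Suc j) G x) (at x)"
proof -
  have "nth_deriv j G differentiable (at x)" using G by (auto simp: Cc_infty_def)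
  then show ?thesis by (simp add: nth_deriv_def vector_derivative_works)
qed

lemma continuous_nth_deriv: "continuous_on A (nth_deriv j G)"
  by (meson nth_deriv_has_vector_derivative has_vector_derivative_continuous continuous_at_imp_continuous_on)

lemma nth_deriv_eq_0: "x \<notin> {1/4..5/4} \<Longrightarrow> nth_deriv j G x = 0"
proof (induction j arbitrary: x)
  case 0
  have "closure {x. G x \<noteq> 0} \<subseteq> {1/4..5/4}" using G by (auto simp: Cc_infty_def)
  then show ?case using 0 closure_subset[of "{x. G x \<noteq> 0}"] by auto
next
  case (Suc j)
  have "open (- {1/4..5/4::real})" by auto
  have "(nth_deriv j G has_vector_derivative 0) (at x)"
    by (rule has_vector_derivative_transform_within_open[of "\<lambda>_. 0" 0 _ "- {1/4..5/4}"])
       (use Suc \<open>open (- {1/4..5/4::real})\<close> in auto)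
  then show ?case using nth_deriv_has_vector_derivative[of j x] vector_derivative_unique_at by blast
qed

lemma integrable_nth_deriv: "integrable lborel (\<lambda>x. norm (nth_deriv j G x))"
proof -
  have "set_integrable lborel {1/4..5/4} (\<lambda>x. norm (nth_deriv j G x))"
    by (intro borel_integrable_atLeastAtMost' continuous_on_norm continuous_nth_deriv)
  moreover have "(\<lambda>x. indicator {1/4..5/4} x *\<^sub>R norm (nth_deriv j G x)) = (\<lambda>x. norm (nth_deriv j G x))"
    using nth_deriv_eq_0[of _ j] by (auto simp: indicator_def fun_eq_iff)
  ultimately show ?thesis by (simp only: set_integrable_def)
qed

text \<open>One majorant for all derivatives up to order \<open>M\<close>, so that the same function
  can serve as \<open>K\<close> at every order; its integral is exactly
  \<open>sobolev_norm M G\<close>.\<close>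

definition deriv_sum :: "nat \<Rightarrow> real \<Rightarrow> real" where
  "deriv_sum M z = (\<Sum>i=0..M. norm (nth_deriv i G z))"

lemma deriv_sum_nonneg: "deriv_sum M z \<ge> 0"
  by (simp add: deriv_sum_def sum_nonneg)

lemma deriv_sum_eq_0: "z \<notin> {1/4..5/4} \<Longrightarrow> deriv_sum M z = 0"
  by (simp add: deriv_sum_def nth_deriv_eq_0)

lemma continuous_deriv_sum: "continuous_on A (deriv_sum M)"
  unfolding deriv_sum_def [abs_def] by (intro continuous_intros continuous_nth_deriv)

lemma integrable_deriv_sum: "integrable lborel (deriv_sum M)"
  unfolding deriv_sum_def [abs_def] by (intro Bochner_Integration.integrable_sum integrable_nth_deriv)

lemma integral_deriv_sum: "(LINT z|lborel. deriv_sum M z) = sobolev_norm M G"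
  unfolding deriv_sum_def sobolev_norm_def
  by (intro Bochner_Integration.integral_sum integrable_nth_deriv)

lemma sobolev_norm_nonneg: "sobolev_norm M G \<ge> 0"
  unfolding sobolev_norm_def by (intro sum_nonneg) auto

lemma deriv_bounded_Cc_infty: "deriv_bounded UNIV M (deriv_sum M) 1 G"
proof -
  have "deriv_bounded UNIV m (deriv_sum M) 1 (nth_deriv j G)" if "j + m \<le> M" for j m
    using that
  proof (induction m arbitrary: j)
    have b: "norm (nth_deriv j G z) \<le> deriv_sum M z" if "j \<le> M" for j z
      unfolding deriv_sum_def by (rule member_le_sum) (use that in auto)
    {
      case 0
      then show ?case using b by auto
    next
      case (Suc m)
      have "deriv_bounded UNIV m (\<lambda>z. deriv_sum M z * 1) 1 (nth_deriv (Suc j) G)"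
        using Suc.IH[of "Suc j"] Suc.prems by simp
      then show ?case unfolding deriv_bounded.simps
        using b[of j] Suc.prems nth_deriv_has_vector_derivative by auto
    }
  qed
  from this[of 0 M] show ?thesis by simp
qed

text \<open>Up to a constant factor, the function \<open>D\<close> of
  \<open>periodic_sum_bound\<close>. The base point 0 lies to the left of the support, so the value
  0 for negative \<open>z\<close>, where the interval is empty, fits smoothly.\<close>

definition deriv_sum_primitive :: "nat \<Rightarrow> real \<Rightarrow> real" where
  "deriv_sum_primitive M z = integral {0..z} (deriv_sum M)"

lemma deriv_sum_primitive_has_real_derivative:
  "(deriv_sum_primitive M has_real_derivative deriv_sum M z) (at z)"
proof (cases "z > 0")
  case True
  have "((\<lambda>z. integral {0..z} (deriv_sum M)) has_real_derivative deriv_sum M z) (at z within {0..z+1})"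
    by (rule integral_has_real_derivative[OF continuous_deriv_sum]) (use True in auto)
  then show ?thesis using True
    unfolding deriv_sum_primitive_def [abs_def] by (simp add: at_within_Icc_at)
next
  case False
  have z: "deriv_sum_primitive M y = 0" if "y < 1/4" for y
    unfolding deriv_sum_primitive_def using that
    by (intro integral_unique has_integral_is_0) (auto intro!: deriv_sum_eq_0)
  have "(deriv_sum_primitive M has_real_derivative 0) (at z)"
    by (rule has_field_derivative_transform_within_open[of "\<lambda>_. 0" 0 _ "{..<1/4}"])
       (use False z in auto)
  then show ?thesis using False deriv_sum_eq_0[of z] by simp
qed

lemma deriv_sum_primitive_nonneg: "0 \<le> deriv_sum_primitive M z"
  unfolding deriv_sum_primitive_def
  by (rule Henstock_Kurzweil_Integration.integral_nonneg)
     (auto intro!: integrable_continuous_interval continuous_deriv_sum deriv_sum_nonneg)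

lemma deriv_sum_primitive_le: "deriv_sum_primitive M z \<le> sobolev_norm M G"
proof -
  have si: "set_integrable lborel {0..z} (deriv_sum M)"
    by (intro borel_integrable_atLeastAtMost' continuous_deriv_sum)
  have "deriv_sum_primitive M z = (LINT y:{0..z}|lborel. deriv_sum M y)"
    unfolding deriv_sum_primitive_def using set_borel_integral_eq_integral(2)[OF si] by simp
  also have "\<dots> \<le> (LINT y|lborel. deriv_sum M y)"
    unfolding set_lebesgue_integral_def
    by (rule integral_mono) (use si integrable_deriv_sum deriv_sum_nonneg in \<open>auto simp: set_integrable_def indicator_def\<close>)
  finally show ?thesis by (simp add: integral_deriv_sum)
qed

text \<open>\<open>G\<close> vanishes at 0, so its growth is controlled by the integral of its first
  derivative. This serves the bounded range of \<open>X\<close>, where no cancellation is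
  used.\<close>

lemma norm_le_sobolev_norm:
  assumes "M \<ge> 1"
  shows "norm (G x) \<le> sobolev_norm M G"
proof -
  have "norm (G x - G 0) \<le> deriv_sum_primitive M x - deriv_sum_primitive M 0" if x: "x > 0"
  proof (rule differentiable_bound_general[where f' = "nth_deriv 1 G" and \<phi>' = "deriv_sum M"])
    show "continuous_on {0..x} G" using continuous_nth_deriv[of _ 0] by simp
    show "continuous_on {0..x} (deriv_sum_primitive M)"
      by (intro continuous_at_imp_continuous_on ballI) (meson DERIV_isCont deriv_sum_primitive_has_real_derivative)
    show "(G has_vector_derivative nth_deriv 1 G y) (at y)" for y
      using nth_deriv_has_vector_derivative[of 0 y] by simp
    show "(deriv_sum_primitive M has_vector_derivative deriv_sum M y) (at y)" for y
      using deriv_sum_primitive_has_real_derivative by (simp add: has_real_derivative_iff_has_vector_derivative)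
    show "norm (nth_deriv 1 G y) \<le> deriv_sum M y" for y
      unfolding deriv_sum_def by (rule member_le_sum) (use assms in auto)
  qed (use x in auto)
  moreover have "G 0 = 0" using nth_deriv_eq_0[of 0 0] by simp
  moreover have "G x = 0" if "x \<le> 0" using nth_deriv_eq_0[of x 0] that by simp
  ultimately show ?thesis
    using deriv_sum_primitive_le[of M x] deriv_sum_primitive_nonneg[of M 0] sobolev_norm_nonneg[of M]
    by (cases "x > 0") auto
qed

end

section \<open>The weight as a function of \<open>n / X\<close>\<close>

lemma deriv_bounded_e: "deriv_bounded UNIV m (\<lambda>_. 1) (2 * pi * \<bar>\<gamma>\<bar>) (\<lambda>s. e (- \<gamma> * s))"
proof -
  define d where "d = - 2 * of_real pi * \<i> * of_real \<gamma>"
  have nd: "norm d = 2 * pi * \<bar>\<gamma>\<bar>" by (simp add: d_def norm_mult)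
  have "deriv_bounded UNIV m (\<lambda>_. norm b) (norm d) (\<lambda>s. b * e (- \<gamma> * s))" for b
  proof (induction m arbitrary: b)
    case (Suc m)
    have "((\<lambda>s. b * e (- \<gamma> * s)) has_vector_derivative (b * d) * e (- \<gamma> * s)) (at s)" for s
      using has_vector_derivative_mult_right[OF e_has_vector_derivative[of \<gamma> s], of b]
      by (simp add: d_def mult_ac)
    moreover have "deriv_bounded UNIV m (\<lambda>_. norm b * norm d) (norm d) (\<lambda>s. (b * d) * e (- \<gamma> * s))"
      using Suc[of "b * d"] by (simp only: norm_mult)
    moreover have "norm (b * e (- \<gamma> * s)) \<le> norm b" for s by (simp add: norm_mult)
    ultimately show ?case unfolding deriv_bounded.simps
      by (intro conjI ballI exI[of _ "\<lambda>s. (b * d) * e (- \<gamma> * s)"])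
  qed (auto simp: norm_mult)
  from this[of 1] show ?thesis by (simp add: nd)
qed

text \<open>The point \<open>x\<close> will enter only through \<open>\<beta>\<close> and
  \<open>\<gamma>\<close>. Translation by \<open>\<beta>\<close> does not affect a bound that holds
  on the whole line, so \<open>C\<close> is uniform in it, while a derivative falling on the phase
  costs a factor of size \<open>\<bar>\<gamma>\<bar>\<close>.\<close>

lemma deriv_bounded_weight:
  assumes g: "deriv_bounded UNIV M (\<lambda>_. K) 1 g" and K: "K \<ge> 0"
  shows "\<exists>C>0. \<forall>G\<in>Cc_infty {1/4..5/4}. \<forall>\<beta> \<gamma>.
    deriv_bounded UNIV M (\<lambda>z. K * deriv_sum G M z) (C * (1 + \<bar>\<gamma>\<bar>))
      (\<lambda>z. G z * (g (\<beta> - ln z / 2) * e (- \<gamma> * sqrt z)))"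
proof -
  \<comment> \<open>An open neighbourhood of the support \<open>{1/4..5/4}\<close> that stays away
    from 0, where \<open>ln\<close> and \<open>sqrt\<close> are smooth.\<close>
  define A where "A = {1/8<..<2::real}"
  have A: "A \<subseteq> {1/8..2}" "open A" "(0::real) < 1/8" by (auto simp: A_def)
  obtain K1 where K1: "K1 \<ge> 0" "deriv_bounded A M (\<lambda>_. K1) 1 (\<lambda>z. complex_of_real (- 1 / 2 * z powr (- 1)))"
    using deriv_bounded_powr[OF A(1,3)] by blast
  obtain K2 where K2: "K2 \<ge> 0" "deriv_bounded A M (\<lambda>_. K2) 1 (\<lambda>z. complex_of_real (1 / 2 * z powr (- 1 / 2)))"
    using deriv_bounded_powr[OF A(1,3)] by blast
  \<comment> \<open>The rates of the three factors add up: 1 from \<open>G\<close>,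
    \<open>K1 + M\<close> from \<open>g\<close> composed with the logarithm, and
    \<open>2 * pi * \<bar>\<gamma>\<bar> * K2 + M\<close> from the phase.\<close>
  define C where "C = 1 + K1 + 2 * real M + 2 * pi * K2"
  have C: "C > 0" using K1 K2 by (simp add: C_def add_pos_nonneg)
  have "deriv_bounded UNIV M (\<lambda>z. K * deriv_sum G M z) (C * (1 + \<bar>\<gamma>\<bar>))
      (\<lambda>z. G z * (g (\<beta> - ln z / 2) * e (- \<gamma> * sqrt z)))" if G: "G \<in> Cc_infty {1/4..5/4}" for G \<beta> \<gamma>
  proof -
    have 1: "deriv_bounded A M (\<lambda>_. K) (1 * K1 + real M * 1) (\<lambda>z. g (\<beta> - ln z / 2))"
    proof (rule deriv_bounded_compose[OF g K1(2)])
      fix z assume "z \<in> A"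
      then have "z > 0" by (simp add: A_def)
      then show "((\<lambda>z. \<beta> - ln z / 2) has_real_derivative - 1 / 2 * z powr - 1) (at z)"
        by (auto intro!: derivative_eq_intros simp: powr_minus_divide)
    qed (use K K1 in auto)
    have 2: "deriv_bounded A M (\<lambda>_. 1) (2 * pi * \<bar>\<gamma>\<bar> * K2 + real M * 1) (\<lambda>z. e (- \<gamma> * sqrt z))"
    proof (rule deriv_bounded_compose[OF deriv_bounded_e K2(2)])
      fix z assume "z \<in> A"
      then have "z > 0" by (simp add: A_def)
      then show "(sqrt has_real_derivative 1 / 2 * z powr (- 1 / 2)) (at z)"
        by (auto intro!: derivative_eq_intros simp: powr_minus_divide powr_half_sqrt field_simps)
    qed (use K2 in auto)
    have 0: "deriv_bounded A M (deriv_sum G M) 1 G"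
      by (rule deriv_bounded_subset[OF deriv_bounded_Cc_infty[OF G]]) simp
    have "deriv_bounded A M (\<lambda>z. deriv_sum G M z * (K * 1)) (1 + (1 * K1 + real M * 1 + (2 * pi * \<bar>\<gamma>\<bar> * K2 + real M * 1)))
        (\<lambda>z. G z * (g (\<beta> - ln z / 2) * e (- \<gamma> * sqrt z)))"
      by (intro deriv_bounded_mult 0 1 2)
    then have "deriv_bounded A M (\<lambda>z. K * deriv_sum G M z) (C * (1 + \<bar>\<gamma>\<bar>))
        (\<lambda>z. G z * (g (\<beta> - ln z / 2) * e (- \<gamma> * sqrt z)))"
    proof (rule deriv_bounded_mono)
      have "1 + (1 * K1 + real M * 1 + (2 * pi * \<bar>\<gamma>\<bar> * K2 + real M * 1)) = (1 + K1 + 2 * real M) * 1 + (2 * pi * K2) * \<bar>\<gamma>\<bar>"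
        by (simp add: algebra_simps)
      also have "\<dots> \<le> (1 + K1 + 2 * real M) * (1 + \<bar>\<gamma>\<bar>) + (2 * pi * K2) * (1 + \<bar>\<gamma>\<bar>)"
        using K1 K2 by (intro add_mono mult_left_mono) auto
      also have "\<dots> = C * (1 + \<bar>\<gamma>\<bar>)" by (simp add: C_def algebra_simps)
      finally show "1 + (1 * K1 + real M * 1 + (2 * pi * \<bar>\<gamma>\<bar> * K2 + real M * 1)) \<le> C * (1 + \<bar>\<gamma>\<bar>)" .
    qed (use K K1 K2 deriv_sum_nonneg[OF G] in auto)
    then show ?thesis
    proof (rule deriv_bounded_extend[where T = "{1/4..5/4}"])
      show "G z * (g (\<beta> - ln z / 2) * e (- \<gamma> * sqrt z)) = 0" if "z \<notin> {1/4..5/4}" for z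
        using nth_deriv_eq_0[OF G that, of 0] nth_deriv_0[OF G] by simp
    qed (use A C K deriv_sum_nonneg[OF G] in \<open>auto simp: A_def\<close>)
  qed
  then show ?thesis using C by blast
qed

section \<open>The sum over the integers n\<close>

lemma sum_nonzero_weight_eq:
  assumes G: "G \<in> Cc_infty {1/4..5/4}" and X: "X > 0"
    and h: "\<And>n. G (real_of_int n / X) = 0 \<Longrightarrow> h n = (0::complex)"
    and N: "real N \<ge> 2 * X"
  shows "(\<Sum>n::int | G (real_of_int n / X) \<noteq> 0. h n) = (\<Sum>n<N. h (int n))"
proof -
  have z: "G x = 0" if "x \<notin> {1/4..5/4}" for x
    using nth_deriv_eq_0[OF G that, of 0] nth_deriv_0[OF G] by simp
  have sub: "{n::int. G (real_of_int n / X) \<noteq> 0} \<subseteq> int ` {..<N}"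
  proof
    fix n :: int assume "n \<in> {n. G (real_of_int n / X) \<noteq> 0}"
    then have "real_of_int n / X \<in> {1/4..5/4}" using z by blast
    then have n: "0 < real_of_int n" "real_of_int n < 2 * X" using X by (auto simp: field_simps)
    have "0 < n" "real_of_int n < real N" using n N by linarith+
    then have "0 < n" "n < int N" by linarith+
    then show "n \<in> int ` {..<N}" by (intro image_eqI[of _ _ "nat n"]) auto
  qed
  have "(\<Sum>n::int | G (real_of_int n / X) \<noteq> 0. h n) = (\<Sum>n\<in>int ` {..<N}. h n)"
    by (rule sum.mono_neutral_left) (use sub h in auto)
  also have "\<dots> = (\<Sum>n<N. h (int n))" by (simp add: sum.reindex)
  finally show ?thesis .
qed

text \<open>\<open>\<gamma>0\<close> bounds the frequency for all \<open>x\<close> between -1 and 1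
  at once. The condition \<open>4 * M \<le> X\<close> puts the first \<open>M\<close> integers to
  the left of the support of \<open>G\<close>, as \<open>periodic_sum_bound\<close> requires; the
  Kloosterman sum is the periodic sequence, bounded by \<open>4 q\<close>.\<close>

lemma twisted_sum_bound:
  assumes M: "M > 0"
    and g: "deriv_bounded UNIV M (\<lambda>_. K) 1 g" and K: "K \<ge> 0"
  shows "\<exists>C>0. \<forall>G\<in>Cc_infty {1/4..5/4}. \<forall>X l f \<xi> N \<beta> \<gamma> \<gamma>0.
    X > 0 \<longrightarrow> X \<ge> 4 * real M \<longrightarrow> l > 0 \<longrightarrow> f > 0 \<longrightarrow> \<xi> \<noteq> 0 \<longrightarrow> \<bar>\<xi>\<bar> < int l * (int f)\<^sup>2 \<longrightarrow>
    real N \<ge> 2 * X \<longrightarrow> \<bar>\<gamma>\<bar> \<le> \<gamma>0 \<longrightarrow>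
    norm (\<Sum>n<N. Kl l f \<xi> (int n) *
        (G (n / X) * (g (\<beta> - ln (n / X) / 2) * e (- \<gamma> * sqrt (n / X)))))
      \<le> 4 * (real l * (real f)\<^sup>2) * X * (2 * (real l * (real f)\<^sup>2) * (C * (1 + \<gamma>0)) / X) ^ M * M
          * (K * sobolev_norm M G)"
proof -
  obtain C where C: "C > 0" "\<And>G \<beta> \<gamma>. G\<in>Cc_infty {1/4..5/4} \<Longrightarrow>
    deriv_bounded UNIV M (\<lambda>z. K * deriv_sum G M z) (C * (1 + \<bar>\<gamma>\<bar>))
      (\<lambda>z. G z * (g (\<beta> - ln z / 2) * e (- \<gamma> * sqrt z)))"
    using deriv_bounded_weight[OF g K] by blast
  show ?thesis
  proof (rule exI[of _ C], intro conjI ballI allI impI)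
    fix G and X \<beta> \<gamma> \<gamma>0 :: real and l f N :: nat and \<xi> :: int
    assume G: "G \<in> Cc_infty {1/4..5/4}" and X: "X > 0" "X \<ge> 4 * real M" and lf: "l > 0" "f > 0"
      and \<xi>: "\<xi> \<noteq> 0" "\<bar>\<xi>\<bar> < int l * (int f)\<^sup>2" and N: "real N \<ge> 2 * X" and \<gamma>: "\<bar>\<gamma>\<bar> \<le> \<gamma>0"
    define q where "q = l * f\<^sup>2"
    have qr: "real q = real l * (real f)\<^sup>2" and qi: "int q = int l * (int f)\<^sup>2" by (auto simp: q_def)
    define w where "w z = G z * (g (\<beta> - ln z / 2) * e (- \<gamma> * sqrt z))" for z
    have Gz: "G x = 0" if "x \<notin> {1/4..5/4}" for x
      using nth_deriv_eq_0[OF G that, of 0] nth_deriv_0[OF G] by simp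
    have w: "deriv_bounded UNIV M (\<lambda>z. K * deriv_sum G M z) (C * (1 + \<gamma>0)) w"
      unfolding w_def
      by (rule deriv_bounded_mono[OF C(2)[OF G]]) (use C(1) \<gamma> K deriv_sum_nonneg[OF G] in auto)
    have "norm (\<Sum>n<N. Kl l f \<xi> (int n) * w (n / X)) \<le>
        (4 * real q) * X * (2 * real q * (C * (1 + \<gamma>0)) / X) ^ M * M * (K * sobolev_norm M G)"
    proof (rule periodic_sum_bound[where a = "\<lambda>n. Kl l f \<xi> (int n)" and q = q and K = "\<lambda>z. K * deriv_sum G M z"
          and D = "\<lambda>z. K * deriv_sum_primitive G M z"])
      show "q > 0" using lf by (simp add: q_def)
      show "Kl l f \<xi> (int (n + q)) = Kl l f \<xi> (int n)" for n
        using Kl_periodic[OF lf(2), of l \<xi> "int n"] by (simp add: qi)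
      show "(\<Sum>i<q. Kl l f \<xi> (int i)) = 0"
      proof -
        have "(\<Sum>i<q. Kl l f \<xi> (int i)) = (\<Sum>n\<in>int ` {..<q}. Kl l f \<xi> n)" by (simp add: sum.reindex)
        also have "int ` {..<q} = {0..<int l * (int f)\<^sup>2}"
          unfolding qi[symmetric] by (auto simp: image_iff) (metis nat_int zless_nat_conj int_nat_eq lessThan_iff zero_le_imp_eq_int of_nat_less_iff)
        finally show ?thesis using Kl_sum_period_eq_0[OF lf \<xi>] by simp
      qed
      show "norm (Kl l f \<xi> (int n)) \<le> 4 * real q" for n using norm_Kl_le[of l f \<xi> "int n"] by (simp add: qr)
      show "((\<lambda>z. K * deriv_sum_primitive G M z) has_real_derivative K * deriv_sum G M z) (at z)" for z
        by (rule DERIV_cmult[OF deriv_sum_primitive_has_real_derivative[OF G]])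
      show "w (real n / X) = 0" if "n < M" for n
      proof -
        have "real n < real M" using that by simp
        then have "real n / X < 1 / 4" using X by (simp add: field_simps)
        then show ?thesis using Gz[of "real n / X"] by (simp add: w_def)
      qed
      show "w (real n / X) = 0" if "n \<ge> N" for n
      proof -
        have "real n \<ge> real N" using that by simp
        then have "real n / X \<ge> 2" using X N by (simp add: field_simps)
        then have "real n / X \<notin> {1/4..5/4}" unfolding atLeastAtMost_iff by linarith
        then show ?thesis using Gz[of "real n / X"] by (simp add: w_def)
      qed
    qed (use M X w C(1) \<gamma> K deriv_sum_nonneg[OF G] deriv_sum_primitive_nonneg[OF G] deriv_sum_primitive_le[OF G] in
        \<open>auto intro!: mult_left_mono mult_nonneg_nonneg\<close>)
    then show "norm (\<Sum>n<N. Kl l f \<xi> (int n) *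
        (G (n / X) * (g (\<beta> - ln (n / X) / 2) * e (- \<gamma> * sqrt (n / X)))))
      \<le> 4 * (real l * (real f)\<^sup>2) * X * (2 * (real l * (real f)\<^sup>2) * (C * (1 + \<gamma>0)) / X) ^ M * M
          * (K * sobolev_norm M G)" unfolding w_def qr .
  qed (use C in auto)
qed

text \<open>Integration by parts in \<open>x\<close> yields two pieces, with \<open>FH_log\<close>
  and with its derivative \<open>g'\<close>, which is why \<open>Suc M\<close> derivatives are
  requested. The finite sum over \<open>n\<close> moves under the integral, and
  \<open>twisted_sum_bound\<close> applies for each fixed \<open>x\<close>. What is left in
  \<open>x\<close> is dominated by a multiple of \<open>1 / sqrt (1 - x^2)\<close>, whose integral
  is \<open>pi\<close>.\<close>

lemma n_sum_bound:
  assumes M: "M > 0"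
  shows "\<exists>C\<ge>0. \<forall>G\<in>Cc_infty {1/4..5/4}. \<forall>X l f \<xi>.
    X > 0 \<longrightarrow> X \<ge> 4 * real M \<longrightarrow> l > 0 \<longrightarrow> f > 0 \<longrightarrow> \<xi> \<noteq> 0 \<longrightarrow> \<bar>\<xi>\<bar> < int l * (int f)\<^sup>2 \<longrightarrow>
    norm (\<Sum>n::int | G (real_of_int n / X) \<noteq> 0.
        G (real_of_int n / X) * complex_of_real (sqrt (real_of_int n)) * (Kl l f \<xi> n * I_int k l f \<xi> n))
      \<le> C * sobolev_norm M G * X * ((real l * (real f)\<^sup>2)\<^sup>2 / \<bar>real_of_int \<xi>\<bar>)
          * (real l * (real f)\<^sup>2 / X + \<bar>real_of_int \<xi>\<bar> / sqrt X) ^ M"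
proof -
  obtain K where K: "K \<ge> 0" "deriv_bounded UNIV (Suc M) (\<lambda>_. K) 1 FH_log"
    using deriv_bounded_FH by blast
  obtain g' where g': "\<And>v. (FH_log has_vector_derivative g' v) (at v)" "deriv_bounded UNIV M (\<lambda>_. K * 1) 1 g'"
    using K(2) by (rule deriv_bounded_SucE) auto
  have b1: "deriv_bounded UNIV M (\<lambda>_. K) 1 FH_log" using K(2) by (rule deriv_bounded_Suc_D)
  have b2: "deriv_bounded UNIV M (\<lambda>_. K) 1 g'" using g'(2) by simp
  note tw1 = twisted_sum_bound[OF M b1 K(1)]
  note tw2 = twisted_sum_bound[OF M b2 K(1)]
  obtain C1 where C1: "C1 > 0" "\<And>G X l f \<xi> N \<beta> \<gamma> \<gamma>0. G\<in>Cc_infty {1/4..5/4} \<Longrightarrow>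
    X > 0 \<Longrightarrow> X \<ge> 4 * real M \<Longrightarrow> l > 0 \<Longrightarrow> f > 0 \<Longrightarrow> \<xi> \<noteq> 0 \<Longrightarrow> \<bar>\<xi>\<bar> < int l * (int f)\<^sup>2 \<Longrightarrow>
    real N \<ge> 2 * X \<Longrightarrow> \<bar>\<gamma>\<bar> \<le> \<gamma>0 \<Longrightarrow>
    norm (\<Sum>n<N. Kl l f \<xi> (int n) *
        (G (n / X) * (FH_log (\<beta> - ln (n / X) / 2) * e (- \<gamma> * sqrt (n / X)))))
      \<le> 4 * (real l * (real f)\<^sup>2) * X * (2 * (real l * (real f)\<^sup>2) * (C1 * (1 + \<gamma>0)) / X) ^ M * M
          * (K * sobolev_norm M G)" using tw1 by auto
  obtain C2 where C2: "C2 > 0" "\<And>G X l f \<xi> N \<beta> \<gamma> \<gamma>0. G\<in>Cc_infty {1/4..5/4} \<Longrightarrow>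
    X > 0 \<Longrightarrow> X \<ge> 4 * real M \<Longrightarrow> l > 0 \<Longrightarrow> f > 0 \<Longrightarrow> \<xi> \<noteq> 0 \<Longrightarrow> \<bar>\<xi>\<bar> < int l * (int f)\<^sup>2 \<Longrightarrow>
    real N \<ge> 2 * X \<Longrightarrow> \<bar>\<gamma>\<bar> \<le> \<gamma>0 \<Longrightarrow>
    norm (\<Sum>n<N. Kl l f \<xi> (int n) *
        (G (n / X) * (g' (\<beta> - ln (n / X) / 2) * e (- \<gamma> * sqrt (n / X)))))
      \<le> 4 * (real l * (real f)\<^sup>2) * X * (2 * (real l * (real f)\<^sup>2) * (C2 * (1 + \<gamma>0)) / X) ^ M * M
          * (K * sobolev_norm M G)" using tw2 by auto
  define CC where "CC = C1 + C2"
  define m where "m = real (k - 1)"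
  define C where "C = 8 * m * M * K * (2 * CC) ^ M"
  have "C \<ge> 0" using C1(1) C2(1) K(1) by (simp add: C_def m_def CC_def)
  moreover have "norm (\<Sum>n::int | G (real_of_int n / X) \<noteq> 0.
        G (real_of_int n / X) * complex_of_real (sqrt (real_of_int n)) * (Kl l f \<xi> n * I_int k l f \<xi> n))
      \<le> C * sobolev_norm M G * X * ((real l * (real f)\<^sup>2)\<^sup>2 / \<bar>real_of_int \<xi>\<bar>)
          * (real l * (real f)\<^sup>2 / X + \<bar>real_of_int \<xi>\<bar> / sqrt X) ^ M"
    if G: "G \<in> Cc_infty {1/4..5/4}" and X: "X > 0" "X \<ge> 4 * real M" and lf: "l > 0" "f > 0"
      and \<xi>: "\<xi> \<noteq> 0" "\<bar>\<xi>\<bar> < int l * (int f)\<^sup>2" for G X \<xi> and l f :: nat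
  proof -
    define N where "N = nat \<lceil>2 * X\<rceil>"
    have N: "real N \<ge> 2 * X" unfolding N_def by linarith
    define q where "q = real l * (real f)\<^sup>2"
    have q: "q > 0" using lf by (simp add: q_def)
    define z where "z = \<bar>real_of_int \<xi>\<bar>"
    have z: "z > 0" using \<xi> by (simp add: z_def)
    have S0: "sobolev_norm M G \<ge> 0" by (rule sobolev_norm_nonneg[OF G])
    define \<gamma>0 where "\<gamma>0 = z * sqrt X / (2 * q)"
    have \<gamma>0: "\<gamma>0 \<ge> 0" using z q X by (simp add: \<gamma>0_def)
    define Bd where "Bd = 4 * q * X * (2 * q * (CC * (1 + \<gamma>0)) / X) ^ M * M * (K * sobolev_norm M G)"
    \<comment> \<open>\<open>\<beta> x\<close> is what remains of \<open>ln t\<close> after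
      \<open>- ln (n / X) / 2\<close> is split off; likewise \<open>\<gamma> x\<close> is the
      frequency of the phase relative to \<open>sqrt (n / X)\<close>.\<close>
    define \<beta> where "\<beta> x = ln (q / 2) - ln X / 2 - ln (1 - x\<^sup>2) / 2" for x
    define \<gamma> where "\<gamma> x = x * real_of_int \<xi> * sqrt X / (2 * q)" for x
    have \<gamma>: "\<bar>\<gamma> x\<bar> \<le> \<gamma>0" if "\<bar>x\<bar> \<le> 1" for x
    proof -
      have "\<bar>\<gamma> x\<bar> = \<bar>x\<bar> * \<gamma>0" using q X by (simp add: \<gamma>_def \<gamma>0_def z_def abs_mult)
      also have "\<dots> \<le> 1 * \<gamma>0" using that \<gamma>0 by (intro mult_right_mono) auto
      finally show ?thesis by simp
    qed
    define W1 where "W1 x = (\<Sum>n<N. Kl l f \<xi> (int n) *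
        (G (n / X) * (FH_log (\<beta> x - ln (n / X) / 2) * e (- \<gamma> x * sqrt (n / X)))))" for x
    define W2 where "W2 x = (\<Sum>n<N. Kl l f \<xi> (int n) *
        (G (n / X) * (g' (\<beta> x - ln (n / X) / 2) * e (- \<gamma> x * sqrt (n / X)))))" for x
    have mon: "4 * q * X * (2 * q * (Ci * (1 + \<gamma>0)) / X) ^ M * M * (K * sobolev_norm M G) \<le> Bd"
      if "0 < Ci" "Ci \<le> CC" for Ci
      unfolding Bd_def using that q X K(1) \<gamma>0 S0
      by (intro mult_right_mono mult_left_mono power_mono divide_right_mono) auto
    have W1: "norm (W1 x) \<le> Bd" if "\<bar>x\<bar> \<le> 1" for x
      unfolding W1_def
      by (rule order_trans[OF C1(2)[OF G X lf \<xi> N \<gamma>[OF that]] mon[of C1, unfolded q_def]]) (use C1 C2 in \<open>auto simp: CC_def\<close>)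
    have W2: "norm (W2 x) \<le> Bd" if "\<bar>x\<bar> \<le> 1" for x
      unfolding W2_def
      by (rule order_trans[OF C2(2)[OF G X lf \<xi> N \<gamma>[OF that]] mon[of C2, unfolded q_def]]) (use C1 C2 in \<open>auto simp: CC_def\<close>)
    have Bd: "Bd \<ge> 0" using W1[of 0] norm_ge_zero[of "W1 0"] by linarith
    define T where "T x = theta_infty' k x * W1 x + (theta_infty k x * (x / (1 - x\<^sup>2))) * W2 x" for x
    define h where "h n = G (real_of_int n / X) * complex_of_real (sqrt (real_of_int n)) * (Kl l f \<xi> n * I_int k l f \<xi> n)" for n
    have Tint: "(T has_integral (\<Sum>n<N. (of_real pi * \<i> * of_int \<xi> / of_real q) * h (int n))) {-1..1}"
    proof -
      define Tn where "Tn n x = (Kl l f \<xi> (int n) * G (n / X)) * ((theta_infty' k x * FH_log (\<beta> x - ln (n / X) / 2)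
          + (theta_infty k x * (x / (1 - x\<^sup>2))) * g' (\<beta> x - ln (n / X) / 2)) * e (- \<gamma> x * sqrt (n / X)))" for n :: nat and x
      have "(Tn n has_integral (of_real pi * \<i> * of_int \<xi> / of_real q) * h (int n)) {-1..1}" for n :: nat
      proof (cases "n = 0")
        case True
        have "G 0 = 0" using nth_deriv_eq_0[OF G, of 0 0] nth_deriv_0[OF G] by simp
        then show ?thesis using True by (simp add: Tn_def [abs_def] h_def)
      next
        case False
        then have n: "n > 0" by simp
        have ls: "log_shift (real l * (real f)\<^sup>2 / (2 * sqrt (real_of_int (int n)))) x = \<beta> x - ln (n / X) / 2" for x
          using n X q unfolding log_shift_def \<beta>_def q_def[symmetric]
          by (simp add: ln_div ln_mult ln_sqrt field_simps)
        have om: "- (real_of_int \<xi> * sqrt (real_of_int (int n)) / (2 * (real l * (real f)\<^sup>2))) * x = - \<gamma> x * sqrt (n / X)" for x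
          using X q unfolding \<gamma>_def q_def[symmetric] by (simp add: real_sqrt_divide)
        have K': "norm (FH_log v) \<le> K" for v using deriv_bounded_norm[OF b1] by auto
        have "int n > 0" using n by simp
        note ibp = I_int_by_parts[OF lf this g'(1) K', of k \<xi>, unfolded ls om]
        \<comment> \<open>The factor \<open>2 pi i \<omega>\<close> from the integration by parts is
          \<open>pi i \<xi> sqrt n / q\<close>. Its \<open>sqrt n\<close> is the one in
          \<open>h\<close>, so the coefficient in front of \<open>h\<close> is the same for all
          \<open>n\<close>.\<close>
        have eq: "(Kl l f \<xi> (int n) * G (n / X)) * (2 * of_real pi * \<i> * of_real (real_of_int \<xi> * sqrt (real_of_int (int n)) / (2 * (real l * (real f)\<^sup>2))) * I_int k l f \<xi> (int n))
            = (of_real pi * \<i> * of_int \<xi> / of_real q) * h (int n)"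
          using q unfolding h_def q_def[symmetric] by (simp add: field_simps)
        show ?thesis unfolding Tn_def eq[symmetric] by (rule has_integral_mult_right[OF ibp])
      qed
      then have "((\<lambda>x. \<Sum>n<N. Tn n x) has_integral (\<Sum>n<N. (of_real pi * \<i> * of_int \<xi> / of_real q) * h (int n))) {-1..1}"
        by (intro has_integral_sum) auto
      moreover have "(\<lambda>x. \<Sum>n<N. Tn n x) = T"
        unfolding Tn_def T_def W1_def W2_def sum_distrib_left
        by (auto simp: fun_eq_iff algebra_simps sum.distrib)
      ultimately show ?thesis by simp
    qed
    have bi: "((\<lambda>x. 2 * m * Bd * (1 / sqrt (1 - x\<^sup>2))) has_integral 2 * m * Bd * pi) {-1..1::real}"
      by (rule has_integral_mult_right[OF has_integral_inverse_sqrt])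
    have Tb: "norm (T x) \<le> 2 * m * Bd * (1 / sqrt (1 - x\<^sup>2))" if "x \<in> {-1..1}" for x
    proof (cases "\<bar>x\<bar> < 1")
      case True
      have "norm (T x) \<le> norm (theta_infty' k x * W1 x) + norm ((theta_infty k x * (x / (1 - x\<^sup>2))) * W2 x)"
        unfolding T_def by (rule norm_triangle_ineq)
      also have "\<dots> = \<bar>theta_infty' k x\<bar> * norm (W1 x) + \<bar>theta_infty k x * (x / (1 - x\<^sup>2))\<bar> * norm (W2 x)"
        by (simp only: norm_mult norm_of_real flip: of_real_mult)
      also have "\<dots> \<le> m * (1 / sqrt (1 - x\<^sup>2)) * Bd + m * (1 / sqrt (1 - x\<^sup>2)) * Bd"
        unfolding m_def using True Bd
        by (intro add_mono mult_mono abs_theta_infty'_le abs_theta_infty_quotient_le W1 W2) (auto simp: abs_square_le_1)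
      finally show ?thesis by (simp add: algebra_simps)
    next
      case False
      then have "x = 1 \<or> x = - 1" using that by auto
      \<comment> \<open>At the endpoints both quotients in \<open>T\<close>, and the majorant as
        well, are divisions by zero and hence 0.\<close>
      then have "T x = 0" by (auto simp: T_def theta_infty'_def)
      then show ?thesis using Bd \<open>x = 1 \<or> x = - 1\<close> by (auto simp: m_def)
    qed
    have "norm (integral {-1..1} T) \<le> integral {-1..1} (\<lambda>x. 2 * m * Bd * (1 / sqrt (1 - x\<^sup>2)))"
      by (rule integral_norm_bound_integral) (use Tint bi Tb in \<open>auto simp: integrable_on_def\<close>)
    then have "norm (\<Sum>n<N. (of_real pi * \<i> * of_int \<xi> / of_real q) * h (int n)) \<le> 2 * m * Bd * pi"
      using integral_unique[OF Tint] integral_unique[OF bi] by simp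
    then have "pi * z / q * norm (\<Sum>n<N. h (int n)) \<le> 2 * m * Bd * pi"
      using q by (simp only: sum_distrib_left[symmetric] norm_mult norm_divide) (simp add: z_def)
    then have "norm (\<Sum>n<N. h (int n)) \<le> 2 * m * Bd * q / z"
      using q z by (simp add: field_simps)
    also have "2 * m * Bd * q / z \<le> C * sobolev_norm M G * X * (q\<^sup>2 / z) * (q / X + z / sqrt X) ^ M"
    proof -
      \<comment> \<open>The 1 yields \<open>q / X\<close>, from derivatives of \<open>G\<close> and
        \<open>g\<close>; \<open>\<gamma>0\<close> yields \<open>z / sqrt X\<close>, from the phase,
        with \<open>q\<close> cancelling.\<close>
      have "2 * q * (CC * (1 + \<gamma>0)) / X = (2 * CC) * (q / X + z * (sqrt X / X) / 2)"
        using q X by (simp add: \<gamma>0_def field_simps)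
      also have "sqrt X / X = 1 / sqrt X" using X by (simp add: real_div_sqrt divide_simps)
      also have "(2 * CC) * (q / X + z * (1 / sqrt X) / 2) \<le> (2 * CC) * (q / X + z / sqrt X)"
        using C1(1) C2(1) z X by (intro mult_left_mono add_left_mono) (auto simp: CC_def field_simps)
      finally have le: "2 * q * (CC * (1 + \<gamma>0)) / X \<le> (2 * CC) * (q / X + z / sqrt X)" .
      have "Bd \<le> 4 * q * X * ((2 * CC) * (q / X + z / sqrt X)) ^ M * M * (K * sobolev_norm M G)"
        unfolding Bd_def using q X K(1) S0 \<gamma>0 C1(1) C2(1)
        by (intro mult_right_mono mult_left_mono power_mono le) (auto simp: CC_def)
      then have "2 * m * Bd * q / z \<le> 2 * m * (4 * q * X * ((2 * CC) * (q / X + z / sqrt X)) ^ M * M * (K * sobolev_norm M G)) * q / z"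
        using q z by (intro divide_right_mono mult_right_mono mult_left_mono) (auto simp: m_def)
      also have "\<dots> = C * sobolev_norm M G * X * (q\<^sup>2 / z) * (q / X + z / sqrt X) ^ M"
        by (simp add: C_def power_mult_distrib power2_eq_square)
      finally show ?thesis .
    qed
    finally show ?thesis
      using sum_nonzero_weight_eq[OF G X(1) _ N, of h] by (simp add: h_def q_def z_def)
  qed
  ultimately show ?thesis by blast
qed

section \<open>The sums over l, f and the frequencies\<close>

lemma sum_powr_le:
  assumes "finite A" "s < -1"
  shows "(\<Sum>n\<in>A. real n powr s) \<le> (\<Sum>n. real n powr s)"
  by (rule sum_le_suminf) (use assms in \<open>auto simp: summable_real_powr_iff\<close>)

lemma sum_int_powr_le:
  fixes A :: "int set"
  assumes "finite A" "s < -1"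
  shows "(\<Sum>n\<in>A. \<bar>real_of_int n\<bar> powr s) \<le> 2 * (\<Sum>n. real n powr s)"
proof -
  have *: "(\<Sum>n\<in>B. \<bar>real_of_int n\<bar> powr s) \<le> (\<Sum>n. real n powr s)"
    if "finite B" "inj_on (\<lambda>n. nat \<bar>n\<bar>) B" for B :: "int set"
  proof -
    have "(\<Sum>n\<in>B. \<bar>real_of_int n\<bar> powr s) = (\<Sum>n\<in>(\<lambda>n. nat \<bar>n\<bar>) ` B. real n powr s)"
      using that(2) by (subst sum.reindex) auto
    also have "\<dots> \<le> (\<Sum>n. real n powr s)" by (rule sum_powr_le) (use that assms in auto)
    finally show ?thesis .
  qed
  have "(\<Sum>n\<in>A. \<bar>real_of_int n\<bar> powr s) =
      (\<Sum>n\<in>{n\<in>A. n \<ge> 0}. \<bar>real_of_int n\<bar> powr s) + (\<Sum>n\<in>{n\<in>A. n < 0}. \<bar>real_of_int n\<bar> powr s)"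
    using assms(1) by (subst sum.union_disjoint[symmetric]) (auto intro!: sum.cong)
  also have "\<dots> \<le> (\<Sum>n. real n powr s) + (\<Sum>n. real n powr s)"
    by (intro add_mono *) (use assms in \<open>auto simp: inj_on_def\<close>)
  finally show ?thesis by simp
qed

definition lf_set :: "real \<Rightarrow> real \<Rightarrow> (nat \<times> nat) set" where
  "lf_set a b = {(l::nat, f::nat). l \<ge> 1 \<and> f \<ge> 1 \<and> a \<le> real l * (real f)\<^sup>2 \<and> real l * (real f)\<^sup>2 \<le> b}"

definition xi_set :: "real \<Rightarrow> real \<Rightarrow> nat \<Rightarrow> nat \<Rightarrow> int set" where
  "xi_set a b l f = {\<xi>::int. \<xi> \<noteq> 0 \<and> real l * (real f)\<^sup>2 * \<bar>real_of_int \<xi>\<bar> \<le> a \<and> \<bar>real_of_int \<xi>\<bar> \<le> b}"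

lemma lf_set_subset: "b \<le> B \<Longrightarrow> lf_set a b \<subseteq> {..nat \<lfloor>B\<rfloor>} \<times> {..nat \<lfloor>B\<rfloor>}"
proof
  fix p assume "p \<in> lf_set a b" "b \<le> B"
  then obtain l f where p: "p = (l, f)" and lf: "l \<ge> 1" "f \<ge> 1" "real l * (real f)\<^sup>2 \<le> B"
    by (auto simp: lf_set_def)
  have f2: "real f \<le> (real f)\<^sup>2" "1 \<le> (real f)\<^sup>2" using lf(2) by (auto intro: self_le_power one_le_power)
  have "real l * 1 \<le> real l * (real f)\<^sup>2" using f2 by (intro mult_left_mono) auto
  moreover have "1 * (real f)\<^sup>2 \<le> real l * (real f)\<^sup>2" using lf by (intro mult_right_mono) auto
  ultimately have "real l \<le> B" "real f \<le> B" using lf(3) f2 by linarith+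
  then have "l \<le> nat \<lfloor>B\<rfloor>" "f \<le> nat \<lfloor>B\<rfloor>" by (simp_all add: le_nat_floor)
  then show "p \<in> {..nat \<lfloor>B\<rfloor>} \<times> {..nat \<lfloor>B\<rfloor>}" by (simp add: p)
qed

lemma xi_set_subset: "b \<le> B \<Longrightarrow> xi_set a b l f \<subseteq> {- \<lfloor>B\<rfloor>..\<lfloor>B\<rfloor>}"
proof
  fix \<xi> assume "b \<le> B" "\<xi> \<in> xi_set a b l f"
  then have "\<bar>real_of_int \<xi>\<bar> \<le> B" by (auto simp: xi_set_def)
  then have "\<bar>\<xi>\<bar> \<le> \<lfloor>B\<rfloor>" by (simp add: le_floor_iff)
  then show "\<xi> \<in> {- \<lfloor>B\<rfloor>..\<lfloor>B\<rfloor>}" by auto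
qed

lemma finite_lf_set [simp]: "finite (lf_set a b)"
  by (rule finite_subset[OF lf_set_subset[OF order_refl]]) auto

lemma finite_xi_set [simp]: "finite (xi_set a b l f)"
  by (rule finite_subset[OF xi_set_subset[OF order_refl]]) auto

lemma norm_double_sum_le:
  fixes h :: "nat \<Rightarrow> nat \<Rightarrow> int \<Rightarrow> complex"
  assumes "\<And>l f \<xi>. (l, f) \<in> P \<Longrightarrow> \<xi> \<in> Q l f \<Longrightarrow> norm (h l f \<xi>) \<le> b l f \<xi>"
  shows "norm (\<Sum>(l, f)\<in>P. \<Sum>\<xi>\<in>Q l f. h l f \<xi>) \<le> (\<Sum>(l, f)\<in>P. \<Sum>\<xi>\<in>Q l f. b l f \<xi>)"
  by (intro order_trans[OF norm_sum] sum_mono)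
     (auto split: prod.splits intro!: order_trans[OF norm_sum] sum_mono assms)

text \<open>The cancellation lies in the sum over \<open>n\<close>, which is therefore moved
  innermost; the ranges of \<open>l\<close>, \<open>f\<close> and \<open>\<xi>\<close> do not depend
  on \<open>n\<close>.\<close>

lemma S_eq:
  "S k c1 c2 c3 c4 G X \<kappa> \<alpha> =
   (\<Sum>(l, f)\<in>lf_set (c1 * X powr (1/4 - \<kappa>)) (c2 * X powr (1/2 + \<kappa>)).
     \<Sum>\<xi>\<in>xi_set (c3 * X powr (1/2 + \<kappa>)) (c4 * X powr (1/6 + \<kappa> + \<alpha>)) l f.
       1 / ((of_nat l)\<^sup>2 * (of_nat f) ^ 3) *
       (\<Sum>n::int | G (real_of_int n / X) \<noteq> 0.
          G (real_of_int n / X) * complex_of_real (sqrt (real_of_int n)) * (Kl l f \<xi> n * I_int k l f \<xi> n)))"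
  (is "_ = (\<Sum>(l, f)\<in>?P. \<Sum>\<xi>\<in>?Q l f. _ * (\<Sum>n\<in>?N. _))")
proof -
  have "S k c1 c2 c3 c4 G X \<kappa> \<alpha> = (\<Sum>n\<in>?N. \<Sum>p\<in>?P. case p of (l, f) \<Rightarrow> \<Sum>\<xi>\<in>?Q l f.
      1 / ((of_nat l)\<^sup>2 * (of_nat f) ^ 3) * (G (real_of_int n / X) * complex_of_real (sqrt (real_of_int n)) * (Kl l f \<xi> n * I_int k l f \<xi> n)))"
    unfolding S_def lf_set_def[symmetric] xi_set_def[symmetric] sum_distrib_left
    by (intro sum.cong refl) (auto simp: sum_distrib_left mult_ac split: prod.splits intro!: sum.cong)
  also have "\<dots> = (\<Sum>p\<in>?P. \<Sum>n\<in>?N. case p of (l, f) \<Rightarrow> \<Sum>\<xi>\<in>?Q l f.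
      1 / ((of_nat l)\<^sup>2 * (of_nat f) ^ 3) * (G (real_of_int n / X) * complex_of_real (sqrt (real_of_int n)) * (Kl l f \<xi> n * I_int k l f \<xi> n)))"
    by (rule sum.swap)
  also have "\<dots> = (\<Sum>(l, f)\<in>?P. \<Sum>\<xi>\<in>?Q l f.
       1 / ((of_nat l)\<^sup>2 * (of_nat f) ^ 3) *
       (\<Sum>n\<in>?N. G (real_of_int n / X) * complex_of_real (sqrt (real_of_int n)) * (Kl l f \<xi> n * I_int k l f \<xi> n)))"
    unfolding sum_distrib_left by (intro sum.cong refl) (auto split: prod.splits intro: sum.swap)
  finally show ?thesis .
qed

text \<open>All index sets lie in the boxes belonging to \<open>X0\<close>, because the exponents of
  \<open>X\<close> in the upper bounds are positive. Kloosterman sums and integrals there are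
  finitely many fixed numbers, and \<open>G\<close> enters only through its supremum.\<close>

lemma S_bound_small:
  assumes c: "c1 > 0" "c2 > 0" "c3 > 0" "c4 > 0" and M: "M \<ge> 1" and pos: "\<kappa> > 0" "\<alpha> > 0" and X0: "X0 \<ge> 2"
  shows "\<exists>C\<ge>0. \<forall>G \<in> Cc_infty {1/4..5/4}. \<forall>X. 2 \<le> X \<longrightarrow> X \<le> X0 \<longrightarrow>
    norm (S k c1 c2 c3 c4 G X \<kappa> \<alpha>) \<le> C * sobolev_norm M G"
proof -
  define B1 where "B1 = nat \<lfloor>c2 * X0 powr (1/2 + \<kappa>)\<rfloor>"
  define B2 where "B2 = \<lfloor>c4 * X0 powr (1/6 + \<kappa> + \<alpha>)\<rfloor>"
  define N where "N = nat \<lceil>2 * X0\<rceil>"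
  define C where "C = (\<Sum>(l, f)\<in>{..B1} \<times> {..B1}. \<Sum>\<xi>\<in>{- B2..B2}. \<Sum>n<N.
      sqrt (real n) * norm (Kl l f \<xi> (int n) * I_int k l f \<xi> (int n)))"
  have "C \<ge> 0" unfolding C_def by (intro sum_nonneg) (auto intro!: sum_nonneg split: prod.splits)
  moreover have "norm (S k c1 c2 c3 c4 G X \<kappa> \<alpha>) \<le> C * sobolev_norm M G"
    if G: "G \<in> Cc_infty {1/4..5/4}" and X: "2 \<le> X" "X \<le> X0" for G X
  proof -
    let ?P = "lf_set (c1 * X powr (1/4 - \<kappa>)) (c2 * X powr (1/2 + \<kappa>))"
    let ?Q = "xi_set (c3 * X powr (1/2 + \<kappa>)) (c4 * X powr (1/6 + \<kappa> + \<alpha>))"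
    let ?s = "sobolev_norm M G"
    have s: "?s \<ge> 0" by (rule sobolev_norm_nonneg[OF G])
    have P: "?P \<subseteq> {..B1} \<times> {..B1}" unfolding B1_def
      using c pos X by (intro lf_set_subset mult_left_mono powr_mono2) auto
    have Q: "?Q l f \<subseteq> {- B2..B2}" for l f unfolding B2_def
      using c pos X by (intro xi_set_subset mult_left_mono powr_mono2) auto
    have N: "real N \<ge> 2 * X" using X unfolding N_def by linarith
    let ?n = "\<lambda>l f \<xi>. \<Sum>n<N. sqrt (real n) * norm (Kl l f \<xi> (int n) * I_int k l f \<xi> (int n))"
    have inner: "norm (1 / ((of_nat l)\<^sup>2 * (of_nat f) ^ 3) *
       (\<Sum>n::int | G (real_of_int n / X) \<noteq> 0.
          G (real_of_int n / X) * complex_of_real (sqrt (real_of_int n)) * (Kl l f \<xi> n * I_int k l f \<xi> n))) \<le> ?s * ?n l f \<xi>"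
      if "(l, f) \<in> ?P" for l f \<xi>
    proof -
      have lf: "l \<ge> 1" "f \<ge> 1" using that by (auto simp: lf_set_def)
      have "norm (\<Sum>n::int | G (real_of_int n / X) \<noteq> 0.
          G (real_of_int n / X) * complex_of_real (sqrt (real_of_int n)) * (Kl l f \<xi> n * I_int k l f \<xi> n)) =
         norm (\<Sum>n<N. G (real_of_int (int n) / X) * complex_of_real (sqrt (real_of_int (int n))) * (Kl l f \<xi> (int n) * I_int k l f \<xi> (int n)))"
        using sum_nonzero_weight_eq[OF G _ _ N, of "\<lambda>n. G (real_of_int n / X) * complex_of_real (sqrt (real_of_int n)) * (Kl l f \<xi> n * I_int k l f \<xi> n)"] X
        by simp
      also have "\<dots> \<le> (\<Sum>n<N. ?s * (sqrt (real n) * norm (Kl l f \<xi> (int n) * I_int k l f \<xi> (int n))))"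
      proof (intro order_trans[OF norm_sum] sum_mono)
        fix n
        have "norm (G (real n / X)) * (sqrt (real n) * norm (Kl l f \<xi> (int n) * I_int k l f \<xi> (int n)))
          \<le> ?s * (sqrt (real n) * norm (Kl l f \<xi> (int n) * I_int k l f \<xi> (int n)))"
          by (intro mult_right_mono norm_le_sobolev_norm[OF G M]) auto
        then show "norm (G (real_of_int (int n) / X) * complex_of_real (sqrt (real_of_int (int n))) * (Kl l f \<xi> (int n) * I_int k l f \<xi> (int n)))
          \<le> ?s * (sqrt (real n) * norm (Kl l f \<xi> (int n) * I_int k l f \<xi> (int n)))"
          by (simp add: norm_mult mult_ac)
      qed
      finally have le: "norm (\<Sum>n::int | G (real_of_int n / X) \<noteq> 0.
          G (real_of_int n / X) * complex_of_real (sqrt (real_of_int n)) * (Kl l f \<xi> n * I_int k l f \<xi> n)) \<le> ?s * ?n l f \<xi>"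
        by (simp add: sum_distrib_left)
      have "(1::real) \<le> (real l)\<^sup>2 * (real f) ^ 3"
        using mult_mono[of 1 "(real l)\<^sup>2" 1 "real f ^ 3"] lf by (simp add: one_le_power)
      then have le1: "norm (1 / ((of_nat l)\<^sup>2 * (of_nat f) ^ 3) :: complex) \<le> 1"
        by (simp add: norm_divide norm_mult norm_power divide_le_eq_1)
      have "norm (1 / ((of_nat l)\<^sup>2 * (of_nat f) ^ 3) *
         (\<Sum>n::int | G (real_of_int n / X) \<noteq> 0.
            G (real_of_int n / X) * complex_of_real (sqrt (real_of_int n)) * (Kl l f \<xi> n * I_int k l f \<xi> n))) \<le> 1 * (?s * ?n l f \<xi>)"
        unfolding norm_mult[of "1 / ((of_nat l)\<^sup>2 * (of_nat f) ^ 3)"] by (intro mult_mono le1 le) auto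
      then show ?thesis by simp
    qed
    have "norm (S k c1 c2 c3 c4 G X \<kappa> \<alpha>) \<le> (\<Sum>(l, f)\<in>?P. \<Sum>\<xi>\<in>?Q l f. ?s * ?n l f \<xi>)"
      unfolding S_eq
      by (rule norm_double_sum_le) (rule inner)
    also have "\<dots> \<le> (\<Sum>(l, f)\<in>?P. \<Sum>\<xi>\<in>{- B2..B2}. ?s * ?n l f \<xi>)"
      using s by (intro sum_mono) (auto split: prod.splits intro!: sum_mono2 Q mult_nonneg_nonneg sum_nonneg)
    also have "\<dots> \<le> (\<Sum>(l, f)\<in>{..B1} \<times> {..B1}. \<Sum>\<xi>\<in>{- B2..B2}. ?s * ?n l f \<xi>)"
      using s by (intro sum_mono2 P) (auto split: prod.splits intro!: mult_nonneg_nonneg sum_nonneg)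
    also have "\<dots> = C * ?s"
      unfolding C_def by (simp add: sum_distrib_left sum_distrib_right case_prod_unfold mult_ac)
    finally show ?thesis .
  qed
  ultimately show ?thesis by blast
qed

text \<open>The target exponent leaves a factor \<open>X\<^sup>1\<^sup>/\<^sup>1\<^sup>2\<close> to spare. It pays for the exponent \<open>13/12\<close>, which turns
  the constraint \<open>q z \<le> c3 X\<^sup>1\<^sup>/\<^sup>2\<^sup>+\<^sup>\<kappa>\<close> into summable weights in \<open>l\<close>, \<open>f\<close> and \<open>z\<close>.\<close>

lemma frequency_term_bound:
  fixes X q z l f :: real
  assumes c: "c3 > 0" "c4 > 0" and M: "M \<ge> 1" and pos: "\<kappa> > 0" "\<alpha> > 0" and X: "X \<ge> 2"
    and lf: "l \<ge> 1" "f \<ge> 1" "q = l * f\<^sup>2" and z: "z \<ge> 1"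
    and qz: "q * z \<le> c3 * X powr (1/2 + \<kappa>)" and zY: "z \<le> c4 * X powr (1/6 + \<kappa> + \<alpha>)"
  shows "f / z * (q / X + z / sqrt X) ^ M \<le>
    (((1 + c3) * (1 + c4)) ^ M * 2 * c3 powr (13/12)) *
    X powr (5/12 + 2 * \<kappa> + \<alpha> - real M * (1/3 - \<kappa> - \<alpha>)) *
    (l powr (-13/12) * f powr (-7/6) * z powr (-13/12))"
proof -
  \<comment> \<open>In these units the gain of one step is \<open>Y / s\<close>, which is
    \<open>X powr (- (1/3 - \<kappa> - \<alpha>))\<close>: \<open>z / s\<close> is at most
    \<open>c4 * Y / s\<close>, and the constraint on \<open>q * z\<close> with
    \<open>z \<ge> 1\<close> makes \<open>q / X\<close> at most \<open>c3 * a / s\<close>, where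
    \<open>a \<le> Y\<close>.\<close>
  define a Y s where "a = X powr \<kappa>" and "Y = X powr (1/6 + \<kappa> + \<alpha>)" and "s = sqrt X"
  have sX: "s = X powr (1/2)" using X by (simp add: s_def powr_half_sqrt)
  have s: "s > 0" "s * s = X" using X by (auto simp: s_def)
  have a: "a \<ge> 1" using X pos by (simp add: a_def ge_one_powr_ge_zero)
  have aY: "a \<le> Y" unfolding a_def Y_def using X pos by (intro powr_mono) auto
  have Y: "Y > 0" using a aY by linarith
  have q: "q \<ge> 1"
    using mult_mono[of 1 l 1 "f\<^sup>2"] lf by (simp add: one_le_power)
  define g where "g = X powr (- (1/3 - \<kappa> - \<alpha>))"
  have g: "g = Y / s" unfolding g_def Y_def sX powr_diff[symmetric] by (simp add: algebra_simps)
  have qz': "q * z \<le> c3 * (s * a)" using qz by (simp add: sX a_def powr_add)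
  have "q / X \<le> q * z / X" using q z X by (intro divide_right_mono) (auto simp: mult_le_cancel_left1)
  also have "\<dots> \<le> c3 * (s * a) / X" using qz' X by (intro divide_right_mono) auto
  also have "\<dots> = c3 * a / s" unfolding s(2)[symmetric] using s(1) by simp
  finally have "q / X + z / s \<le> (c3 * a + z) / s" by (simp add: add_divide_distrib)
  also have "\<dots> \<le> ((1 + c3) * (a + z)) / s"
    using c a z s by (intro divide_right_mono) (auto simp: algebra_simps)
  also have "\<dots> = (1 + c3) * g * ((a + z) / Y)" using Y by (simp add: g)
  finally have d: "q / X + z / s \<le> (1 + c3) * g * ((a + z) / Y)" .
  \<comment> \<open>Of the \<open>M\<close> factors \<open>r\<close> all but one are bounded by
    \<open>1 + c4\<close>. The one kept, divided by \<open>z\<close>, is at most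
    \<open>2 * a / Y\<close>, a further saving of \<open>X powr (1/6 + \<alpha>)\<close>.\<close>
  define r where "r = (a + z) / Y"
  have r: "0 \<le> r" "r \<le> 1 + c4"
    using a aY z zY[folded Y_def] Y by (auto simp: r_def divide_le_eq algebra_simps)
  have rM: "r ^ M \<le> (1 + c4) ^ M * r"
  proof -
    obtain j where j: "M = Suc j" using M by (cases M) auto
    have "r ^ M \<le> (1 + c4) ^ j * r" unfolding j using power_mono[OF r(2,1), of j] r by (simp add: mult.commute mult_left_mono)
    also have "\<dots> \<le> (1 + c4) ^ M * r" using c r unfolding j by (intro mult_right_mono power_increasing) auto
    finally show ?thesis .
  qed
  have g0: "g \<ge> 0" by (simp add: g_def)
  have "(q / X + z / s) ^ M \<le> ((1 + c3) * g * r) ^ M"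
    unfolding r_def by (rule power_mono[OF d]) (use q z X s in auto)
  also have "\<dots> = ((1 + c3) ^ M * g ^ M) * r ^ M" by (simp add: power_mult_distrib)
  also have "\<dots> \<le> ((1 + c3) ^ M * g ^ M) * ((1 + c4) ^ M * r)"
    using c g0 by (intro mult_left_mono rM) auto
  also have "\<dots> = ((1 + c3) * (1 + c4)) ^ M * g ^ M * r" by (simp add: power_mult_distrib)
  finally have dM: "(q / X + z / s) ^ M \<le> ((1 + c3) * (1 + c4)) ^ M * g ^ M * r" .
  have rz: "r / z \<le> 2 * a / Y"
  proof -
    have "a + z \<le> a * z + a * z" using a z mult_left_mono[of 1 z a] mult_right_mono[of 1 a z] by linarith
    then have "(a + z) / (z * Y) \<le> (a * z + a * z) / (z * Y)" using Y z by (intro divide_right_mono) auto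
    also have "\<dots> = 2 * a / Y" using z by (simp add: divide_simps)
    finally show ?thesis by (simp add: r_def mult.commute)
  qed
  \<comment> \<open>\<open>t \<ge> 1\<close> is the constraint on \<open>q * z\<close>, so a power
    of \<open>t\<close> may be inserted for free. An exponent above 1 makes \<open>l\<close> and
    \<open>z\<close> summable; as \<open>q\<close> contains \<open>f^2\<close>, the extra factor
    \<open>f\<close> leaves \<open>f powr (1 - 13/6)\<close>, summable too.\<close>
  define t where "t = c3 * (s * a) / (q * z)"
  have "t \<ge> 1" using qz' q z by (simp add: t_def le_divide_eq)
  then have t: "t powr (13/12) \<ge> 1" by (rule ge_one_powr_ge_zero) simp
  have tp: "f * t powr (13/12) = c3 powr (13/12) * (s * a) powr (13/12) * (l powr (-13/12) * f powr (-7/6) * z powr (-13/12))"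
  proof -
    have "t powr (13/12) = c3 powr (13/12) * (s * a) powr (13/12) * (q * z) powr (-13/12)"
      using c s a q z by (simp add: t_def powr_divide powr_mult powr_minus_divide)
    also have "(q * z) powr (-13/12) = l powr (-13/12) * (f\<^sup>2) powr (-13/12) * z powr (-13/12)"
      using lf z by (simp add: powr_mult)
    also have "(f\<^sup>2) powr (-13/12) = f powr (-13/6)"
      using lf powr_powr[of f 2 "-13/12"] by (simp add: powr_numeral)
    finally have "f * t powr (13/12) = c3 powr (13/12) * (s * a) powr (13/12) * (l powr (-13/12) * (f * f powr (-13/6)) * z powr (-13/12))"
      by (simp only: mult_ac)
    moreover have "f * f powr (-13/6) = f powr (-7/6)"
      using lf powr_add[of f 1 "-13/6"] by simp
    ultimately show ?thesis by (simp only:)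
  qed
  have "f / z * (q / X + z / s) ^ M \<le> f / z * (((1 + c3) * (1 + c4)) ^ M * g ^ M * r)"
    using lf z by (intro mult_left_mono dM) auto
  also have "\<dots> = (((1 + c3) * (1 + c4)) ^ M * g ^ M * f) * (r / z)" by simp
  also have "\<dots> \<le> (((1 + c3) * (1 + c4)) ^ M * g ^ M * (f * t powr (13/12))) * (2 * a / Y)"
    using c g0 lf t r z a Y
    by (intro mult_mono rz mult_left_mono) (auto simp: mult_le_cancel_left1)
  also have "\<dots> = (((1 + c3) * (1 + c4)) ^ M * 2 * c3 powr (13/12)) * (g ^ M * (s * a) powr (13/12) * a / Y)
      * (l powr (-13/12) * f powr (-7/6) * z powr (-13/12))"
    unfolding tp by simp
  also have "g ^ M * (s * a) powr (13/12) * a / Y =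
      X powr (- (1/3 - \<kappa> - \<alpha>) * real M + (1/2 + \<kappa>) * (13/12) + \<kappa> - (1/6 + \<kappa> + \<alpha>))"
  proof -
    have "g ^ M = X powr (- (1/3 - \<kappa> - \<alpha>) * real M)"
      unfolding g_def using X by (simp add: powr_powr powr_realpow[symmetric])
    moreover have "(s * a) powr (13/12) = X powr ((1/2 + \<kappa>) * (13/12))"
      unfolding sX a_def powr_add[symmetric] by (rule powr_powr)
    ultimately show ?thesis unfolding a_def Y_def by (simp only: powr_add powr_diff)
  qed
  \<comment> \<open>Apart from the common term in \<open>M\<close>, the exponent obtained is
    \<open>3/8 + 13/12 * \<kappa> - \<alpha>\<close>, and 3/8 is below 5/12.\<close>
  also have "(((1 + c3) * (1 + c4)) ^ M * 2 * c3 powr (13/12)) *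
      X powr (- (1/3 - \<kappa> - \<alpha>) * real M + (1/2 + \<kappa>) * (13/12) + \<kappa> - (1/6 + \<kappa> + \<alpha>)) *
      (l powr (-13/12) * f powr (-7/6) * z powr (-13/12)) \<le>
    (((1 + c3) * (1 + c4)) ^ M * 2 * c3 powr (13/12)) *
    X powr (5/12 + 2 * \<kappa> + \<alpha> - real M * (1/3 - \<kappa> - \<alpha>)) *
    (l powr (-13/12) * f powr (-7/6) * z powr (-13/12))"
    using X c pos by (intro mult_right_mono mult_left_mono powr_mono) (auto simp: algebra_simps)
  finally show ?thesis unfolding s_def .
qed

text \<open>The last condition on \<open>X\<close> puts every admissible
  \<open>\<bar>\<xi>\<bar>\<close> below every admissible \<open>l f^2\<close>, as the vanishing
  over a period requires. Since \<open>q^2 / (l^2 f^3) = f\<close>,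
  \<open>frequency_term_bound\<close> applies to each term, and the sums over \<open>l\<close>,
  \<open>f\<close> and \<open>\<xi>\<close> are bounded by the convergent series \<open>Z\<close>,
  \<open>V\<close> and, for both signs of \<open>\<xi>\<close>, \<open>2 * Z\<close>.\<close>

lemma S_bound_large:
  assumes c: "c1 > 0" "c2 > 0" "c3 > 0" "c4 > 0" and M: "M \<ge> 1" and pos: "\<kappa> > 0" "\<alpha> > 0"
  shows "\<exists>C\<ge>0. \<forall>G \<in> Cc_infty {1/4..5/4}. \<forall>X. 2 \<le> X \<longrightarrow> 4 * real M \<le> X \<longrightarrow>
    c4 * X powr (1/6 + \<kappa> + \<alpha>) < c1 * X powr (1/4 - \<kappa>) \<longrightarrow>
    norm (S k c1 c2 c3 c4 G X \<kappa> \<alpha>) \<le>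
      C * (sobolev_norm M G * X powr (17/12 + 2 * \<kappa> + \<alpha> - real M * (1/3 - \<kappa> - \<alpha>)))"
proof -
  obtain C0 where C0: "C0 \<ge> 0" "\<And>G X l f \<xi>. G\<in>Cc_infty {1/4..5/4} \<Longrightarrow>
    X > 0 \<Longrightarrow> X \<ge> 4 * real M \<Longrightarrow> l > 0 \<Longrightarrow> f > 0 \<Longrightarrow> \<xi> \<noteq> 0 \<Longrightarrow> \<bar>\<xi>\<bar> < int l * (int f)\<^sup>2 \<Longrightarrow>
    norm (\<Sum>n::int | G (real_of_int n / X) \<noteq> 0.
        G (real_of_int n / X) * complex_of_real (sqrt (real_of_int n)) * (Kl l f \<xi> n * I_int k l f \<xi> n))
      \<le> C0 * sobolev_norm M G * X * ((real l * (real f)\<^sup>2)\<^sup>2 / \<bar>real_of_int \<xi>\<bar>)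
          * (real l * (real f)\<^sup>2 / X + \<bar>real_of_int \<xi>\<bar> / sqrt X) ^ M"
    using n_sum_bound[of M k] M by auto
  define D where "D = ((1 + c3) * (1 + c4)) ^ M * 2 * c3 powr (13/12)"
  have D: "D \<ge> 0" using c by (simp add: D_def)
  define Z where "Z = (\<Sum>n. real n powr (-13/12))"
  define V where "V = (\<Sum>n. real n powr (-7/6))"
  have Z: "Z \<ge> 0" and V: "V \<ge> 0"
    using sum_powr_le[of "{}" "-13/12"] sum_powr_le[of "{}" "-7/6"] by (auto simp: Z_def V_def)
  define C where "C = C0 * D * (2 * Z) * (Z * V)"
  have "C \<ge> 0" using C0(1) D Z V by (simp add: C_def)
  moreover have "norm (S k c1 c2 c3 c4 G X \<kappa> \<alpha>) \<le>
      C * (sobolev_norm M G * X powr (17/12 + 2 * \<kappa> + \<alpha> - real M * (1/3 - \<kappa> - \<alpha>)))"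
    if G: "G \<in> Cc_infty {1/4..5/4}" and X: "2 \<le> X" "4 * real M \<le> X"
      and sep: "c4 * X powr (1/6 + \<kappa> + \<alpha>) < c1 * X powr (1/4 - \<kappa>)" for G X
  proof -
    let ?P = "lf_set (c1 * X powr (1/4 - \<kappa>)) (c2 * X powr (1/2 + \<kappa>))"
    let ?Q = "xi_set (c3 * X powr (1/2 + \<kappa>)) (c4 * X powr (1/6 + \<kappa> + \<alpha>))"
    let ?s = "sobolev_norm M G"
    let ?E = "5/12 + 2 * \<kappa> + \<alpha> - real M * (1/3 - \<kappa> - \<alpha>)"
    have s: "?s \<ge> 0" by (rule sobolev_norm_nonneg[OF G])
    define B where "B = C0 * ?s * X * D * X powr ?E"
    have B: "B \<ge> 0" using C0(1) s X D by (simp add: B_def)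
    let ?u = "\<lambda>l. real l powr (-13/12)" and ?v = "\<lambda>f. real f powr (-7/6)" and ?w = "\<lambda>\<xi>. \<bar>real_of_int \<xi>\<bar> powr (-13/12)"
    have inner: "norm (1 / ((of_nat l)\<^sup>2 * (of_nat f) ^ 3) *
       (\<Sum>n::int | G (real_of_int n / X) \<noteq> 0.
          G (real_of_int n / X) * complex_of_real (sqrt (real_of_int n)) * (Kl l f \<xi> n * I_int k l f \<xi> n)))
        \<le> B * (?u l * ?v f * ?w \<xi>)"
      if P: "(l, f) \<in> ?P" and Q: "\<xi> \<in> ?Q l f" for l f \<xi>
    proof -
      define q where "q = real l * (real f)\<^sup>2"
      define z where "z = \<bar>real_of_int \<xi>\<bar>"
      have lf: "l \<ge> 1" "f \<ge> 1" "c1 * X powr (1/4 - \<kappa>) \<le> q" using P by (auto simp: lf_set_def q_def)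
      have xi: "\<xi> \<noteq> 0" "q * z \<le> c3 * X powr (1/2 + \<kappa>)" "z \<le> c4 * X powr (1/6 + \<kappa> + \<alpha>)"
        using Q by (auto simp: xi_set_def q_def z_def)
      have z: "z \<ge> 1" using xi(1) unfolding z_def by linarith
      have "z < q" using xi(3) sep lf(3) by linarith
      then have "real_of_int \<bar>\<xi>\<bar> < real_of_int (int l * (int f)\<^sup>2)" by (simp add: z_def q_def)
      then have "\<bar>\<xi>\<bar> < int l * (int f)\<^sup>2" by (simp only: of_int_less_iff)
      with C0(2)[OF G, of X l f \<xi>] X lf xi(1)
      have "norm (\<Sum>n::int | G (real_of_int n / X) \<noteq> 0.
          G (real_of_int n / X) * complex_of_real (sqrt (real_of_int n)) * (Kl l f \<xi> n * I_int k l f \<xi> n))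
          \<le> C0 * ?s * X * (q\<^sup>2 / z) * (q / X + z / sqrt X) ^ M"
        by (simp add: q_def z_def)
      then have "norm (1 / ((of_nat l)\<^sup>2 * (of_nat f) ^ 3) *
       (\<Sum>n::int | G (real_of_int n / X) \<noteq> 0.
          G (real_of_int n / X) * complex_of_real (sqrt (real_of_int n)) * (Kl l f \<xi> n * I_int k l f \<xi> n)))
        \<le> 1 / ((real l)\<^sup>2 * (real f) ^ 3) * (C0 * ?s * X * (q\<^sup>2 / z) * (q / X + z / sqrt X) ^ M)"
        unfolding norm_mult by (intro mult_mono) (auto simp: norm_divide norm_mult norm_power)
      also have "\<dots> = C0 * ?s * X * (real f / z * (q / X + z / sqrt X) ^ M)"
      proof -
        have "1 / ((real l)\<^sup>2 * (real f) ^ 3) * q\<^sup>2 = real f"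
          using lf by (simp add: q_def power_mult_distrib power2_eq_square power3_eq_cube)
        moreover have "1 / ((real l)\<^sup>2 * (real f) ^ 3) * (C0 * ?s * X * (q\<^sup>2 / z) * (q / X + z / sqrt X) ^ M) =
            C0 * ?s * X * ((1 / ((real l)\<^sup>2 * (real f) ^ 3) * q\<^sup>2) / z * (q / X + z / sqrt X) ^ M)"
          by simp
        ultimately show ?thesis by (simp only:)
      qed
      also have "\<dots> \<le> C0 * ?s * X * (D * X powr ?E * (?u l * ?v f * z powr (-13/12)))"
        unfolding D_def using C0(1) s X
        by (intro mult_left_mono frequency_term_bound[OF c(3,4) M pos X(1) _ _ q_def z xi(2,3)]) (use lf in auto)
      finally show ?thesis by (simp add: B_def z_def mult_ac)
    qed
    have "norm (S k c1 c2 c3 c4 G X \<kappa> \<alpha>) \<le> (\<Sum>(l, f)\<in>?P. \<Sum>\<xi>\<in>?Q l f. B * (?u l * ?v f * ?w \<xi>))"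
      unfolding S_eq
      by (rule norm_double_sum_le) (rule inner)
    also have "\<dots> = (\<Sum>(l, f)\<in>?P. B * (?u l * ?v f) * (\<Sum>\<xi>\<in>?Q l f. ?w \<xi>))"
      by (simp add: sum_distrib_left mult.assoc)
    also have "\<dots> \<le> (\<Sum>(l, f)\<in>?P. B * (?u l * ?v f) * (2 * Z))"
      unfolding Z_def using B
      by (intro sum_mono) (auto split: prod.splits intro!: mult_left_mono sum_int_powr_le)
    \<comment> \<open>Enlarging the index set to the product of its projections lets the nonnegative
      double sum factor.\<close>
    also have "\<dots> \<le> (\<Sum>(l, f)\<in>fst ` ?P \<times> snd ` ?P. B * (?u l * ?v f) * (2 * Z))"
      using B Z by (intro sum_mono2) (auto split: prod.splits intro: rev_image_eqI)
    also have "\<dots> = B * (2 * Z) * ((\<Sum>l\<in>fst ` ?P. ?u l) * (\<Sum>f\<in>snd ` ?P. ?v f))"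
      unfolding sum.cartesian_product[symmetric] sum_product unfolding sum_distrib_left
      by (intro sum.cong refl) (simp only: mult_ac)
    also have "\<dots> \<le> B * (2 * Z) * (Z * V)"
      using B Z unfolding Z_def V_def
      by (intro mult_left_mono mult_mono sum_powr_le) (auto intro!: sum_nonneg)
    also have "\<dots> = C * (?s * (X * X powr ?E))" by (simp add: B_def C_def)
    also have "X * X powr ?E = X powr (17/12 + 2 * \<kappa> + \<alpha> - real M * (1/3 - \<kappa> - \<alpha>))"
      using X powr_add[of X 1 ?E] by (simp add: algebra_simps)
    finally show ?thesis .
  qed
  ultimately show ?thesis by blast
qed

theorem theorem4p15:
  fixes k M :: nat and c1 c2 c3 c4 \<kappa> \<alpha> :: real
  assumes "k > 2" and "even k"
    and "c1 > 0" and "c2 > 0" and "c3 > 0" and "c4 > 0"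
    and "M \<ge> 2" and "\<kappa> > 0" and "\<alpha> > 0" and "2 * \<kappa> + \<alpha> < 1 / 12"
  shows "\<exists>C>0. \<forall>G \<in> Cc_infty {1/4..5/4}. \<forall>X::real. X \<ge> 2 \<longrightarrow>
           norm (S k c1 c2 c3 c4 G X \<kappa> \<alpha>)
             \<le> C * (sobolev_norm M G
                     * X powr (17/12 + 2 * \<kappa> + \<alpha> - real M * (1/3 - \<kappa> - \<alpha>)) * ln X)"
proof -
  define E where "E = 17/12 + 2 * \<kappa> + \<alpha> - real M * (1/3 - \<kappa> - \<alpha>)"
  \<comment> \<open>\<open>X powr d\<close> is the ratio of \<open>X powr (1/4 - \<kappa>)\<close>
    to \<open>X powr (1/6 + \<kappa> + \<alpha>)\<close>; from \<open>X0\<close> on it exceeds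
    \<open>c4 / c1\<close>.\<close>
  define d where "d = 1/12 - 2 * \<kappa> - \<alpha>"
  have d: "d > 0" using assms by (simp add: d_def)
  define X0 where "X0 = Max {2, 4 * real M, (c4 / c1 + 1) powr (1 / d)}"
  have X0: "X0 \<ge> 2" "X0 \<ge> 4 * real M" "X0 \<ge> (c4 / c1 + 1) powr (1 / d)" by (auto simp: X0_def)
  have sep: "c4 * X powr (1/6 + \<kappa> + \<alpha>) < c1 * X powr (1/4 - \<kappa>)" if "X \<ge> X0" for X
  proof -
    have X: "X \<ge> 2" "X \<ge> (c4 / c1 + 1) powr (1 / d)" using that X0 by linarith+
    have p: "c4 / c1 + 1 > 0" using assms by (simp add: add_pos_pos)
    have "c4 / c1 + 1 = ((c4 / c1 + 1) powr (1 / d)) powr d" using d p by (simp add: powr_powr)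
    also have "\<dots> \<le> X powr d" using X d by (intro powr_mono2) auto
    finally have "c4 < c1 * X powr d" using assms by (simp add: field_simps)
    then have "c4 * X powr (1/6 + \<kappa> + \<alpha>) < c1 * X powr d * X powr (1/6 + \<kappa> + \<alpha>)"
      using X by (intro mult_strict_right_mono) auto
    also have "\<dots> = c1 * X powr (1/4 - \<kappa>)"
      unfolding mult.assoc powr_add[symmetric] by (simp add: d_def algebra_simps)
    finally show ?thesis .
  qed
  have M1: "M \<ge> 1" using assms by simp
  obtain CL where CL: "CL \<ge> 0" "\<And>G X. G \<in> Cc_infty {1/4..5/4} \<Longrightarrow> 2 \<le> X \<Longrightarrow> 4 * real M \<le> X \<Longrightarrow>
    c4 * X powr (1/6 + \<kappa> + \<alpha>) < c1 * X powr (1/4 - \<kappa>) \<Longrightarrow>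
    norm (S k c1 c2 c3 c4 G X \<kappa> \<alpha>) \<le> CL * (sobolev_norm M G * X powr E)"
    using S_bound_large[OF assms(3-6) M1 assms(8,9), of k] unfolding E_def by blast
  obtain CS where CS: "CS \<ge> 0" "\<And>G X. G \<in> Cc_infty {1/4..5/4} \<Longrightarrow> 2 \<le> X \<Longrightarrow> X \<le> X0 \<Longrightarrow>
    norm (S k c1 c2 c3 c4 G X \<kappa> \<alpha>) \<le> CS * sobolev_norm M G"
    using S_bound_small[OF assms(3-6) M1 assms(8,9) X0(1), of k] by blast
  \<comment> \<open>\<open>E\<close> may have either sign, so the minimum of \<open>X powr E\<close>
    on \<open>{2..X0}\<close> is taken at one of the two ends.\<close>
  define mn where "mn = min (2 powr E) (X0 powr E)"
  have mn: "mn > 0" using X0 by (simp add: mn_def)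
  have mn_le: "mn \<le> X powr E" if "2 \<le> X" "X \<le> X0" for X
  proof (cases "E \<ge> 0")
    case True
    then have "2 powr E \<le> X powr E" using that by (intro powr_mono2) auto
    then show ?thesis by (simp add: mn_def)
  next
    case False
    then have "X0 powr E \<le> X powr E" using that by (intro powr_mono2') auto
    then show ?thesis by (simp add: mn_def)
  qed
  \<comment> \<open>Dividing by \<open>ln 2\<close> brings in the logarithm, as
    \<open>ln X \<ge> ln 2\<close>; the summand 1 makes \<open>C\<close> positive.\<close>
  define C where "C = (CL + CS / mn + 1) / ln 2"
  have ln2: "ln (2::real) > 0" by simp
  have C: "C > 0" using CL(1) CS(1) mn ln2 by (simp add: C_def add_nonneg_pos)
  have "norm (S k c1 c2 c3 c4 G X \<kappa> \<alpha>) \<le> C * (sobolev_norm M G * X powr E * ln X)"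
    if G: "G \<in> Cc_infty {1/4..5/4}" and X: "X \<ge> 2" for G X
  proof -
    let ?s = "sobolev_norm M G"
    have s: "?s \<ge> 0" by (rule sobolev_norm_nonneg[OF G])
    have "norm (S k c1 c2 c3 c4 G X \<kappa> \<alpha>) \<le> (CL + CS / mn + 1) * (?s * X powr E)"
    proof (cases "X \<le> X0")
      case True
      have "norm (S k c1 c2 c3 c4 G X \<kappa> \<alpha>) \<le> CS * ?s" using CS(2)[OF G X True] .
      also have "\<dots> = CS / mn * (?s * mn)" using mn by simp
      also have "\<dots> \<le> (CL + CS / mn + 1) * (?s * X powr E)"
        using CL(1) CS(1) mn s mn_le[OF X True] by (intro mult_mono mult_left_mono) auto
      finally show ?thesis .
    next
      case False
      then have "norm (S k c1 c2 c3 c4 G X \<kappa> \<alpha>) \<le> CL * (?s * X powr E)"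
        using X0 by (intro CL(2)[OF G X] sep) auto
      also have "\<dots> \<le> (CL + CS / mn + 1) * (?s * X powr E)"
        using CS(1) mn s by (intro mult_right_mono) auto
      finally show ?thesis .
    qed
    also have "\<dots> = C * (?s * X powr E * ln 2)" using ln2 by (simp add: C_def)
    also have "\<dots> \<le> C * (?s * X powr E * ln X)"
      using C s X by (intro mult_left_mono) auto
    finally show ?thesis .
  qed
  then show ?thesis unfolding E_def using C by blast
qed

end
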